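(* Let $a_1=\cdots=a_N=a\in\mathbb{R}$. Then $\Phi=\{\phi_{i,k}\mid1\le i\le N,\ k\in\mathbb{N}\}$ is a Riesz basis of $\mathcal{H}^0$. Moreover, $\mathcal{A}$ generates a $C_0$-semigroup.
   Context: $N$ is a positive integer, $\mathbb{N}=\{0,1,2,\ldots\}$, $\mathcal{H}^0=(L^2(0,1))^N$ with its usual inner product. The operator $\mathcal{A}$ on $\mathcal{H}^0$ is $\mathcal{A}(f^j)_{1\le j\le N}=((f^j)''+af^j)_{1\le j\le N}$ on the domain $D(\mathcal{A})$ of all $(f^j)\in(H^2(0,1))^N$ with $(f^N)'(0)=(f^N)'(1)=0$ and $(f^j)'(0)=f^{j+1}(1)$, $(f^j)'(1)=0$ for $1\le j\le N-1$. The functions $\sigma_k^n$ on $[0,1]$ and reals $\nu_k^n$ are defined recursively. For $k=0$: $\sigma_0^1=1$ and, for $n\ge2$, $\nu_0^{n-1}=-\sigma_0^{n-1}(1)-\sum_{i=1}^{n-2}\nu_0^i\int_0^1\sigma_0^{n-i}(s)\,\mathrm{d}s$, $\sigma_0^n(x)=\sigma_0^{n-1}(1)x+\sum_{i=1}^{n-1}\nu_0^i\int_0^x(x-s)\sigma_0^{n-i}(s)\,\mathrm{d}s$. For $k\ge1$: $\sigma_k^1(x)=\sqrt2\cos(k\pi x)$ and, for $n\ge2$, $\nu_k^{n-1}=-\sqrt2\big(\sigma_k^{n-1}(1)+\sum_{i=1}^{n-2}\nu_k^i\int_0^1\cos(k\pi s)\sigma_k^{n-i}(s)\,\mathrm{d}s\big)$,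 $\sigma_k^n(x)=\frac{\sigma_k^{n-1}(1)}{k\pi}\sin(k\pi x)+\frac1{k\pi}\sum_{i=1}^{n-1}\nu_k^i\int_0^x\sin(k\pi(x-s))\sigma_k^{n-i}(s)\,\mathrm{d}s$. The generalized eigenvectors of $\mathcal{A}$ are $\phi_{i,k}=(\sigma_k^i,\sigma_k^{i-1},\ldots,\sigma_k^1,0,\ldots,0)$ (with $N-i$ zeros), $1\le i\le N$, $k\in\mathbb{N}$. *)

theory Defs
  imports "HOL-Analysis.Analysis"
begin

section \<open>The real Hilbert space $L^2(0,1)$\<close>

abbreviation lebesgue01 :: "real measure" where
  "lebesgue01 \<equiv> lebesgue_on {0<..<1}"

definition square_integrable :: "(real \<Rightarrow> real) \<Rightarrow> bool" where
  "square_integrable f \<longleftrightarrow>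
     f \<in> borel_measurable lebesgue01 \<and> integrable lebesgue01 (\<lambda>x. (f x)\<^sup>2)"

lemma square_integrable_zero: "square_integrable (\<lambda>x. 0)"
  by (simp add: square_integrable_def)

lemma square_integrable_mult:
  assumes "square_integrable f" "square_integrable g"
  shows "integrable lebesgue01 (\<lambda>x. f x * g x)"
proof (rule Bochner_Integration.integrable_bound)
  show "integrable lebesgue01 (\<lambda>x. (f x)\<^sup>2 + (g x)\<^sup>2)"
    using assms by (simp add: square_integrable_def)
  show "(\<lambda>x. f x * g x) \<in> borel_measurable lebesgue01"
    using assms by (simp add: square_integrable_def borel_measurable_times)
  have "\<bar>u * v\<bar> \<le> \<bar>u\<^sup>2 + v\<^sup>2\<bar>" for u v :: real
    using sum_squares_bound[of "\<bar>u\<bar>" "\<bar>v\<bar>"] abs_ge_zero[of "u * v"]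
    unfolding abs_mult power2_abs by linarith
  then show "AE x in lebesgue01. norm (f x * g x) \<le> norm ((f x)\<^sup>2 + (g x)\<^sup>2)"
    by simp
qed

lemma square_integrable_add:
  assumes "square_integrable f" "square_integrable g"
  shows "square_integrable (\<lambda>x. f x + g x)"
  using assms square_integrable_mult[OF assms]
  by (simp add: square_integrable_def power2_sum mult.assoc borel_measurable_add)

lemma square_integrable_scale:
  assumes "square_integrable f"
  shows "square_integrable (\<lambda>x. c * f x)"
  using assms by (simp add: square_integrable_def power_mult_distrib borel_measurable_times)

lemma square_integrable_minus:
  assumes "square_integrable f"
  shows "square_integrable (\<lambda>x. - f x)"
  using square_integrable_scale[OF assms, of "-1"] by simp

lemma square_integrable_diff:
  assumes "square_integrable f" "square_integrable g"
  shows "square_integrable (\<lambda>x. f x - g x)"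
  using square_integrable_add[OF assms(1) square_integrable_minus[OF assms(2)]] by simp

lemma square_integrable_continuous:
  assumes "continuous_on {0..1} f"
  shows "square_integrable f"
proof -
  have "continuous_on {0..1} (\<lambda>x. (f x)\<^sup>2)"
    by (intro continuous_intros assms)
  then have "integrable (lebesgue_on {0..1}) (\<lambda>x. (f x)\<^sup>2)"
    by (rule continuous_imp_integrable_real)
  then have "set_integrable lebesgue {0..1} (\<lambda>x. (f x)\<^sup>2)"
    by (simp add: integrable_restrict_space set_integrable_def)
  then have "set_integrable lebesgue {0<..<1} (\<lambda>x. (f x)\<^sup>2)"
    by (rule set_integrable_subset) auto
  then have "integrable lebesgue01 (\<lambda>x. (f x)\<^sup>2)"
    by (simp add: integrable_restrict_space set_integrable_def)
  moreover have "f \<in> borel_measurable lebesgue01"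
    by (intro continuous_imp_measurable_on_sets_lebesgue continuous_on_subset[OF assms]) auto
  ultimately show ?thesis
    by (simp add: square_integrable_def)
qed

text \<open>Square-integrable functions modulo equality almost everywhere. Functions that are not
  square-integrable do not represent anything, so \<^term>\<open>abs_l2 f\<close> is meaningful only
  for square-integrable \<^term>\<open>f\<close>.\<close>

quotient_type l2 = "real \<Rightarrow> real" / partial:
  "\<lambda>f g. square_integrable f \<and> square_integrable g \<and> (AE x in lebesgue01. f x = g x)"
proof (rule part_equivpI)
  show "\<exists>f. square_integrable f \<and> square_integrable f \<and> (AE x in lebesgue01. f x = f x)"
    using square_integrable_zero by auto
  show "symp (\<lambda>f g. square_integrable f \<and> square_integrable g \<and> (AE x in lebesgue01. f x = g x))"
    by (auto simp: symp_def)
  show "transp (\<lambda>f g. square_integrable f \<and> square_integrable g \<and> (AE x in lebesgue01. f x = g x))"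
    by (auto simp: transp_def)
qed

instantiation l2 :: real_inner
begin

lift_definition zero_l2 :: l2 is "\<lambda>x. 0"
  by (simp add: square_integrable_zero)

lift_definition plus_l2 :: "l2 \<Rightarrow> l2 \<Rightarrow> l2" is "\<lambda>f g x. f x + g x"
  by (auto intro: square_integrable_add)

lift_definition minus_l2 :: "l2 \<Rightarrow> l2 \<Rightarrow> l2" is "\<lambda>f g x. f x - g x"
  by (auto intro: square_integrable_diff)

lift_definition uminus_l2 :: "l2 \<Rightarrow> l2" is "\<lambda>f x. - f x"
  by (auto intro: square_integrable_minus)

lift_definition scaleR_l2 :: "real \<Rightarrow> l2 \<Rightarrow> l2" is "\<lambda>c f x. c * f x"
  by (auto intro: square_integrable_scale)

lift_definition inner_l2 :: "l2 \<Rightarrow> l2 \<Rightarrow> real" is "\<lambda>f g. LINT x|lebesgue01. f x * g x"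
  by (rule integral_cong_AE)
     (auto simp: square_integrable_def intro!: borel_measurable_times)

definition norm_l2 :: "l2 \<Rightarrow> real" where "norm (f::l2) = sqrt (inner f f)"
definition sgn_l2 :: "l2 \<Rightarrow> l2" where "sgn (f::l2) = scaleR (inverse (norm f)) f"
definition dist_l2 :: "l2 \<Rightarrow> l2 \<Rightarrow> real" where "dist (f::l2) g = norm (f - g)"
definition uniformity_l2 :: "(l2 \<times> l2) filter" where
  "uniformity = (INF e\<in>{0<..}. principal {(f, g). dist (f::l2) g < e})"
definition open_l2 :: "l2 set \<Rightarrow> bool" where
  "open U \<longleftrightarrow> (\<forall>f\<in>U. eventually (\<lambda>(f', g). f' = (f::l2) \<longrightarrow> g \<in> U) uniformity)"

instance
proof
  fix a b c :: l2 and r s :: real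
  show "a + b + c = a + (b + c)"
    by transfer (auto simp: add.assoc intro: square_integrable_add)
  show "a + b = b + a"
    by transfer (auto simp: add.commute intro: square_integrable_add)
  show "0 + a = a"
    by transfer auto
  show "- a + a = 0"
    by transfer (auto simp: square_integrable_zero)
  show "a - b = a + - b"
    by transfer (auto intro: square_integrable_diff)
  show "r *\<^sub>R (a + b) = r *\<^sub>R a + r *\<^sub>R b"
    by transfer (auto simp: distrib_left intro!: square_integrable_add square_integrable_scale)
  show "(r + s) *\<^sub>R a = r *\<^sub>R a + s *\<^sub>R a"
    by transfer (auto simp: distrib_right intro!: square_integrable_add square_integrable_scale)
  show "r *\<^sub>R s *\<^sub>R a = (r * s) *\<^sub>R a"
    by transfer (auto simp: mult.assoc intro!: square_integrable_scale)
  show "1 *\<^sub>R a = a"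
    by transfer auto
  show "dist a b = norm (a - b)" by (rule dist_l2_def)
  show "sgn a = scaleR (inverse (norm a)) a" by (rule sgn_l2_def)
  show "uniformity = (INF e\<in>{0<..}. principal {(f, g). dist (f::l2) g < e})"
    by (rule uniformity_l2_def)
  show "open U \<longleftrightarrow> (\<forall>f\<in>U. eventually (\<lambda>(f', g). f' = (f::l2) \<longrightarrow> g \<in> U) uniformity)"
    for U by (rule open_l2_def)
  show "inner a b = inner b a"
    by transfer (simp add: mult.commute)
  show "inner (a + b) c = inner a c + inner b c"
    by transfer
       (auto simp: distrib_right square_integrable_mult intro!: Bochner_Integration.integral_add)
  show "inner (r *\<^sub>R a) b = r * inner a b"
    by transfer (simp add: mult.assoc)
  show "0 \<le> inner a a"
    by transfer simp
  show "inner a a = 0 \<longleftrightarrow> a = 0"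
  proof transfer
    fix f assume f: "square_integrable f \<and> square_integrable f \<and> (AE x in lebesgue01. f x = f x)"
    then have "integrable lebesgue01 (\<lambda>x. f x * f x)"
      by (simp add: square_integrable_mult)
    then have "(LINT x|lebesgue01. f x * f x) = 0 \<longleftrightarrow> (AE x in lebesgue01. f x * f x = 0)"
      by (rule integral_nonneg_eq_0_iff_AE) simp
    then show "(LINT x|lebesgue01. f x * f x) = 0 \<longleftrightarrow>
        square_integrable f \<and> square_integrable (\<lambda>x. 0) \<and> (AE x in lebesgue01. f x = 0)"
      using f by (simp add: square_integrable_zero)
  qed
  show "norm a = sqrt (inner a a)" by (rule norm_l2_def)
qed

end

lemma square_integrable_rep_l2: "square_integrable (rep_l2 f)"
  using Quotient3_rep_reflp[OF Quotient3_l2] by blast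

lemma abs_rep_l2: "abs_l2 (rep_l2 f) = f"
  by (rule Quotient3_abs_rep[OF Quotient3_l2])

lemma abs_l2_diff:
  assumes "square_integrable f" "square_integrable g"
  shows "abs_l2 (\<lambda>x. f x - g x) = abs_l2 f - abs_l2 g"
  using assms by (simp add: minus_l2.abs_eq)

lemma nn_integral_abs_l2:
  assumes "square_integrable f"
  shows "(\<integral>\<^sup>+x. ennreal ((f x)\<^sup>2) \<partial>lebesgue01) = ennreal ((norm (abs_l2 f))\<^sup>2)"
proof -
  have "(norm (abs_l2 f))\<^sup>2 = (LINT x|lebesgue01. f x * f x)"
    using assms by (simp add: power2_norm_eq_inner inner_l2.abs_eq)
  then show ?thesis
    using assms by (simp add: nn_integral_eq_integral square_integrable_def power2_eq_square)
qed

instance l2 :: complete_space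
proof
  fix X :: "nat \<Rightarrow> l2" assume X: "Cauchy X"
  have "\<exists>M. \<forall>i\<ge>M. \<forall>j\<ge>M. norm (X i - X j) < (1/2)^n" for n
    using CauchyD[OF X, of "(1/2)^n"] by simp
  then obtain M where M: "\<And>n i j. i \<ge> M n \<Longrightarrow> j \<ge> M n \<Longrightarrow> norm (X i - X j) < (1/2)^n"
    by metis
  define r where "r n = (\<Sum>i\<le>n. M i)" for n
  have r_M: "M n \<le> r n" for n
    unfolding r_def by (rule member_le_sum) auto
  have r_mono: "r n \<le> r m" if "n \<le> m" for n m
    unfolding r_def using that by (intro sum_mono2) auto
  define g where "g n = rep_l2 (X (r n))" for n
  have g: "square_integrable (g n)" and abs_g: "abs_l2 (g n) = X (r n)" for n
    by (simp_all add: g_def square_integrable_rep_l2 abs_rep_l2)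
  have [measurable]: "g n \<in> borel_measurable lebesgue01" for n
    using g by (simp add: square_integrable_def)
  have close: "(\<integral>\<^sup>+x. ennreal ((g m x - g n x)\<^sup>2) \<partial>lebesgue01) \<le> ennreal (((1/2)^n)\<^sup>2)"
    if "n \<le> m" for m n
  proof -
    have "norm (X (r m) - X (r n)) < (1/2)^n"
      using r_M[of n] r_mono[OF that] by (intro M) auto
    then show ?thesis
      using nn_integral_abs_l2[OF square_integrable_diff[OF g[of m] g[of n]]]
      by (auto simp: abs_l2_diff g abs_g intro!: ennreal_leI power_mono)
  qed

  have "(\<integral>\<^sup>+x. (\<Sum>n. ennreal (2^n * (g (Suc n) x - g n x)\<^sup>2)) \<partial>lebesgue01)
      = (\<Sum>n. \<integral>\<^sup>+x. ennreal (2^n * (g (Suc n) x - g n x)\<^sup>2) \<partial>lebesgue01)"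
    by (rule nn_integral_suminf) measurable
  also have "\<dots> \<le> (\<Sum>n. ennreal ((1/2)^n))"
  proof (intro suminf_le allI)
    fix n
    have "(\<integral>\<^sup>+x. ennreal (2^n * (g (Suc n) x - g n x)\<^sup>2) \<partial>lebesgue01)
        = ennreal (2^n) * (\<integral>\<^sup>+x. ennreal ((g (Suc n) x - g n x)\<^sup>2) \<partial>lebesgue01)"
      by (subst nn_integral_cmult[symmetric]) (simp_all add: ennreal_mult)
    also have "\<dots> \<le> ennreal (2^n) * ennreal (((1/2)^n)\<^sup>2)"
      by (intro mult_left_mono close) auto
    also have "\<dots> = ennreal ((1/2)^n)"
      by (simp add: ennreal_mult[symmetric] power2_eq_square power_one_over field_simps)
    finally show "(\<integral>\<^sup>+x. ennreal (2^n * (g (Suc n) x - g n x)\<^sup>2) \<partial>lebesgue01)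
        \<le> ennreal ((1/2)^n)" .
  qed auto
  also have "\<dots> < \<infinity>"
    by (simp add: suminf_ennreal2 summable_geometric)
  finally have "AE x in lebesgue01. (\<Sum>n. ennreal (2^n * (g (Suc n) x - g n x)\<^sup>2)) \<noteq> \<infinity>"
    by (intro nn_integral_PInf_AE) auto
  then have conv: "AE x in lebesgue01. convergent (\<lambda>n. g n x)"
  proof eventually_elim
    case (elim x)
    then have "summable (\<lambda>n. 2^n * (g (Suc n) x - g n x)\<^sup>2)"
      by (intro summable_suminf_not_top) auto
    then have "summable (\<lambda>n. (1/2)^n + 2^n * (g (Suc n) x - g n x)\<^sup>2)"
      by (intro summable_add summable_geometric) auto
    moreover have "norm (g (Suc n) x - g n x) \<le> (1/2)^n + 2^n * (g (Suc n) x - g n x)\<^sup>2" for n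
    proof -
      define u where "u = \<bar>g (Suc n) x - g n x\<bar>"
      have "u * (1 - 2^n * u) \<le> (1/2)^n"
      proof (cases "2^n * u \<le> 1")
        case True
        then have "u \<le> (1/2)^n" by (simp add: power_one_over field_simps)
        moreover have "u * (1 - 2^n * u) \<le> u * 1"
          by (intro mult_left_mono) (auto simp: u_def)
        ultimately show ?thesis by simp
      next
        case False
        then have "u * (1 - 2^n * u) \<le> 0"
          by (intro mult_nonneg_nonpos) (auto simp: u_def)
        then show ?thesis by (rule order_trans) simp
      qed
      moreover have "(g (Suc n) x - g n x)\<^sup>2 = u * u"
        by (simp add: u_def power2_eq_square[symmetric])
      ultimately show ?thesis by (simp add: u_def[symmetric] algebra_simps)
    qed
    ultimately have "summable (\<lambda>n. g (Suc n) x - g n x)"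
      by (intro summable_comparison_test[of "\<lambda>n. g (Suc n) x - g n x"]) auto
    then have "convergent (\<lambda>n. \<Sum>i<n. g (Suc i) x - g i x)"
      by (simp add: summable_iff_convergent)
    then have "convergent (\<lambda>n. g n x - g 0 x)"
      using sum_lessThan_telescope[of "\<lambda>n. g n x"] by simp
    then have "convergent (\<lambda>n. (g n x - g 0 x) + g 0 x)"
      by (intro convergent_add convergent_const)
    then show ?case by simp
  qed

  define f where "f x = lim (\<lambda>n. g n x)" for x
  have f_meas [measurable]: "f \<in> borel_measurable lebesgue01"
    unfolding f_def by measurable
  have bound: "(\<integral>\<^sup>+x. ennreal ((f x - g n x)\<^sup>2) \<partial>lebesgue01) \<le> ennreal (((1/2)^n)\<^sup>2)" for n
  proof -
    have "(\<integral>\<^sup>+x. ennreal ((f x - g n x)\<^sup>2) \<partial>lebesgue01)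
        = (\<integral>\<^sup>+x. liminf (\<lambda>m. ennreal ((g m x - g n x)\<^sup>2)) \<partial>lebesgue01)"
    proof (rule nn_integral_cong_AE, use conv in eventually_elim)
      case (elim x)
      then have "(\<lambda>m. g m x) \<longlonglongrightarrow> f x"
        by (simp add: f_def convergent_LIMSEQ_iff)
      then have "(\<lambda>m. ennreal ((g m x - g n x)\<^sup>2)) \<longlonglongrightarrow> ennreal ((f x - g n x)\<^sup>2)"
        by (intro tendsto_ennrealI tendsto_intros)
      then show ?case
        by (rule lim_imp_Liminf[OF sequentially_bot, symmetric])
    qed
    also have "\<dots> \<le> liminf (\<lambda>m. \<integral>\<^sup>+x. ennreal ((g m x - g n x)\<^sup>2) \<partial>lebesgue01)"
      by (rule nn_integral_liminf) measurable
    also have "\<dots> \<le> limsup (\<lambda>m. \<integral>\<^sup>+x. ennreal ((g m x - g n x)\<^sup>2) \<partial>lebesgue01)"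
      by (rule Liminf_le_Limsup) simp
    also have "\<dots> \<le> ennreal (((1/2)^n)\<^sup>2)"
      by (rule Limsup_bounded) (use close in \<open>auto simp: eventually_sequentially\<close>)
    finally show ?thesis .
  qed
  have diff: "square_integrable (\<lambda>x. f x - g n x)" for n
  proof -
    have "integrable lebesgue01 (\<lambda>x. (f x - g n x)\<^sup>2)"
      by (rule integrableI_bounded)
         (auto intro: le_less_trans[OF bound])
    then show ?thesis by (simp add: square_integrable_def)
  qed
  have f: "square_integrable f"
    using square_integrable_add[OF diff[of 0] g[of 0]] by simp
  have lim: "norm (abs_l2 f - X (r n)) \<le> (1/2)^n" for n
  proof -
    have "ennreal ((norm (abs_l2 f - X (r n)))\<^sup>2) \<le> ennreal (((1/2)^n)\<^sup>2)"
      using bound[of n] nn_integral_abs_l2[OF diff[of n]] by (simp add: abs_l2_diff f g abs_g)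
    then have "(norm (abs_l2 f - X (r n)))\<^sup>2 \<le> ((1/2)^n)\<^sup>2"
      by (subst (asm) ennreal_le_iff) auto
    then show ?thesis by (rule power2_le_imp_le) simp
  qed
  have "X \<longlonglongrightarrow> abs_l2 f"
  proof (rule LIMSEQ_I)
    fix e :: real assume "0 < e"
    then obtain n where n: "(1/2)^n < e / 2"
      using real_arch_pow_inv[of "e / 2" "1/2"] by auto
    have "norm (X k - abs_l2 f) < e" if "k \<ge> r n" for k
    proof -
      have "norm (X k - X (r n)) < (1/2)^n"
        using that r_M[of n] by (intro M) auto
      moreover have "norm (X k - abs_l2 f) \<le> norm (X k - X (r n)) + norm (abs_l2 f - X (r n))"
        by (metis norm_minus_commute norm_diff_triangle_ineq[of "X k" 0 "X (r n)" "X (r n)"]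
            norm_triangle_sub diff_add_cancel norm_triangle_ineq add_diff_eq)
      ultimately show ?thesis using lim[of n] n by simp
    qed
    then show "\<exists>no. \<forall>k\<ge>no. norm (X k - abs_l2 f) < e" by blast
  qed
  then show "convergent X" by (rule convergentI)
qed

instance l2 :: banach ..


section \<open>Weak derivatives, $H^1(0,1)$, $H^2(0,1)$ and boundary values\<close>

definition test_fun :: "(real \<Rightarrow> real) \<Rightarrow> bool" where
  "test_fun \<theta> \<longleftrightarrow>
     (\<forall>n x. (deriv ^^ n) \<theta> differentiable at x) \<and>
     (\<exists>c d. 0 < c \<and> d < 1 \<and> (\<forall>x. x \<notin> {c..d} \<longrightarrow> \<theta> x = 0))"

definition has_weak_deriv :: "l2 \<Rightarrow> l2 \<Rightarrow> bool" where
  "has_weak_deriv f g \<longleftrightarrow>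
     (\<forall>\<theta>. test_fun \<theta> \<longrightarrow>
        (LINT x|lebesgue01. rep_l2 f x * deriv \<theta> x) = - (LINT x|lebesgue01. rep_l2 g x * \<theta> x))"

definition weak_deriv :: "l2 \<Rightarrow> l2" where
  "weak_deriv f = (THE g. has_weak_deriv f g)"

definition sobolev1 :: "l2 set" where
  "sobolev1 = {f. \<exists>g. has_weak_deriv f g}"

definition sobolev2 :: "l2 set" where
  "sobolev2 = {f \<in> sobolev1. weak_deriv f \<in> sobolev1}"

text \<open>Pointwise values (in particular at the end points) of an element of $H^1(0,1)$ are those of
  its continuous representative on $[0,1]$, which is unique.\<close>

definition point_value :: "l2 \<Rightarrow> real \<Rightarrow> real" where
  "point_value f x = (THE y. \<exists>u. continuous_on {0..1} u \<and> abs_l2 u = f \<and> u x = y)"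


section \<open>Riesz bases and strongly continuous semigroups\<close>

definition riesz_basis :: "'i set \<Rightarrow> ('i \<Rightarrow> 'h::{real_inner, complete_space}) \<Rightarrow> bool" where
  "riesz_basis I b \<longleftrightarrow>
     closure (span (b ` I)) = UNIV \<and>
     (\<exists>m>0. \<exists>M>0. \<forall>F c. finite F \<and> F \<subseteq> I \<longrightarrow>
        m * (\<Sum>i\<in>F. (c i)\<^sup>2) \<le> (norm (\<Sum>i\<in>F. c i *\<^sub>R b i))\<^sup>2 \<and>
        (norm (\<Sum>i\<in>F. c i *\<^sub>R b i))\<^sup>2 \<le> M * (\<Sum>i\<in>F. (c i)\<^sup>2))"

definition C0_semigroup :: "(real \<Rightarrow> 'h::banach \<Rightarrow> 'h) \<Rightarrow> bool" where
  "C0_semigroup T \<longleftrightarrow>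
     (\<forall>t\<ge>0. bounded_linear (T t)) \<and>
     (\<forall>x. T 0 x = x) \<and>
     (\<forall>s\<ge>0. \<forall>t\<ge>0. \<forall>x. T (s + t) x = T s (T t x)) \<and>
     (\<forall>x. ((\<lambda>t. T t x) \<longlongrightarrow> x) (at_right 0))"

text \<open>Unbounded operators are identified with their graphs.\<close>

definition generator :: "(real \<Rightarrow> 'h::banach \<Rightarrow> 'h) \<Rightarrow> ('h \<times> 'h) set" where
  "generator T = {(x, y). ((\<lambda>t. (T t x - x) /\<^sub>R t) \<longlongrightarrow> y) (at_right 0)}"

definition generates_C0_semigroup :: "('h::banach) set \<Rightarrow> ('h \<Rightarrow> 'h) \<Rightarrow> bool" where
  "generates_C0_semigroup D A \<longleftrightarrow>
     (\<exists>T. C0_semigroup T \<and> generator T = {(x, A x) |x. x \<in> D})"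


section \<open>The operator and its generalized eigenvectors\<close>

text \<open>The space $(L^2(0,1))^N$ is \<^typ>\<open>l2 ^ 'n\<close> with $N$ the cardinality of
  \<^typ>\<open>'n::{finite, linorder}\<close>; the index type is identified with $\{1,\dots,N\}$ in increasing
  order by means of \<open>idx\<close>.\<close>

definition idx :: "'n::{finite, linorder} \<Rightarrow> nat" where
  "idx j = card {..j}"

lemma strict_mono_idx: "strict_mono (idx :: 'n::{finite, linorder} \<Rightarrow> nat)"
  unfolding idx_def by (intro strict_monoI psubset_card_mono) auto

lemma bij_betw_idx: "bij_betw idx (UNIV :: 'n::{finite, linorder} set) {1..CARD('n)}"
proof -
  have inj: "inj (idx :: 'n \<Rightarrow> nat)"
    by (rule strict_mono_imp_inj_on[OF strict_mono_idx])
  have "range (idx :: 'n \<Rightarrow> nat) \<subseteq> {1..CARD('n)}"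
    unfolding idx_def by (auto simp: Suc_le_eq card_gt_0_iff intro!: card_mono)
  moreover have "card (range (idx :: 'n \<Rightarrow> nat)) = card {1..CARD('n)}"
    using inj by (simp add: card_image)
  ultimately have "range (idx :: 'n \<Rightarrow> nat) = {1..CARD('n)}"
    by (intro card_subset_eq) auto
  with inj show ?thesis by (simp add: bij_betw_def)
qed

definition dom_A :: "(l2 ^ 'n::{finite, linorder}) set" where
  "dom_A = {f. (\<forall>j. f $ j \<in> sobolev2) \<and>
     (\<forall>j. idx j = CARD('n) \<longrightarrow>
        point_value (weak_deriv (f $ j)) 0 = 0 \<and> point_value (weak_deriv (f $ j)) 1 = 0) \<and>
     (\<forall>j j'. idx j' = idx j + 1 \<longrightarrow>
        point_value (weak_deriv (f $ j)) 0 = point_value (f $ j') 1 \<and>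
        point_value (weak_deriv (f $ j)) 1 = 0)}"

definition op_A :: "real \<Rightarrow> l2 ^ 'n \<Rightarrow> l2 ^ 'n" where
  "op_A a f = (\<chi> j. weak_deriv (weak_deriv (f $ j)) + a *\<^sub>R f $ j)"

text \<open>\<open>sigma_fun k n\<close> and \<open>nu_coeff k n\<close> are $\sigma_k^n$ and $\nu_k^n$; the superscript starts at \<open>1\<close>,
  and the values at superscript \<open>0\<close> are never used.\<close>

function sigma_fun :: "nat \<Rightarrow> nat \<Rightarrow> real \<Rightarrow> real" and nu_coeff :: "nat \<Rightarrow> nat \<Rightarrow> real" where
  "sigma_fun k n =
     (if n = 0 then (\<lambda>x. 0)
      else if n = 1 then (\<lambda>x. if k = 0 then 1 else sqrt 2 * cos (k * pi * x))
      else if k = 0 then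
        (\<lambda>x. sigma_fun 0 (n - 1) 1 * x
           + (\<Sum>i\<in>{1..<n}. nu_coeff 0 i * integral {0..x} (\<lambda>s. (x - s) * sigma_fun 0 (n - i) s)))
      else
        (\<lambda>x. sigma_fun k (n - 1) 1 / (k * pi) * sin (k * pi * x)
           + 1 / (k * pi) *
             (\<Sum>i\<in>{1..<n}. nu_coeff k i * integral {0..x} (\<lambda>s. sin (k * pi * (x - s)) * sigma_fun k (n - i) s))))"
| "nu_coeff k m =
     (if m = 0 then 0
      else if k = 0 then
        - sigma_fun 0 m 1 - (\<Sum>i\<in>{1..<m}. nu_coeff 0 i * integral {0..1} (sigma_fun 0 (m + 1 - i)))
      else
        - sqrt 2 * (sigma_fun k m 1
           + (\<Sum>i\<in>{1..<m}. nu_coeff k i * integral {0..1} (\<lambda>s. cos (k * pi * s) * sigma_fun k (m + 1 - i) s))))"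
  by pat_completeness auto
termination
  by (relation "Wellfounded.measure (case_sum (\<lambda>(k, n). 2 * n) (\<lambda>(k, m). 2 * m + 1))") auto

declare sigma_fun.simps [simp del] nu_coeff.simps [simp del]

lemma continuous_on_indefinite_integral:
  fixes f :: "real \<Rightarrow> real"
  assumes "continuous_on {0..1} f"
  shows "continuous_on {0..1} (\<lambda>x. integral {0..x} f)"
  by (intro indefinite_integral_continuous_1 integrable_continuous_interval assms)

lemma continuous_on_sigma_fun: "continuous_on {0..1} (sigma_fun k n)"
proof (induction n rule: less_induct)
  case (less n)
  consider "n \<le> 1" | "n > 1" "k = 0" | "n > 1" "k > 0" by linarith
  then show ?case
  proof cases
    case 1
    then consider "n = 0" | "n = 1" by linarith
    then show ?thesis
    proof cases
      case 1
      then show ?thesis by (simp add: sigma_fun.simps[of k 0])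
    next
      case 2
      then show ?thesis
        by (cases "k = 0") (auto simp: sigma_fun.simps[of _ "Suc 0"] intro!: continuous_intros)
    qed
  next
    case 2
    have "continuous_on {0..1} (\<lambda>x. integral {0..x} (\<lambda>s. (x - s) * sigma_fun 0 (n - i) s))"
      if i: "i \<in> {1..<n}" for i
    proof -
      have c: "continuous_on {0..1} (sigma_fun 0 (n - i))"
        using less.IH[of "n - i"] i 2 by auto
      have "continuous_on {0..1} (\<lambda>x. x * integral {0..x} (sigma_fun 0 (n - i))
          - integral {0..x} (\<lambda>s. s * sigma_fun 0 (n - i) s))"
        by (intro continuous_intros continuous_on_indefinite_integral c)
      moreover have "x * integral {0..x} (sigma_fun 0 (n - i))
          - integral {0..x} (\<lambda>s. s * sigma_fun 0 (n - i) s)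
          = integral {0..x} (\<lambda>s. (x - s) * sigma_fun 0 (n - i) s)" if "x \<in> {0..1}" for x
      proof -
        have c': "continuous_on {0..x} (sigma_fun 0 (n - i))"
          using that by (intro continuous_on_subset[OF c]) auto
        show ?thesis
          unfolding left_diff_distrib
          by (subst integral_diff)
             (auto intro!: integrable_continuous_interval continuous_intros c')
      qed
      ultimately show ?thesis
        by (rule continuous_on_eq)
    qed
    then show ?thesis
      using 2 by (subst sigma_fun.simps) (auto intro!: continuous_intros)
  next
    case 3
    have "continuous_on {0..1} (\<lambda>x. integral {0..x} (\<lambda>s. sin (k * pi * (x - s)) * sigma_fun k (n - i) s))"
      if i: "i \<in> {1..<n}" for i
    proof -
      have c: "continuous_on {0..1} (sigma_fun k (n - i))"
        using less.IH[of "n - i"] i by auto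
      have "continuous_on {0..1} (\<lambda>x.
            sin (k * pi * x) * integral {0..x} (\<lambda>s. cos (k * pi * s) * sigma_fun k (n - i) s)
          - cos (k * pi * x) * integral {0..x} (\<lambda>s. sin (k * pi * s) * sigma_fun k (n - i) s))"
        by (intro continuous_intros continuous_on_indefinite_integral c)
      moreover have "sin (k * pi * x) * integral {0..x} (\<lambda>s. cos (k * pi * s) * sigma_fun k (n - i) s)
          - cos (k * pi * x) * integral {0..x} (\<lambda>s. sin (k * pi * s) * sigma_fun k (n - i) s)
          = integral {0..x} (\<lambda>s. sin (k * pi * (x - s)) * sigma_fun k (n - i) s)"
        if "x \<in> {0..1}" for x
      proof -
        have c': "continuous_on {0..x} (sigma_fun k (n - i))"
          using that by (intro continuous_on_subset[OF c]) auto
        show ?thesis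
          unfolding right_diff_distrib sin_diff left_diff_distrib mult.assoc[of "sin _"] mult.assoc[of "cos _"]
          by (subst integral_diff)
             (auto simp: mult.assoc intro!: integrable_continuous_interval continuous_intros c')
      qed
      ultimately show ?thesis
        by (rule continuous_on_eq)
    qed
    then show ?thesis
      using 3 by (subst sigma_fun.simps) (auto intro!: continuous_intros)
  qed
qed

lemma square_integrable_sigma_fun: "square_integrable (sigma_fun k n)"
  by (rule square_integrable_continuous[OF continuous_on_sigma_fun])

definition phi :: "nat \<Rightarrow> nat \<Rightarrow> l2 ^ 'n::{finite, linorder}" where
  "phi i k = (\<chi> j. if idx j \<le> i then abs_l2 (sigma_fun k (i + 1 - idx j)) else 0)"

end

theory Submission
  imports Defs
begin

text \<open>Let $e_0 = 1$, $e_k = \sqrt2\cos(k\pi x)$; these form an orthonormal basis of $L^2(0,1)$, so the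
vectors with a single nonzero entry $e_k$ form an orthonormal basis of the product space. The vector
$\phi_{i,k}$ has entry $\sigma_k^1 = e_k$ at position $i$, and the entries $\sigma_k^2, \sigma_k^3,
\dots$ at the positions before it. Hence the operator \<open>transform\<close> that sends the orthonormal basis to
the family $\phi_{i,k}$ is block upper triangular, constant along diagonals (\<open>toeplitz\<close>), with the
identity on the diagonal. The recursion for $\sigma_k^n$ with $n \ge 2$ contains a factor $1/(k\pi)$,
so $\|\sigma_k^n\| = O(1/k)$ is square summable in $k$ and the blocks above the diagonal are bounded. A
bounded block triangular operator with identities on the diagonal has a bounded inverse. So
\<open>transform\<close> is an isomorphism that maps an orthonormal basis to the family $\phi_{i,k}$, which is the
Riesz basis property (\<open>riesz_basis_phi\<close>).

In the coordinates given by this basis the operator becomes explicit. Twice differentiating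
$\sigma_k^n$ gives $-k^2\pi^2\sigma_k^n + \sum_{i<n}\nu_k^i\sigma_k^{n-i}$, so that the operator acts on
the coefficients at frequency $k$ as the power series $a - k^2\pi^2 + \sum_i \nu_k^i z^i$ in the
nilpotent shift $z$ (\<open>generator_symbol\<close>). Its exponential is a power series in $z$ whose coefficients
are bounded in $k$, locally uniformly in $t \ge 0$; these define a strongly continuous semigroup
(\<open>model_semigroup\<close>), whose generator consists of all pairs that satisfy the coefficient relation for
every $k$ (\<open>generator_model\<close>). Conjugation with \<open>transform\<close> gives a semigroup with a generator $G$.

It remains to identify $G$ with the operator, domain included. A function with second weak derivative
$h$ is an affine function plus a double primitive of $h$, and this makes the graph of the operator
the solution set of continuous linear equations, hence closed (\<open>graph_A_iff\<close>,
\<open>graph_A_closed_subspace\<close>). As $G$ agrees with the operator on finite combinations of the $\phi_{i,k}$,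
closedness shows that the operator extends $G$ (\<open>transform_model_generator\<close>). Conversely
$a + 1 - G$ is surjective, because it acts by invertible power series with uniformly bounded inverses
(\<open>model_generator_resolvent\<close>), while $a + 1$ minus the operator is injective
(\<open>graph_A_injective\<close>). So the extension is not proper (\<open>graph_A_eq_transform_model_generator\<close>).\<close>

section \<open>Hilbert spaces with a countable orthonormal basis\<close>

text \<open>Strong convergence needs to be checked only on a dense set once the operators are uniformly bounded.
Linearity and the bound are required only eventually, since semigroup operators are controlled only
near $0$ from the right.\<close>

lemma uniformly_bounded_tendsto_zero:
  fixes A :: "'t \<Rightarrow> 'a::real_normed_vector \<Rightarrow> 'b::real_normed_vector"
  assumes bl: "eventually (\<lambda>t. linear (A t) \<and> (\<forall>x. norm (A t x) \<le> M * norm x)) F"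
    and conv: "\<And>x. x \<in> S \<Longrightarrow> ((\<lambda>t. A t x) \<longlongrightarrow> 0) F"
    and dense: "closure S = UNIV"
  shows "((\<lambda>t. A t x) \<longlongrightarrow> 0) F"
proof (rule tendstoI)
  fix \<epsilon> :: real assume "\<epsilon> > 0"
  define d where "d = \<epsilon> / (2 * (\<bar>M\<bar> + 1))"
  have "d > 0" unfolding d_def using \<open>\<epsilon> > 0\<close> by (auto intro!: divide_pos_pos)
  moreover have "x \<in> closure S" by (simp add: dense)
  ultimately obtain y where y: "y \<in> S" "dist y x < d"
    unfolding closure_approachable by blast
  have "(\<bar>M\<bar> + 1) * d = \<epsilon> / 2" unfolding d_def by (simp add: field_simps)
  have "eventually (\<lambda>t. norm (A t y) < \<epsilon> / 2) F"
    using tendstoD[OF conv[OF y(1)], of "\<epsilon> / 2"] \<open>\<epsilon> > 0\<close> by simp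
  with bl show "eventually (\<lambda>t. dist (A t x) 0 < \<epsilon>) F"
  proof eventually_elim
    case (elim t)
    have "A t x = A t (x - y) + A t y"
      using elim linear_diff[of "A t" x y] by simp
    then have "norm (A t x) \<le> norm (A t (x - y)) + norm (A t y)"
      using norm_triangle_ineq by metis
    moreover have "norm (A t (x - y)) \<le> M * norm (x - y)" using elim by blast
    moreover have "M * norm (x - y) \<le> (\<bar>M\<bar> + 1) * d"
      using y(2) by (intro mult_mono) (auto simp: dist_norm norm_minus_commute)
    ultimately show ?case using elim \<open>(\<bar>M\<bar> + 1) * d = \<epsilon> / 2\<close>
      unfolding dist_0_norm dist_commute[of _ 0] by linarith
  qed
qed

lemma bounded_linear_eq_on_dense_span:
  fixes f g :: "'a::real_normed_vector \<Rightarrow> 'b::real_normed_vector"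
  assumes f: "bounded_linear f" and g: "bounded_linear g"
    and eq: "\<And>x. x \<in> S \<Longrightarrow> f x = g x" and dense: "closure (span S) = UNIV"
  shows "f x = g x"
proof -
  have "closed {x. f x = g x}"
    by (intro closed_Collect_eq bounded_linear.continuous_on[OF f] bounded_linear.continuous_on[OF g] continuous_on_id)
  moreover have "span S \<subseteq> {x. f x = g x}"
    using linear_eq_on[of f g] f g eq by (auto simp: bounded_linear.linear)
  ultimately show ?thesis
    using dense closure_minimal by blast
qed

locale hilbert_basis =
  fixes e :: "nat \<Rightarrow> 'h::{real_inner, banach}"
  assumes orthonormal: "inner (e i) (e j) = (if i = j then 1 else 0)"
    and dense_span: "closure (span (range e)) = UNIV"
begin

text \<open>The difference is orthogonal to the dense span of the basis, hence to itself.\<close>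

lemma coeff_eqI:
  assumes "\<And>k. inner f (e k) = inner g (e k)"
  shows "f = g"
proof -
  have "inner (f - g) (f - g) = 0"
    by (rule bounded_linear_eq_on_dense_span[where f = "inner (f - g)" and S = "range e" and g = "\<lambda>_. 0"])
       (use assms dense_span in \<open>auto simp: inner_diff_left intro: bounded_linear_inner_right bounded_linear_zero\<close>)
  then show ?thesis by simp
qed

lemma norm_sum_sq:
  assumes "finite F"
  shows "(norm (\<Sum>k\<in>F. c k *\<^sub>R e k))\<^sup>2 = (\<Sum>k\<in>F. (c k)\<^sup>2)"
  using assms
  by (simp add: dot_square_norm[symmetric] inner_sum_left inner_sum_right orthonormal if_distrib
      sum.delta power2_eq_square[of "c _"] cong: if_cong)

lemma bessel: 
  assumes "finite F"
  shows "(\<Sum>k\<in>F. (inner f (e k))\<^sup>2) \<le> (norm f)\<^sup>2"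
proof -
  let ?p = "\<Sum>k\<in>F. inner f (e k) *\<^sub>R e k"
  have "inner f ?p = (\<Sum>k\<in>F. (inner f (e k))\<^sup>2)"
    by (simp add: inner_sum_right power2_eq_square)
  moreover have "inner ?p ?p = (\<Sum>k\<in>F. (inner f (e k))\<^sup>2)"
    using norm_sum_sq[OF assms, of "\<lambda>k. inner f (e k)"] by (simp add: power2_norm_eq_inner)
  moreover have "0 \<le> inner (f - ?p) (f - ?p)" by simp
  ultimately show ?thesis
    by (simp add: inner_diff_left inner_diff_right inner_commute power2_norm_eq_inner)
qed

lemma summable_coeff_sq: "summable (\<lambda>k. (inner f (e k))\<^sup>2)"
  by (rule summableI_nonneg_bounded[of _ "(norm f)\<^sup>2"]) (auto intro: bessel)

text \<open>By orthonormality the squared norm of a block of the series is the corresponding block of the series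
of squares, so one Cauchy criterion gives the other.\<close>

lemma summable_series:
  assumes "summable (\<lambda>k. (c k)\<^sup>2)"
  shows "summable (\<lambda>k. c k *\<^sub>R e k)"
  unfolding summable_Cauchy
proof (intro allI impI)
  fix \<epsilon> :: real assume "\<epsilon> > 0"
  then obtain N where N: "\<And>m n. m \<ge> N \<Longrightarrow> norm (\<Sum>k=m..<n. (c k)\<^sup>2) < \<epsilon>\<^sup>2"
    using assms unfolding summable_Cauchy by (meson zero_less_power)
  have "norm (\<Sum>k=m..<n. c k *\<^sub>R e k) < \<epsilon>" if "m \<ge> N" for m n
  proof -
    have "(norm (\<Sum>k=m..<n. c k *\<^sub>R e k))\<^sup>2 < \<epsilon>\<^sup>2"
      using N[OF that, of n] norm_sum_sq[of "{m..<n}" c] by (simp add: abs_of_nonneg sum_nonneg)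
    then show ?thesis using \<open>\<epsilon> > 0\<close> power2_less_imp_less less_imp_le by blast
  qed
  then show "\<exists>N. \<forall>m\<ge>N. \<forall>n. norm (\<Sum>k=m..<n. c k *\<^sub>R e k) < \<epsilon>" by blast
qed

lemma inner_series:
  assumes "summable (\<lambda>k. (c k)\<^sup>2)"
  shows "inner (\<Sum>k. c k *\<^sub>R e k) (e j) = c j"
proof -
  have "(\<lambda>k. inner (c k *\<^sub>R e k) (e j)) sums inner (\<Sum>k. c k *\<^sub>R e k) (e j)"
    by (intro bounded_linear.sums[OF bounded_linear_inner_left] summable_sums summable_series assms)
  moreover have "(\<lambda>k. inner (c k *\<^sub>R e k) (e j)) = (\<lambda>k. if k = j then c k else 0)"
    by (auto simp: orthonormal)
  ultimately show ?thesis
    using sums_single[of j c] sums_unique2 by metis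
qed

lemma fourier_sums: "(\<lambda>k. inner f (e k) *\<^sub>R e k) sums f"
proof -
  have "(\<Sum>k. inner f (e k) *\<^sub>R e k) = f"
    by (rule coeff_eqI) (simp add: inner_series summable_coeff_sq)
  then show ?thesis
    using summable_sums[OF summable_series[OF summable_coeff_sq]] by metis
qed

lemma norm_series_le:
  assumes "summable (\<lambda>k. (c k)\<^sup>2)" "\<And>n. (\<Sum>k<n. (c k)\<^sup>2) \<le> B\<^sup>2" "0 \<le> B"
  shows "norm (\<Sum>k. c k *\<^sub>R e k) \<le> B"
proof (rule tendsto_upperbound[OF tendsto_norm])
  show "(\<lambda>n. \<Sum>k<n. c k *\<^sub>R e k) \<longlonglongrightarrow> (\<Sum>k. c k *\<^sub>R e k)"
    by (intro summable_LIMSEQ summable_series assms)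
  have "norm (\<Sum>k<n. c k *\<^sub>R e k) \<le> B" for n
    using assms(2)[of n] norm_sum_sq[of "{..<n}" c] power2_le_imp_le[OF _ assms(3)] by simp
  then show "\<forall>\<^sub>F n in sequentially. norm (\<Sum>k<n. c k *\<^sub>R e k) \<le> B" by simp
qed simp

text \<open>The operator that is diagonal in the basis \<open>e\<close> with the diagonal \<open>m\<close>. It is meaningful when
\<open>m\<close> is bounded; otherwise the series may diverge.\<close>

definition multiplier :: "(nat \<Rightarrow> real) \<Rightarrow> 'h \<Rightarrow> 'h" where
  "multiplier m f = (\<Sum>k. (m k * inner f (e k)) *\<^sub>R e k)"

lemma multiplied_coeff_sq:
  fixes m :: "nat \<Rightarrow> real"
  assumes "\<And>k. \<bar>m k\<bar> \<le> M"
  shows "summable (\<lambda>k. (m k * inner f (e k))\<^sup>2)"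
    and "(\<Sum>k<n. (m k * inner f (e k))\<^sup>2) \<le> (M * norm f)\<^sup>2"
proof -
  have "0 \<le> M" using assms[of 0] by linarith
  have m2: "(m k)\<^sup>2 \<le> M\<^sup>2" for k
    using power_mono[OF assms, of k 2] by simp
  have le: "(m k * inner f (e k))\<^sup>2 \<le> M\<^sup>2 * (inner f (e k))\<^sup>2" for k
    unfolding power_mult_distrib by (rule mult_right_mono[OF m2]) simp
  show "summable (\<lambda>k. (m k * inner f (e k))\<^sup>2)"
    by (rule summable_comparison_test'[OF summable_mult[OF summable_coeff_sq]]) (use le in auto)
  have "(\<Sum>k<n. (m k * inner f (e k))\<^sup>2) \<le> (\<Sum>k<n. M\<^sup>2 * (inner f (e k))\<^sup>2)"
    by (rule sum_mono) (rule le)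
  also have "\<dots> \<le> M\<^sup>2 * (norm f)\<^sup>2"
    unfolding sum_distrib_left[symmetric] by (intro mult_left_mono bessel) auto
  finally show "(\<Sum>k<n. (m k * inner f (e k))\<^sup>2) \<le> (M * norm f)\<^sup>2"
    by (simp add: power_mult_distrib)
qed

lemma coeff_multiplier:
  fixes m :: "nat \<Rightarrow> real"
  assumes "\<And>k. \<bar>m k\<bar> \<le> M"
  shows "inner (multiplier m f) (e k) = m k * inner f (e k)"
  unfolding multiplier_def by (rule inner_series[OF multiplied_coeff_sq(1)[of m M, OF assms]])

lemma norm_multiplier_le:
  fixes m :: "nat \<Rightarrow> real"
  assumes "\<And>k. \<bar>m k\<bar> \<le> M"
  shows "norm (multiplier m f) \<le> M * norm f"
  unfolding multiplier_def
  by (rule norm_series_le[OF multiplied_coeff_sq[of m M, OF assms]])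
     (use assms[of 0] abs_ge_zero[of "m 0"] in \<open>auto intro!: mult_nonneg_nonneg simp del: abs_ge_zero\<close>)

lemma bounded_linear_multiplier:
  fixes m :: "nat \<Rightarrow> real"
  assumes "\<And>k. \<bar>m k\<bar> \<le> M"
  shows "bounded_linear (multiplier m)"
proof (rule bounded_linear_intro)
  show "multiplier m (x + y) = multiplier m x + multiplier m y" for x y
    by (rule coeff_eqI) (simp add: coeff_multiplier[of m M, OF assms] inner_add_left distrib_left)
  show "multiplier m (r *\<^sub>R x) = r *\<^sub>R multiplier m x" for r x
    by (rule coeff_eqI) (simp add: coeff_multiplier[of m M, OF assms])
  show "norm (multiplier m x) \<le> norm x * M" for x
    using norm_multiplier_le[of m M x, OF assms] by (simp add: mult.commute)
qed

text \<open>Pointwise convergence of bounded diagonals gives strong convergence of the operators: on a basis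
vector the claim concerns a single scalar, and the uniform bound extends it from the span. There is
no convergence in operator norm in general, and the heat semigroup at time $0$ has none.\<close>

lemma multiplier_tendsto:
  assumes bd: "eventually (\<lambda>t. \<forall>k. \<bar>m t k\<bar> \<le> M) F"
    and bd0: "\<And>k. \<bar>m0 k\<bar> \<le> M"
    and conv: "\<And>k. ((\<lambda>t. m t k) \<longlongrightarrow> m0 k) F"
  shows "((\<lambda>t. multiplier (m t) f) \<longlongrightarrow> multiplier m0 f) F"
proof -
  have "((\<lambda>t. multiplier (m t) f - multiplier m0 f) \<longlongrightarrow> 0) F"
  proof (rule uniformly_bounded_tendsto_zero[where A = "\<lambda>t x. multiplier (m t) x - multiplier m0 x" and S = "span (range e)" and M = "M + M"])
    show ev: "\<forall>\<^sub>F t in F. linear (\<lambda>x. multiplier (m t) x - multiplier m0 x) \<and>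
        (\<forall>x. norm (multiplier (m t) x - multiplier m0 x) \<le> (M + M) * norm x)"
      using bd
    proof eventually_elim
      case (elim t)
      have "norm (multiplier (m t) x - multiplier m0 x) \<le> (M + M) * norm x" for x
      proof -
        have "norm (multiplier (m t) x) \<le> M * norm x" "norm (multiplier m0 x) \<le> M * norm x"
          using elim bd0 by (auto intro: norm_multiplier_le)
        then show ?thesis
          using norm_triangle_ineq4[of "multiplier (m t) x" "multiplier m0 x"] by (simp add: distrib_right)
      qed
      moreover have "bounded_linear (\<lambda>x. multiplier (m t) x - multiplier m0 x)"
        using elim bd0 by (intro bounded_linear_sub bounded_linear_multiplier[of _ M]) auto
      ultimately show ?case by (auto simp: bounded_linear.linear)
    qed
    show "((\<lambda>t. multiplier (m t) x - multiplier m0 x) \<longlongrightarrow> 0) F" if "x \<in> span (range e)" for x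
      using that
    proof (induction rule: span_induct_alt)
      case base
      show ?case
        by (rule tendsto_eventually) (use ev in \<open>eventually_elim, auto dest: linear_0\<close>)
    next
      case (step c x y)
      then obtain k where x: "x = e k" by auto
      have m_e: "multiplier m' (e k) = m' k *\<^sub>R e k" if "\<And>j. \<bar>m' j\<bar> \<le> M" for m'
        by (rule coeff_eqI) (use that in \<open>auto simp: coeff_multiplier[of _ M] orthonormal\<close>)
      have "((\<lambda>t. (c * (m t k - m0 k)) *\<^sub>R e k + (multiplier (m t) y - multiplier m0 y)) \<longlongrightarrow> (c * (m0 k - m0 k)) *\<^sub>R e k + 0) F"
        by (intro tendsto_intros conv step.IH)
      moreover have "\<forall>\<^sub>F t in F. (c * (m t k - m0 k)) *\<^sub>R e k + (multiplier (m t) y - multiplier m0 y)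
          = multiplier (m t) (c *\<^sub>R x + y) - multiplier m0 (c *\<^sub>R x + y)"
        using bd
      proof eventually_elim
        case (elim t)
        interpret t: bounded_linear "multiplier (m t)" by (rule bounded_linear_multiplier[of _ M]) (use elim in auto)
        interpret t0: bounded_linear "multiplier m0" by (rule bounded_linear_multiplier[of _ M]) (use bd0 in auto)
        show ?case
          using elim bd0 by (simp add: x t.add t.scaleR t0.add t0.scaleR m_e algebra_simps)
      qed
      ultimately show ?case by (auto elim: Lim_transform_eventually)
    qed
  qed (rule dense_span)
  then show ?thesis by (simp add: LIM_zero_iff)
qed

text \<open>The operator that sends each \<open>e k\<close> to \<open>s k\<close>, for a square summable family \<open>s\<close> that does not need
to be orthogonal.\<close>

definition synthesis :: "(nat \<Rightarrow> 'b::banach) \<Rightarrow> 'h \<Rightarrow> 'b" where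
  "synthesis s f = (\<Sum>k. inner f (e k) *\<^sub>R s k)"

lemma synthesis_basis: "synthesis s (e k) = s k"
proof -
  have "(\<lambda>j. inner (e k) (e j) *\<^sub>R s j) = (\<lambda>j. if j = k then s j else 0)"
    by (auto simp: orthonormal)
  then show ?thesis
    unfolding synthesis_def using sums_unique[OF sums_single[of k s]] by simp
qed

text \<open>The Cauchy--Schwarz inequality for sequences bounds the sum of the norms by the norm of the
coefficient sequence times $(\sum_k \|s_k\|^2)^{1/2}$.\<close>

lemma bounded_linear_synthesis:
  fixes s :: "nat \<Rightarrow> 'b::banach"
  assumes s: "summable (\<lambda>k. (norm (s k))\<^sup>2)"
  shows "bounded_linear (synthesis s)"
proof (rule bounded_linear_intro)
  define B where "B = sqrt (\<Sum>k. (norm (s k))\<^sup>2)"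
  have part: "(\<Sum>k<n. norm (inner f (e k) *\<^sub>R s k)) \<le> norm f * B" for f n
  proof -
    have "(\<Sum>k<n. norm (inner f (e k) *\<^sub>R s k)) = (\<Sum>k<n. \<bar>inner f (e k)\<bar> * \<bar>norm (s k)\<bar>)" by simp
    also have "\<dots> \<le> L2_set (\<lambda>k. inner f (e k)) {..<n} * L2_set (\<lambda>k. norm (s k)) {..<n}"
      by (rule L2_set_mult_ineq)
    also have "\<dots> \<le> norm f * B"
      unfolding L2_set_def B_def
      by (intro mult_mono real_sqrt_le_mono sum_le_suminf s real_le_lsqrt bessel) (auto intro: sum_nonneg)
    finally show ?thesis .
  qed
  have abs: "summable (\<lambda>k. norm (inner f (e k) *\<^sub>R s k))" for f
    by (rule summableI_nonneg_bounded[OF _ part]) simp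
  have sm: "summable (\<lambda>k. inner f (e k) *\<^sub>R s k)" for f
    by (rule summable_norm_cancel[OF abs])
  show "synthesis s (x + y) = synthesis s x + synthesis s y" for x y
    unfolding synthesis_def by (simp add: suminf_add[OF sm sm] inner_add_left scaleR_add_left)
  show "synthesis s (r *\<^sub>R x) = r *\<^sub>R synthesis s x" for r x
    unfolding synthesis_def by (simp add: suminf_scaleR_right[OF sm])
  show "norm (synthesis s x) \<le> norm x * B" for x
    unfolding synthesis_def
    by (rule order_trans[OF summable_norm[OF abs]]) (rule suminf_le_const[OF abs part])
qed

end

section \<open>The cosine basis of $L^2(0,1)$\<close>

lemma lebesgue01_prob: "finite_measure lebesgue01" "measure lebesgue01 (space lebesgue01) = 1"
proof -
  show "finite_measure lebesgue01"
    by (rule finite_measureI) (simp add: emeasure_restrict_space)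
  show "measure lebesgue01 (space lebesgue01) = 1"
    by (simp add: measure_restrict_space)
qed

lemma inner_abs_l2:
  assumes "square_integrable f" "square_integrable g"
  shows "inner (abs_l2 f) (abs_l2 g) = (LINT x|lebesgue01. f x * g x)"
  using assms by (simp add: inner_l2.abs_eq)

lemma inner_abs_l2_continuous:
  assumes "continuous_on {0..1} f" "continuous_on {0..1} g"
  shows "inner (abs_l2 f) (abs_l2 g) = integral {0..1} (\<lambda>x. f x * g x)"
proof -
  have sq: "square_integrable f" "square_integrable g"
    using assms by (auto intro: square_integrable_continuous)
  have "inner (abs_l2 f) (abs_l2 g) = integral {0<..<1} (\<lambda>x. f x * g x)"
    unfolding inner_abs_l2[OF sq]
    by (intro lebesgue_integral_eq_integral square_integrable_mult sq) simp
  then show ?thesis by (simp add: integral_open_interval_real)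
qed

lemma abs_l2_eq_iff:
  assumes "square_integrable f" "square_integrable g"
  shows "abs_l2 f = abs_l2 g \<longleftrightarrow> (AE x in lebesgue01. f x = g x)"
  using Quotient3_rel[OF Quotient3_l2, of f g] assms by auto

lemma abs_l2_cong:
  assumes "square_integrable f" "\<And>x. 0 < x \<Longrightarrow> x < 1 \<Longrightarrow> f x = g x"
  shows "abs_l2 f = abs_l2 g"
proof -
  have "square_integrable g"
    using assms measurable_cong[of lebesgue01 f g borel]
      Bochner_Integration.integrable_cong[OF refl, of lebesgue01 "\<lambda>x. (f x)\<^sup>2" "\<lambda>x. (g x)\<^sup>2"]
    by (simp add: square_integrable_def)
  moreover have "AE x in lebesgue01. f x = g x"
    by (rule AE_I2) (simp add: assms(2))
  ultimately show ?thesis using assms(1) by (simp add: abs_l2_eq_iff)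
qed

lemma abs_l2_add:
  assumes "square_integrable f" "square_integrable g"
  shows "abs_l2 (\<lambda>x. f x + g x) = abs_l2 f + abs_l2 g"
  using assms by (simp add: plus_l2.abs_eq)

lemma abs_l2_scale:
  assumes "square_integrable f"
  shows "abs_l2 (\<lambda>x. c * f x) = c *\<^sub>R abs_l2 f"
  using assms by (simp add: scaleR_l2.abs_eq)

lemma abs_l2_zero: "abs_l2 (\<lambda>x. 0) = 0"
  by (simp add: zero_l2_def)

lemma square_integrable_sum:
  assumes "\<And>i. i \<in> I \<Longrightarrow> square_integrable (f i)"
  shows "square_integrable (\<lambda>x. \<Sum>i\<in>I. f i x)"
  using assms by (induction I rule: infinite_finite_induct)
    (auto intro: square_integrable_zero square_integrable_add)

lemma abs_l2_sum:
  assumes "\<And>i. i \<in> I \<Longrightarrow> square_integrable (f i)"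
  shows "abs_l2 (\<lambda>x. \<Sum>i\<in>I. f i x) = (\<Sum>i\<in>I. abs_l2 (f i))"
  using assms by (induction I rule: infinite_finite_induct)
    (auto simp: abs_l2_zero abs_l2_add square_integrable_sum)

lemma norm_sq_abs_l2:
  assumes "square_integrable f"
  shows "(norm (abs_l2 f))\<^sup>2 = (LINT x|lebesgue01. (f x)\<^sup>2)"
  using assms by (simp add: dot_square_norm[symmetric] inner_abs_l2 power2_eq_square[of "f _"])

text \<open>The measure of the interval is $1$, so the $L^2$ norm is at most the supremum norm.\<close>

lemma norm_abs_l2_le:
  assumes f: "square_integrable f" and le: "\<And>x. 0 < x \<Longrightarrow> x < 1 \<Longrightarrow> \<bar>f x\<bar> \<le> c" and "0 \<le> c"
  shows "norm (abs_l2 f) \<le> c"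
proof (rule power2_le_imp_le)
  interpret finite_measure lebesgue01 by (rule lebesgue01_prob)
  have "(LINT x|lebesgue01. (f x)\<^sup>2) \<le> (LINT x|lebesgue01. c\<^sup>2)"
  proof (rule integral_mono)
    show "integrable lebesgue01 (\<lambda>x. (f x)\<^sup>2)" using f by (simp add: square_integrable_def)
    show "(f x)\<^sup>2 \<le> c\<^sup>2" if "x \<in> space lebesgue01" for x
      using power_mono[OF le[of x], of 2] that by simp
  qed simp
  then show "(norm (abs_l2 f))\<^sup>2 \<le> c\<^sup>2"
    using lebesgue01_prob(2) by (simp add: norm_sq_abs_l2[OF f])
qed fact

text \<open>Dominated convergence for $(f_n - g)^2 \le 2w^2 + 2g^2$.\<close>

lemma abs_l2_dominated_tendsto:
  assumes f: "\<And>n. square_integrable (f n)" and g: "square_integrable g" and w: "square_integrable w"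
    and lim: "AE x in lebesgue01. (\<lambda>n. f n x) \<longlonglongrightarrow> g x"
    and dom: "\<And>n. AE x in lebesgue01. \<bar>f n x\<bar> \<le> w x"
  shows "(\<lambda>n. abs_l2 (f n)) \<longlonglongrightarrow> abs_l2 g"
proof -
  have [measurable]: "f n \<in> borel_measurable lebesgue01" "g \<in> borel_measurable lebesgue01" for n
    using f g by (auto simp: square_integrable_def)
  have "(\<lambda>n. LINT x|lebesgue01. (f n x - g x)\<^sup>2) \<longlonglongrightarrow> (LINT x|lebesgue01. 0)"
  proof (rule integral_dominated_convergence)
    show "integrable lebesgue01 (\<lambda>x. 2 * (w x)\<^sup>2 + 2 * (g x)\<^sup>2)"
      using w g by (auto simp: square_integrable_def)
    show "AE x in lebesgue01. (\<lambda>n. (f n x - g x)\<^sup>2) \<longlonglongrightarrow> 0"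
      using lim
    proof eventually_elim
      case (elim x)
      have "(\<lambda>n. (f n x - g x)\<^sup>2) \<longlonglongrightarrow> (g x - g x)\<^sup>2"
        by (intro tendsto_intros elim)
      then show ?case by simp
    qed
    show "AE x in lebesgue01. norm ((f n x - g x)\<^sup>2) \<le> 2 * (w x)\<^sup>2 + 2 * (g x)\<^sup>2" for n
      using dom[of n]
    proof eventually_elim
      case (elim x)
      have "(f n x)\<^sup>2 \<le> (w x)\<^sup>2"
        using power_mono[OF elim, of 2] by simp
      moreover have "(f n x - g x)\<^sup>2 + (f n x + g x)\<^sup>2 = 2 * (f n x)\<^sup>2 + 2 * (g x)\<^sup>2"
        by (simp add: power2_sum power2_diff)
      moreover have "0 \<le> (f n x + g x)\<^sup>2" by simp
      ultimately have "(f n x - g x)\<^sup>2 \<le> 2 * (w x)\<^sup>2 + 2 * (g x)\<^sup>2" by linarith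
      then show ?case by simp
    qed
  qed measurable
  moreover have "(LINT x|lebesgue01. (f n x - g x)\<^sup>2) = (norm (abs_l2 (f n) - abs_l2 g))\<^sup>2" for n
    by (simp add: norm_sq_abs_l2 square_integrable_diff f g flip: abs_l2_diff)
  ultimately have "(\<lambda>n. (norm (abs_l2 (f n) - abs_l2 g))\<^sup>2) \<longlonglongrightarrow> 0" by simp
  then have "(\<lambda>n. sqrt ((norm (abs_l2 (f n) - abs_l2 g))\<^sup>2)) \<longlonglongrightarrow> sqrt 0"
    by (rule tendsto_real_sqrt)
  then show ?thesis
    by (subst LIM_zero_iff[symmetric]) (simp add: tendsto_norm_zero_iff)
qed

text \<open>A measurable function is an almost everywhere limit of continuous functions. Those need not converge
in $L^2$, but they do after truncation at a fixed height $M$, because a constant dominates them. Then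
the truncations of the function itself converge as $M$ tends to infinity.\<close>

lemma continuous_dense_l2: "closure (abs_l2 ` {u. continuous_on {0..1} u}) = UNIV"
proof -
  interpret finite_measure lebesgue01 by (rule lebesgue01_prob)
  define cut where "cut M y = max (- M) (min M y)" for M y :: real
  have cut: "\<bar>cut M y\<bar> \<le> M" if "0 \<le> M" for M y using that by (auto simp: cut_def)
  have cut_le: "\<bar>cut M y\<bar> \<le> \<bar>y\<bar>" if "0 \<le> M" for M y using that by (auto simp: cut_def)
  let ?C = "closure (abs_l2 ` {u. continuous_on {0..1} u})"
  have sq_cut: "square_integrable (\<lambda>x. cut M (r x))"
    if M: "0 \<le> M" and r[measurable]: "r \<in> borel_measurable lebesgue01" for M r
  proof -
    have m[measurable]: "(\<lambda>x. cut M (r x)) \<in> borel_measurable lebesgue01"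
      unfolding cut_def by measurable
    have "integrable lebesgue01 (\<lambda>x. (cut M (r x))\<^sup>2)"
    proof (rule integrable_const_bound[where B = "M\<^sup>2"])
      have "(cut M y)\<^sup>2 \<le> M\<^sup>2" for y using power_mono[OF cut[OF M, of y], of 2] by simp
      then show "AE x in lebesgue01. norm ((cut M (r x))\<^sup>2) \<le> M\<^sup>2" by simp
    qed measurable
    with m show ?thesis by (simp add: square_integrable_def)
  qed
  have "f \<in> ?C" for f
  proof -
    define r where "r = rep_l2 f"
    have r: "square_integrable r" and f: "f = abs_l2 r"
      by (simp_all add: r_def square_integrable_rep_l2 abs_rep_l2)
    then have rm[measurable]: "r \<in> borel_measurable lebesgue01" by (simp add: square_integrable_def)
    then have "r measurable_on {0<..<1}" by (simp add: measurable_on_iff_borel_measurable)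
    then obtain N g where N: "negligible N" and g: "\<And>n. continuous_on UNIV (g n)"
      and gr: "\<And>x. x \<notin> N \<Longrightarrow> (\<lambda>n. g n x) \<longlonglongrightarrow> (if x \<in> {0<..<1} then r x else 0)"
      unfolding measurable_on_def by metis
    have AE: "AE x in lebesgue01. (\<lambda>n. g n x) \<longlonglongrightarrow> r x"
    proof -
      have "AE x in lebesgue. x \<notin> N"
        using N by (simp add: AE_not_in negligible_iff_null_sets)
      then have "AE x in lebesgue. x \<in> {0<..<1} \<longrightarrow> (\<lambda>n. g n x) \<longlonglongrightarrow> r x"
      proof eventually_elim
        case (elim x)
        then show ?case using gr[of x] by (auto split: if_splits)
      qed
      then show ?thesis by (simp add: AE_restrict_space_iff)
    qed
    have trunc: "abs_l2 (\<lambda>x. cut (real M) (r x)) \<in> ?C" for M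
    proof (rule closed_sequentially[OF closed_closure])
      have c: "continuous_on {0..1} (\<lambda>x. cut (real M) (g n x))" for n
        unfolding cut_def by (intro continuous_intros continuous_on_subset[OF g]) auto
      then show "abs_l2 (\<lambda>x. cut (real M) (g n x)) \<in> ?C" for n
        by (intro subsetD[OF closure_subset] imageI CollectI)
      show "(\<lambda>n. abs_l2 (\<lambda>x. cut (real M) (g n x))) \<longlonglongrightarrow> abs_l2 (\<lambda>x. cut (real M) (r x))"
      proof (rule abs_l2_dominated_tendsto[where w = "\<lambda>x. real M"])
        show "AE x in lebesgue01. (\<lambda>n. cut (real M) (g n x)) \<longlonglongrightarrow> cut (real M) (r x)"
          using AE unfolding cut_def by eventually_elim (intro tendsto_intros)
      qed (use c cut sq_cut in \<open>auto intro: square_integrable_continuous\<close>)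
    qed
    show ?thesis
      unfolding f
    proof (rule closed_sequentially[OF closed_closure trunc])
      show "(\<lambda>M. abs_l2 (\<lambda>x. cut (real M) (r x))) \<longlonglongrightarrow> abs_l2 r"
      proof (rule abs_l2_dominated_tendsto[where w = "\<lambda>x. \<bar>r x\<bar>"])
        have "(\<lambda>M. cut (real M) (r x)) \<longlonglongrightarrow> r x" for x
        proof (rule tendsto_eventually)
          obtain M0 where "\<bar>r x\<bar> \<le> real M0" using real_arch_simple by blast
          then have "cut (real M) (r x) = r x" if "M \<ge> M0" for M
            using that unfolding cut_def by (smt (verit) of_nat_mono)
          then show "\<forall>\<^sub>F M in sequentially. cut (real M) (r x) = r x"
            by (auto simp: eventually_sequentially)
        qed
        then show "AE x in lebesgue01. (\<lambda>M. cut (real M) (r x)) \<longlonglongrightarrow> r x" by simp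
        show "square_integrable (\<lambda>x. \<bar>r x\<bar>)"
          using r by (auto simp: square_integrable_def)
      qed (use r rm cut_le sq_cut in auto)
    qed
  qed
  then show ?thesis by auto
qed

lemma continuous_in_closure_l2:
  assumes u: "continuous_on {0..1} u"
    and approx: "\<And>\<epsilon>. \<epsilon> > 0 \<Longrightarrow> \<exists>v. continuous_on {0..1} v \<and> abs_l2 v \<in> S \<and> (\<forall>x\<in>{0..1}. \<bar>u x - v x\<bar> < \<epsilon>)"
  shows "abs_l2 u \<in> closure S"
  unfolding closure_approachable
proof (intro allI impI)
  fix \<epsilon> :: real assume "\<epsilon> > 0"
  then obtain v where v: "continuous_on {0..1} v" "abs_l2 v \<in> S" "\<forall>x\<in>{0..1}. \<bar>u x - v x\<bar> < \<epsilon> / 2"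
    using approx[of "\<epsilon> / 2"] by auto
  have sq: "square_integrable u" "square_integrable v"
    using u v(1) by (auto intro: square_integrable_continuous)
  have "norm (abs_l2 (\<lambda>x. u x - v x)) \<le> \<epsilon> / 2"
  proof (rule norm_abs_l2_le[OF square_integrable_diff[OF sq]])
    show "\<bar>u x - v x\<bar> \<le> \<epsilon> / 2" if "0 < x" "x < 1" for x
      using v(3) that by (simp add: less_imp_le)
  qed (use \<open>\<epsilon> > 0\<close> in simp)
  then have "norm (abs_l2 u - abs_l2 v) \<le> \<epsilon> / 2" by (simp add: abs_l2_diff sq)
  then show "\<exists>y\<in>S. dist y (abs_l2 u) < \<epsilon>"
    using v(2) \<open>\<epsilon> > 0\<close> by (intro bexI[of _ "abs_l2 v"]) (auto simp: dist_norm norm_minus_commute)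
qed

text \<open>Stone--Weierstrass for the algebra of polynomials in $s$, which separates points because $s$ is
injective. It is used for $s(x) = \cos(\pi x)$, to see that the cosines are complete, and for
$s(x) = x$, to see that test functions are dense.\<close>

lemma powers_dense_l2:
  assumes s: "continuous_on {0..1} s" "inj_on s {0..1::real}"
  shows "closure (span (range (\<lambda>m. abs_l2 (\<lambda>x. s x ^ m)))) = UNIV" (is "closure (span ?S) = _")
proof -
  have "abs_l2 u \<in> closure (span ?S)" if u: "continuous_on {0..1} u" for u
  proof (rule continuous_in_closure_l2[OF u])
    fix \<epsilon> :: real assume "\<epsilon> > 0"
    define P where "P f \<longleftrightarrow> (\<exists>q. f = (\<lambda>x. poly q (s x)))" for f :: "real \<Rightarrow> real"
    have P: "P (\<lambda>x. poly q (s x))" for q by (auto simp: P_def)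
    have contP: "continuous_on {0..1} f" if "P f" for f
      using that s(1) unfolding P_def by (auto intro!: continuous_intros)
    have "\<exists>g. P g \<and> (\<forall>x\<in>{0..1}. \<bar>u x - g x\<bar> < \<epsilon>)"
    proof (rule Stone_Weierstrass_HOL[where P = P, OF _ _ _ _ _ _ u \<open>\<epsilon> > 0\<close>])
      show "P (\<lambda>x. c)" for c using P[of "[:c:]"] by simp
      show "P (\<lambda>x. f x + g x)" if fg: "P f \<and> P g" for f g
      proof -
        obtain p where p: "f = (\<lambda>x. poly p (s x))"
          using conjunct1[OF fg] unfolding P_def by (rule exE)
        obtain q where q: "g = (\<lambda>x. poly q (s x))"
          using conjunct2[OF fg] unfolding P_def by (rule exE)
        show ?thesis unfolding p q using P[of "p + q"] by simp
      qed
      show "P (\<lambda>x. f x * g x)" if fg: "P f \<and> P g" for f g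
      proof -
        obtain p where p: "f = (\<lambda>x. poly p (s x))"
          using conjunct1[OF fg] unfolding P_def by (rule exE)
        obtain q where q: "g = (\<lambda>x. poly q (s x))"
          using conjunct2[OF fg] unfolding P_def by (rule exE)
        show ?thesis unfolding p q using P[of "p * q"] by simp
      qed
      show "\<exists>f. P f \<and> f x \<noteq> f y" if "x \<in> {0..1} \<and> y \<in> {0..1} \<and> x \<noteq> y" for x y
        using that s(2) P[of "[:0, 1:]"] by (intro exI[of _ s]) (auto simp: inj_on_def)
    qed (use contP in auto)
    then obtain q where q: "\<forall>x\<in>{0..1}. \<bar>u x - poly q (s x)\<bar> < \<epsilon>" by (auto simp: P_def)
    have sq: "square_integrable (\<lambda>x. s x ^ m)" for m
      using s(1) by (intro square_integrable_continuous continuous_intros)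
    have "abs_l2 (\<lambda>x. poly q (s x)) = (\<Sum>i\<le>degree q. coeff q i *\<^sub>R abs_l2 (\<lambda>x. s x ^ i))"
      unfolding poly_altdef by (subst abs_l2_sum) (auto simp: abs_l2_scale sq intro: square_integrable_scale)
    moreover have "(\<Sum>i\<le>degree q. coeff q i *\<^sub>R abs_l2 (\<lambda>x. s x ^ i)) \<in> span ?S"
      by (intro span_sum span_scale span_base rangeI)
    ultimately have "abs_l2 (\<lambda>x. poly q (s x)) \<in> span ?S" by simp
    with q contP[OF P] show "\<exists>v. continuous_on {0..1} v \<and> abs_l2 v \<in> span ?S \<and> (\<forall>x\<in>{0..1}. \<bar>u x - v x\<bar> < \<epsilon>)"
      by blast
  qed
  then have "closure (abs_l2 ` {u. continuous_on {0..1} u}) \<subseteq> closure (span ?S)"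
    by (intro closure_minimal) auto
  then show ?thesis using continuous_dense_l2 by auto
qed

definition cos_basis :: "nat \<Rightarrow> real \<Rightarrow> real" where
  "cos_basis k x = (if k = 0 then 1 else sqrt 2 * cos (k * pi * x))"

lemma continuous_on_cos_basis: "continuous_on S (cos_basis k)"
  unfolding cos_basis_def by (cases "k = 0") (auto intro!: continuous_intros)

lemma integral_cos_int:
  assumes "m \<noteq> 0"
  shows "integral {0..1} (\<lambda>x. cos (of_int m * pi * x)) = 0"
proof -
  have "((\<lambda>x. cos (of_int m * pi * x)) has_integral
      (sin (of_int m * pi * 1) / (of_int m * pi) - sin (of_int m * pi * 0) / (of_int m * pi))) {0..1}"
    using assms
    by (intro fundamental_theorem_of_calculus)
       (auto simp: has_real_derivative_iff_has_vector_derivative[symmetric] intro!: derivative_eq_intros)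
  moreover have "sin (of_int m * pi) = 0"
    unfolding sin_zero_iff_int2 by blast
  ultimately show ?thesis by (simp add: integral_unique)
qed

definition cos_l2 :: "nat \<Rightarrow> l2" where
  "cos_l2 k = abs_l2 (cos_basis k)"

lemma square_integrable_cos_basis: "square_integrable (cos_basis k)"
  by (intro square_integrable_continuous continuous_on_cos_basis)

lemma cos_l2_orthonormal: "inner (cos_l2 i) (cos_l2 j) = (if i = j then 1 else 0)"
proof -
  define m p :: int where "m = int i - int j" and "p = int i + int j"
  have ii: "(\<lambda>x. cos (of_int m * pi * x)) integrable_on {0..1}" for m :: int
    by (intro integrable_continuous_interval continuous_intros)
  have prod: "cos (i * pi * x) * cos (j * pi * x) = (cos (of_int m * pi * x) + cos (of_int p * pi * x)) / 2" for x
    unfolding cos_times_cos m_def p_def by (simp add: algebra_simps)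
  have I: "integral {0..1} (\<lambda>x. cos (i * pi * x) * cos (j * pi * x))
      = (integral {0..1} (\<lambda>x. cos (of_int m * pi * x)) + integral {0..1} (\<lambda>x. cos (of_int p * pi * x))) / 2"
    unfolding prod by (simp add: integral_add ii)
  define a where "a k = (if k = (0::nat) then 1 else sqrt 2)" for k
  have cb: "cos_basis k x = a k * cos (k * pi * x)" for k x by (simp add: cos_basis_def a_def)
  have "inner (cos_l2 i) (cos_l2 j) = a i * a j * integral {0..1} (\<lambda>x. cos (i * pi * x) * cos (j * pi * x))"
    unfolding cos_l2_def
    unfolding inner_abs_l2_continuous[OF continuous_on_cos_basis continuous_on_cos_basis] cb
    by (simp add: mult_ac flip: integral_mult_right)
  moreover have "integral {0..1} (\<lambda>x. cos (of_int m * pi * x)) = (if m = 0 then 1 else 0)"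
    by (simp add: integral_cos_int)
  moreover have "integral {0..1} (\<lambda>x. cos (of_int p * pi * x)) = (if p = 0 then 1 else 0)"
    by (simp add: integral_cos_int)
  moreover have "m = 0 \<longleftrightarrow> i = j" "p = 0 \<longleftrightarrow> i = 0 \<and> j = 0" by (auto simp: m_def p_def)
  ultimately show ?thesis unfolding I by (auto simp: a_def)
qed

text \<open>The product $\cos(k\pi x)\cos(\pi x)$ is a combination of the cosines of frequency $k+1$ and $k-1$.
So the span of the cosines is invariant under multiplication by $\cos(\pi x)$ and contains all powers
of $\cos(\pi x)$.\<close>

lemma cos_l2_dense: "closure (span (range cos_l2)) = UNIV"
proof -
  have sq: "square_integrable (\<lambda>x. cos (real k * pi * x) * cos (pi * x) ^ m)" for k m
    by (intro square_integrable_continuous continuous_intros)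
  have "abs_l2 (\<lambda>x. cos (real k * pi * x) * cos (pi * x) ^ m) \<in> span (range cos_l2)" for k m
  proof (induction m arbitrary: k)
    case 0
    have "abs_l2 (\<lambda>x. cos (real k * pi * x)) = (if k = 0 then 1 else 1 / sqrt 2) *\<^sub>R cos_l2 k"
      unfolding cos_l2_def abs_l2_scale[OF square_integrable_cos_basis, symmetric]
      by (simp add: cos_basis_def)
    then show ?case by (auto intro: span_scale span_base)
  next
    case (Suc m)
    \<comment> \<open>The cosine is even, so at $k = 0$ the frequency $k - 1$ may be replaced by $1$.\<close>
    define k' where "k' = (if k = 0 then 1 else k - 1)"
    have k': "cos (real k' * pi * x) = cos (real k * pi * x - pi * x)" for x
      by (cases "k = 0") (auto simp: k'_def algebra_simps of_nat_diff)
    have "cos (real k * pi * x) * cos (pi * x) = (1/2) * cos (real (Suc k) * pi * x) + (1/2) * cos (real k' * pi * x)" for x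
      unfolding k' cos_times_cos by (simp add: algebra_simps add_divide_distrib)
    then have "cos (real k * pi * x) * cos (pi * x) ^ Suc m
        = (1/2) * (cos (real (Suc k) * pi * x) * cos (pi * x) ^ m) + (1/2) * (cos (real k' * pi * x) * cos (pi * x) ^ m)" for x
      by (metis (no_types, lifting) distrib_right mult.assoc power_Suc)
    then have "abs_l2 (\<lambda>x. cos (real k * pi * x) * cos (pi * x) ^ Suc m)
        = (1/2) *\<^sub>R abs_l2 (\<lambda>x. cos (real (Suc k) * pi * x) * cos (pi * x) ^ m)
        + (1/2) *\<^sub>R abs_l2 (\<lambda>x. cos (real k' * pi * x) * cos (pi * x) ^ m)"
      by (simp only: abs_l2_add abs_l2_scale square_integrable_scale sq)
    then show ?case by (simp only:) (intro span_add span_scale Suc.IH)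
  qed
  from this[of 0] have "range (\<lambda>m. abs_l2 (\<lambda>x. cos (pi * x) ^ m)) \<subseteq> span (range cos_l2)" by auto
  then have "span (range (\<lambda>m. abs_l2 (\<lambda>x. cos (pi * x) ^ m))) \<subseteq> span (range cos_l2)"
    by (intro span_minimal) auto
  then have "closure (span (range (\<lambda>m. abs_l2 (\<lambda>x. cos (pi * x) ^ m)))) \<subseteq> closure (span (range cos_l2))"
    by (rule closure_mono)
  moreover have "inj_on (\<lambda>x. cos (pi * x)) {0..1}"
  proof (rule inj_onI)
    fix x y :: real assume x: "x \<in> {0..1}" and y: "y \<in> {0..1}" and eq: "cos (pi * x) = cos (pi * y)"
    have "0 \<le> pi * x" "pi * x \<le> pi" "0 \<le> pi * y" "pi * y \<le> pi"
      using x y by (auto simp: mult_le_cancel_left1)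
    then have "pi * x = pi * y" by (rule cos_inj_pi[OF _ _ _ _ eq])
    then show "x = y" by simp
  qed
  then have "closure (span (range (\<lambda>m. abs_l2 (\<lambda>x. cos (pi * x) ^ m)))) = UNIV"
    by (intro powers_dense_l2 continuous_intros)
  ultimately show ?thesis by auto
qed

lemma hilbert_basis_cos_l2: "hilbert_basis cos_l2"
  by (rule hilbert_basis.intro[OF cos_l2_orthonormal cos_l2_dense])

interpretation cosb: hilbert_basis cos_l2
  by (rule hilbert_basis_cos_l2)

section \<open>The Volterra operator on $L^2(0,1)$\<close>

text \<open>Identities between bounded operators on $L^2$ can be verified by calculus with continuous functions.\<close>

lemma bounded_linear_eq_on_continuous:
  fixes A B :: "l2 \<Rightarrow> 'b::real_normed_vector"
  assumes "bounded_linear A" "bounded_linear B"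
    and "\<And>u. continuous_on {0..1} u \<Longrightarrow> A (abs_l2 u) = B (abs_l2 u)"
  shows "A f = B f"
proof (rule bounded_linear_eq_on_dense_span[OF assms(1,2)])
  show "A x = B x" if "x \<in> abs_l2 ` {u. continuous_on {0..1} u}" for x
    using that assms(3) by auto
  have "UNIV \<subseteq> closure (span (abs_l2 ` {u. continuous_on {0..1} u}))"
    using closure_mono[OF span_superset] continuous_dense_l2 by metis
  then show "closure (span (abs_l2 ` {u. continuous_on {0..1} u})) = UNIV" by auto
qed

text \<open>The integral of the continuous function $(u - v)^2$ vanishes.\<close>

lemma continuous_rep_unique:
  assumes u: "continuous_on {0..1} u" and v: "continuous_on {0..1} v"
    and eq: "abs_l2 u = abs_l2 v" and x: "x \<in> {0..1}"
  shows "u x = v x"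
proof -
  have sq: "square_integrable u" "square_integrable v"
    using u v by (auto intro: square_integrable_continuous)
  have c: "continuous_on {0..1} (\<lambda>x. u x - v x)" by (intro continuous_intros u v)
  have "abs_l2 (\<lambda>x. u x - v x) = 0" by (simp add: abs_l2_diff sq eq)
  then have "integral {0..1} (\<lambda>x. (u x - v x) * (u x - v x)) = 0"
    using inner_abs_l2_continuous[OF c c] by simp
  moreover have c2: "continuous_on {0..1} (\<lambda>x. (u x - v x) * (u x - v x))"
    by (intro continuous_intros c)
  ultimately have "((\<lambda>x. (u x - v x) * (u x - v x)) has_integral 0) {0..1}"
    using integrable_integral[OF integrable_continuous_interval[OF c2]] by simp
  then have "(u x - v x) * (u x - v x) = 0"
    using has_integral_0_cbox_imp_0[of 0 1 "\<lambda>x. (u x - v x) * (u x - v x)" x] c2 x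
    by (simp add: box_real cbox_interval)
  then show ?thesis by simp
qed

lemma point_value_abs_l2:
  assumes "continuous_on {0..1} u" "x \<in> {0..1}"
  shows "point_value (abs_l2 u) x = u x"
  unfolding point_value_def
  by (rule the_equality) (use assms continuous_rep_unique in blast)+

definition one_l2 :: l2 where "one_l2 = abs_l2 (\<lambda>x. 1)"

lemma cos_l2_0: "cos_l2 0 = one_l2"
  unfolding cos_l2_def one_l2_def by (rule arg_cong[of _ _ abs_l2]) (auto simp: cos_basis_def)

lemma inner_one_one: "inner one_l2 one_l2 = 1"
  using cos_l2_orthonormal[of 0 0] by (simp add: cos_l2_0)

text \<open>Pairing with these indicator functions is integration from $0$ to $x$. It makes primitives of elements
of $L^2$ available pointwise, without a choice of a representative.\<close>

definition step_l2 :: "real \<Rightarrow> l2" where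
  "step_l2 x = abs_l2 (indicator {0..x})"

lemma square_integrable_indicator:
  assumes "A \<in> sets borel"
  shows "square_integrable (indicator A)"
proof -
  interpret finite_measure lebesgue01 by (rule lebesgue01_prob)
  have m: "(indicator A :: real \<Rightarrow> real) \<in> borel_measurable lebesgue01"
  proof -
    have "(indicator A :: real \<Rightarrow> real) \<in> borel_measurable lebesgue"
      using assms by (intro borel_measurable_indicator) auto
    then show ?thesis by (rule measurable_restrict_space1)
  qed
  have "integrable lebesgue01 (\<lambda>x. (indicator A x :: real)\<^sup>2)"
    by (rule integrable_const_bound[where B = 1])
       (auto simp: indicator_def[abs_def] intro!: borel_measurable_power m[unfolded indicator_def[abs_def]])
  with m show ?thesis by (simp add: square_integrable_def)
qed

lemma inner_step_continuous:
  assumes u: "continuous_on {0..1} u" and x: "x \<in> {0..1}"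
  shows "inner (abs_l2 u) (step_l2 x) = integral {0..x} u"
proof -
  have sq: "square_integrable u" "square_integrable (indicator {0..x})"
    using u by (auto intro: square_integrable_continuous square_integrable_indicator)
  have "inner (abs_l2 u) (step_l2 x) = integral {0<..<1} (\<lambda>s. u s * indicator {0..x} s)"
    unfolding step_l2_def inner_abs_l2[OF sq]
    by (intro lebesgue_integral_eq_integral square_integrable_mult sq) simp
  also have "\<dots> = integral {0..1} (\<lambda>s. u s * indicator {0..x} s)"
    by (simp add: integral_open_interval_real)
  also have "\<dots> = integral {0..1} (\<lambda>s. if s \<in> {0..x} then u s else 0)"
    by (rule integral_cong) (simp add: indicator_def)
  also have "\<dots> = integral ({0..x} \<inter> {0..1}) u"
    by (rule integral_restrict_Int)
  also have "{0..x} \<inter> {0..1} = {0..x}" using x by auto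
  finally show ?thesis .
qed

lemma step_l2_1: "step_l2 1 = one_l2"
  unfolding step_l2_def one_l2_def
  by (rule abs_l2_cong) (auto intro: square_integrable_indicator)

text \<open>The difference is the indicator function of an interval of length $y - x$. So \<open>step_l2\<close> is Hoelder
continuous of order $1/2$, and primitives are continuous.\<close>

lemma norm_step_diff:
  assumes "0 \<le> x" "x \<le> y" "y \<le> 1"
  shows "(norm (step_l2 y - step_l2 x))\<^sup>2 \<le> y - x"
proof -
  have sq: "square_integrable (indicator {0..y})" "square_integrable (indicator {0..x})"
      "square_integrable (indicator {x<..y})"
    by (auto intro: square_integrable_indicator)
  have "step_l2 y - step_l2 x = abs_l2 (indicator {x<..y})"
    unfolding step_l2_def abs_l2_diff[OF sq(1,2), symmetric]
    by (rule abs_l2_cong[OF square_integrable_diff[OF sq(1,2)]]) (use assms in \<open>auto simp: indicator_def\<close>)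
  then have "(norm (step_l2 y - step_l2 x))\<^sup>2 = (LINT s|lebesgue01. (indicator {x<..y} s)\<^sup>2)"
    by (simp add: norm_sq_abs_l2[OF sq(3)])
  also have "(\<lambda>s. (indicator {x<..y} s :: real)\<^sup>2) = indicator {x<..y}"
    by (auto simp: indicator_def)
  also have "(LINT s|lebesgue01. indicator {x<..y} s) = measure lebesgue01 ({x<..y} \<inter> space lebesgue01)"
    by (rule Bochner_Integration.integral_indicator)
  also have "\<dots> = measure lebesgue ({x<..y} \<inter> {0<..<1})"
    by (subst measure_restrict_space) auto
  also have "\<dots> \<le> measure lebesgue {x<..y}"
    by (rule measure_mono_fmeasurable) (auto simp: lmeasurable_iff_integrable[symmetric] intro: bounded_set_imp_lmeasurable)
  also have "\<dots> = y - x" using assms by simp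
  finally show ?thesis .
qed

lemma continuous_on_step: "continuous_on {0..1} step_l2"
  unfolding continuous_on_iff
proof (intro ballI allI impI)
  fix x :: real and \<epsilon> :: real assume x: "x \<in> {0..1}" and \<epsilon>: "\<epsilon> > 0"
  have "dist (step_l2 y) (step_l2 x) < \<epsilon>" if y: "y \<in> {0..1}" and d: "dist y x < \<epsilon>\<^sup>2" for y
  proof -
    have "(norm (step_l2 y - step_l2 x))\<^sup>2 \<le> \<bar>y - x\<bar>"
    proof (cases "x \<le> y")
      case True
      then show ?thesis using norm_step_diff[of x y] x y by simp
    next
      case False
      then show ?thesis using norm_step_diff[of y x] x y by (simp add: norm_minus_commute)
    qed
    then have "(norm (step_l2 y - step_l2 x))\<^sup>2 < \<epsilon>\<^sup>2"
      using d by (simp add: dist_real_def)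
    from power2_less_imp_less[OF this] \<epsilon> show ?thesis by (simp add: dist_norm)
  qed
  then show "\<exists>d>0. \<forall>y\<in>{0..1}. dist y x < d \<longrightarrow> dist (step_l2 y) (step_l2 x) < \<epsilon>"
    using \<epsilon> by (intro exI[of _ "\<epsilon>\<^sup>2"]) auto
qed

lemma step_l2_0: "step_l2 0 = 0"
  unfolding step_l2_def abs_l2_zero[symmetric]
  by (rule abs_l2_cong) (auto intro: square_integrable_indicator)

definition primitive :: "l2 \<Rightarrow> real \<Rightarrow> real" where
  "primitive h x = inner h (step_l2 x)"

definition volterra :: "l2 \<Rightarrow> l2" where
  "volterra h = abs_l2 (primitive h)"

lemma continuous_on_primitive: "continuous_on {0..1} (primitive h)"
  unfolding primitive_def by (intro continuous_intros continuous_on_step)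

lemma square_integrable_primitive: "square_integrable (primitive h)"
  by (intro square_integrable_continuous continuous_on_primitive)

lemma primitive_0: "primitive h 0 = 0"
  by (simp add: primitive_def step_l2_0)

lemma primitive_1: "primitive h 1 = inner h one_l2"
  by (simp add: primitive_def step_l2_1)

lemma primitive_abs_l2: "continuous_on {0..1} u \<Longrightarrow> x \<in> {0..1} \<Longrightarrow> primitive (abs_l2 u) x = integral {0..x} u"
  by (simp add: primitive_def inner_step_continuous)

lemma norm_step_le:
  assumes "x \<in> {0..1}" shows "norm (step_l2 x) \<le> 1"
proof (rule power2_le_imp_le)
  show "(norm (step_l2 x))\<^sup>2 \<le> 1\<^sup>2"
    using norm_step_diff[of 0 x] assms by (simp add: step_l2_0)
qed simp

lemma bounded_linear_volterra: "bounded_linear volterra"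
proof (rule bounded_linear_intro)
  show "volterra (f + g) = volterra f + volterra g" for f g
    unfolding volterra_def abs_l2_add[OF square_integrable_primitive square_integrable_primitive, symmetric]
    by (rule arg_cong[of _ _ abs_l2]) (auto simp: primitive_def inner_add_left)
  show "volterra (r *\<^sub>R f) = r *\<^sub>R volterra f" for r f
    unfolding volterra_def abs_l2_scale[OF square_integrable_primitive, symmetric]
    by (rule arg_cong[of _ _ abs_l2]) (auto simp: primitive_def)
  show "norm (volterra f) \<le> norm f * 1" for f
    unfolding volterra_def
  proof (rule norm_abs_l2_le[OF square_integrable_primitive])
    fix x :: real assume "0 < x" "x < 1"
    then have "norm (step_l2 x) \<le> 1" by (intro norm_step_le) auto
    then show "\<bar>primitive f x\<bar> \<le> norm f * 1"
      unfolding primitive_def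
      by (intro order_trans[OF Cauchy_Schwarz_ineq2] mult_left_mono) auto
  qed simp
qed

text \<open>The fundamental theorem of calculus, in the language of \<open>primitive\<close> and \<open>volterra\<close>.\<close>

lemma primitive_of_derivative:
  assumes u: "continuous_on {0..1} u"
    and der: "\<And>x. x \<in> {0..1} \<Longrightarrow> (u has_real_derivative v x) (at x within {0..1})"
    and v: "continuous_on {0..1} v"
  shows "x \<in> {0..1} \<Longrightarrow> primitive (abs_l2 v) x = u x - u 0"
    and "volterra (abs_l2 v) = abs_l2 u - u 0 *\<^sub>R one_l2"
proof -
  show *: "primitive (abs_l2 v) x = u x - u 0" if x: "x \<in> {0..1}" for x
  proof -
    have "(v has_integral u x - u 0) {0..x}"
    proof (rule fundamental_theorem_of_calculus)
      fix y assume "y \<in> {0..x}"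
      then show "(u has_vector_derivative v y) (at y within {0..x})"
        using der[of y] x has_field_derivative_subset[of u "v y" y "{0..1}" "{0..x}"]
        by (auto simp: has_real_derivative_iff_has_vector_derivative)
    qed (use x in auto)
    then show ?thesis using primitive_abs_l2[OF v x] by (simp add: integral_unique)
  qed
  have "volterra (abs_l2 v) = abs_l2 (\<lambda>x. u x - u 0 * 1)"
    unfolding volterra_def by (rule abs_l2_cong[OF square_integrable_primitive]) (simp add: *)
  also have "\<dots> = abs_l2 u - u 0 *\<^sub>R one_l2"
  proof -
    have "square_integrable u" "square_integrable (\<lambda>x. 1)"
      by (auto intro!: square_integrable_continuous u)
    then show ?thesis
      unfolding one_l2_def by (simp only: abs_l2_diff abs_l2_scale square_integrable_scale)
  qed
  finally show "volterra (abs_l2 v) = abs_l2 u - u 0 *\<^sub>R one_l2" .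
qed

text \<open>Integration by parts for an arbitrary element \<open>h\<close> of $L^2$. Both sides are bounded linear in \<open>h\<close>, so
the classical formula for continuous functions suffices.\<close>

lemma volterra_parts:
  assumes w: "continuous_on {0..1} w" and w': "continuous_on {0..1} w'"
    and der: "\<And>x. x \<in> {0..1} \<Longrightarrow> (w has_real_derivative w' x) (at x within {0..1})"
  shows "inner (volterra h) (abs_l2 w') = inner h one_l2 * w 1 - inner h (abs_l2 w)"
proof (rule bounded_linear_eq_on_continuous[where A = "\<lambda>h. inner (volterra h) (abs_l2 w')"])
  show "bounded_linear (\<lambda>h. inner (volterra h) (abs_l2 w'))"
    by (rule bounded_linear_compose[OF bounded_linear_inner_left bounded_linear_volterra])
  show "bounded_linear (\<lambda>h. inner h one_l2 * w 1 - inner h (abs_l2 w))"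
    by (intro bounded_linear_sub bounded_linear_inner_left
        bounded_linear_compose[OF bounded_linear_mult_left bounded_linear_inner_left])
next
  fix u :: "real \<Rightarrow> real" assume u: "continuous_on {0..1} u"
  define U where "U x = integral {0..x} u" for x
  have dU: "(U has_real_derivative u x) (at x within {0..1})" if "x \<in> {0..1}" for x
    unfolding U_def by (rule integral_has_real_derivative[OF u that])
  have cU: "continuous_on {0..1} U"
    using dU by (meson DERIV_continuous_on)
  have "((\<lambda>x. u x * w x + U x * w' x) has_integral U 1 * w 1 - U 0 * w 0) {0..1}"
  proof (rule fundamental_theorem_of_calculus)
    show "((\<lambda>x. U x * w x) has_vector_derivative u x * w x + U x * w' x) (at x within {0..1})"
      if "x \<in> {0..1}" for x
      unfolding has_real_derivative_iff_has_vector_derivative[symmetric]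
      using DERIV_mult[OF dU[OF that] der[OF that]] by (simp add: mult.commute add.commute)
  qed simp
  then have "integral {0..1} (\<lambda>x. u x * w x + U x * w' x) = U 1 * w 1"
    by (simp add: integral_unique U_def)
  moreover have "integral {0..1} (\<lambda>x. u x * w x + U x * w' x)
      = integral {0..1} (\<lambda>x. u x * w x) + integral {0..1} (\<lambda>x. U x * w' x)"
    by (intro Henstock_Kurzweil_Integration.integral_add integrable_continuous_interval continuous_intros u w w' cU)
  moreover have "volterra (abs_l2 u) = abs_l2 U"
    unfolding volterra_def
    by (rule abs_l2_cong[OF square_integrable_primitive]) (simp add: primitive_abs_l2[OF u] U_def)
  moreover have "inner (abs_l2 u) one_l2 = U 1"
    using primitive_abs_l2[OF u, of 1] by (simp add: U_def primitive_1)
  ultimately show "inner (volterra (abs_l2 u)) (abs_l2 w') = inner (abs_l2 u) one_l2 * w 1 - inner (abs_l2 u) (abs_l2 w)"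
    by (simp add: inner_abs_l2_continuous u w w' cU)
qed

section \<open>Test functions and weak derivatives\<close>

definition smooth :: "(real \<Rightarrow> real) \<Rightarrow> bool" where
  "smooth f \<longleftrightarrow> (\<forall>n x. (deriv ^^ n) f differentiable at x)"

text \<open>A class of functions that is closed under differentiation consists of smooth functions. This replaces
formulas for the derivatives of higher order in the following lemmas.\<close>

lemma smooth_coinduct:
  assumes "f \<in> S" and S: "\<And>g. g \<in> S \<Longrightarrow> (\<forall>x. g differentiable at x) \<and> deriv g \<in> S"
  shows "smooth f"
proof -
  have "(deriv ^^ n) f \<in> S" for n
    by (induction n) (use assms in auto)
  then show ?thesis unfolding smooth_def using S by blast
qed

lemma smooth_coinduct_DERIV:
  assumes "f \<in> S" and S: "\<And>g. g \<in> S \<Longrightarrow> \<exists>g'\<in>S. \<forall>x. DERIV g x :> g' x"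
  shows "smooth f"
proof (rule smooth_coinduct[OF assms(1)])
  fix g assume "g \<in> S"
  then obtain g' where g': "g' \<in> S" "\<And>x. DERIV g x :> g' x" using S by blast
  then have "deriv g = g'" by (auto intro: DERIV_imp_deriv)
  with g' show "(\<forall>x. g differentiable at x) \<and> deriv g \<in> S"
    by (metis DERIV_deriv_iff_real_differentiable)
qed

lemma smooth_DERIV: "smooth f \<Longrightarrow> DERIV f x :> deriv f x"
  unfolding smooth_def by (metis DERIV_deriv_iff_real_differentiable funpow_0)

lemma smooth_deriv: "smooth f \<Longrightarrow> smooth (deriv f)"
  unfolding smooth_def by (metis comp_apply funpow_Suc_right)

lemma smooth_if_deriv:
  assumes "\<And>x. DERIV f x :> f' x" "smooth f'"
  shows "smooth f"
proof (rule smooth_coinduct_DERIV)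
  show "f \<in> insert f {g. smooth g}" by simp
  show "\<exists>g'\<in>insert f {g. smooth g}. \<forall>x. DERIV g x :> g' x" if "g \<in> insert f {g. smooth g}" for g
    using that assms smooth_DERIV smooth_deriv by blast
qed

lemma smooth_poly: "smooth (poly p)"
proof (rule smooth_coinduct_DERIV)
  show "poly p \<in> range poly" by simp
  show "\<exists>g'\<in>range poly. \<forall>x. DERIV g x :> g' x" if "g \<in> range poly" for g :: "real \<Rightarrow> real"
    using that poly_DERIV by blast
qed

text \<open>A product of smooth functions does not have a product as its derivative, but finite sums of such
products are closed under differentiation.\<close>

inductive sum_of_products :: "(real \<Rightarrow> real) \<Rightarrow> bool" where
  prod: "smooth f \<Longrightarrow> smooth g \<Longrightarrow> sum_of_products (\<lambda>x. f x * g x)"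
| add: "sum_of_products f \<Longrightarrow> sum_of_products g \<Longrightarrow> sum_of_products (\<lambda>x. f x + g x)"

lemma sum_of_products_deriv:
  "sum_of_products f \<Longrightarrow> \<exists>f'. sum_of_products f' \<and> (\<forall>x. DERIV f x :> f' x)"
proof (induction rule: sum_of_products.induct)
  case (prod f g)
  have "DERIV (\<lambda>x. f x * g x) x :> deriv f x * g x + f x * deriv g x" for x
    using DERIV_mult[OF smooth_DERIV[OF prod(1)] smooth_DERIV[OF prod(2)], of x]
    by (simp add: mult.commute add.commute)
  moreover have "sum_of_products (\<lambda>x. deriv f x * g x + f x * deriv g x)"
    by (intro sum_of_products.intros prod smooth_deriv)
  ultimately show ?case by blast
next
  case (add f g)
  then obtain f' g' where "sum_of_products f'" "sum_of_products g'"
    "\<And>x. DERIV f x :> f' x" "\<And>x. DERIV g x :> g' x" by blast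
  then show ?case
    by (intro exI[of _ "\<lambda>x. f' x + g' x"]) (auto intro: sum_of_products.add DERIV_add)
qed

lemma smooth_sum_of_products: "sum_of_products f \<Longrightarrow> smooth f"
  by (rule smooth_coinduct_DERIV[of f "{f. sum_of_products f}"])
     (use sum_of_products_deriv in auto)

lemma smooth_mult: "smooth f \<Longrightarrow> smooth g \<Longrightarrow> smooth (\<lambda>x. f x * g x)"
  by (rule smooth_sum_of_products[OF sum_of_products.prod])

lemma smooth_cmult: "smooth f \<Longrightarrow> smooth (\<lambda>x. c * f x)"
  using smooth_mult[OF smooth_poly[of "[:c:]"]] by simp

lemma smooth_diff: 
  assumes "smooth f" "smooth g" shows "smooth (\<lambda>x. f x - g x)"
proof -
  have "smooth (\<lambda>x. f x * poly [:1:] x + g x * poly [:-1:] x)"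
    by (intro smooth_sum_of_products sum_of_products.intros assms smooth_poly)
  then show ?thesis by simp
qed

lemma smooth_affine:
  assumes "smooth f" shows "smooth (\<lambda>x. f (\<alpha> * x + \<beta>))"
proof (rule smooth_coinduct_DERIV)
  let ?S = "{\<lambda>x. \<gamma> * g (\<alpha> * x + \<beta>) |\<gamma> g. smooth g}"
  show "(\<lambda>x. f (\<alpha> * x + \<beta>)) \<in> ?S"
    using assms by (intro CollectI exI[of _ 1] exI[of _ f]) simp
  show "\<exists>g'\<in>?S. \<forall>x. DERIV g x :> g' x" if gS: "g \<in> ?S" for g
  proof -
    obtain \<gamma> h where h: "smooth h" "g = (\<lambda>x. \<gamma> * h (\<alpha> * x + \<beta>))" using gS by blast
    have "DERIV (\<lambda>x. \<gamma> * h (\<alpha> * x + \<beta>)) x :> (\<gamma> * \<alpha>) * deriv h (\<alpha> * x + \<beta>)" for x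
      by (rule derivative_eq_intros DERIV_chain2[OF smooth_DERIV[OF h(1)]] refl | simp)+
    then show ?thesis
      unfolding h(2) using smooth_deriv[OF h(1)]
      by (intro bexI[of _ "\<lambda>x. (\<gamma> * \<alpha>) * deriv h (\<alpha> * x + \<beta>)"]) blast+
  qed
qed

text \<open>The functions $p(1/x)\,e^{-1/x}$ for $x > 0$, extended by $0$. The polynomial \<open>p\<close> is a parameter so that
the class is closed under differentiation; the derivative of $e^{-1/x}$ alone leaves the case $p = 1$.\<close>

definition flat :: "real poly \<Rightarrow> real \<Rightarrow> real" where
  "flat p x = (if x > 0 then poly p (1 / x) * exp (- (1 / x)) else 0)"

lemma power_poly_div_exp_tendsto_0: "((\<lambda>y. y ^ k * poly p y / exp y) \<longlongrightarrow> (0::real)) at_top"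
proof (induction p arbitrary: k)
  case 0
  then show ?case by simp
next
  case (pCons a p)
  have "((\<lambda>y. a * (y ^ k / exp y) + y ^ Suc k * poly p y / exp y) \<longlongrightarrow> a * 0 + 0) at_top"
    by (intro tendsto_intros tendsto_power_div_exp_0 pCons.IH)
  then show ?case by (simp add: field_simps)
qed

text \<open>For $x > 0$ this is the chain rule. At $0$ the difference quotient from the right is $y\,p(y)\,e^{-y}$
with $y = 1/x$ tending to infinity.\<close>

lemma DERIV_flat: "DERIV (flat p) x :> flat ([:0, 0, 1:] * (p - pderiv p)) x"
proof -
  consider "x > 0" | "x < 0" | "x = 0" by linarith
  then show ?thesis
  proof cases
    case 1
    have "DERIV (\<lambda>x. poly p (1 / x) * exp (- (1 / x))) x :>
        poly (pderiv p) (1 / x) * (- (1 / x\<^sup>2)) * exp (- (1 / x)) + poly p (1 / x) * (exp (- (1 / x)) * (1 / x\<^sup>2))"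
      using 1 by (auto intro!: derivative_eq_intros DERIV_chain2[OF poly_DERIV] simp: field_simps power2_eq_square)
    also have "poly (pderiv p) (1 / x) * (- (1 / x\<^sup>2)) * exp (- (1 / x)) + poly p (1 / x) * (exp (- (1 / x)) * (1 / x\<^sup>2))
        = flat ([:0, 0, 1:] * (p - pderiv p)) x"
      using 1 by (simp add: flat_def field_simps power2_eq_square)
    finally show ?thesis
      by (rule has_field_derivative_transform_within_open[where S = "{0<..}"]) (use 1 in \<open>auto simp: flat_def\<close>)
  next
    case 2
    have "DERIV (\<lambda>x. 0) x :> flat ([:0, 0, 1:] * (p - pderiv p)) x" using 2 by (simp add: flat_def)
    then show ?thesis
      by (rule has_field_derivative_transform_within_open[where S = "{..<0}"]) (use 2 in \<open>auto simp: flat_def\<close>)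
  next
    case 3
    have "((\<lambda>h. (flat p h - flat p 0) / h) \<longlongrightarrow> 0) (at 0)"
    proof (rule filterlim_split_at)
      show "((\<lambda>h. (flat p h - flat p 0) / h) \<longlongrightarrow> 0) (at_left 0)"
        by (rule tendsto_eventually) (auto simp: flat_def eventually_at_filter)
      have "((\<lambda>h. (1/h) ^ 1 * poly p (1/h) / exp (1/h)) \<longlongrightarrow> 0) (at_right (0::real))"
        using filterlim_compose[OF power_poly_div_exp_tendsto_0[of 1 p] filterlim_inverse_at_top_right]
        by (simp add: inverse_eq_divide)
      then show "((\<lambda>h. (flat p h - flat p 0) / h) \<longlongrightarrow> 0) (at_right 0)"
        by (rule Lim_transform_eventually)
           (auto simp: flat_def eventually_at_filter exp_minus field_simps)
    qed
    then show ?thesis using 3 by (simp add: DERIV_def flat_def)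
  qed
qed

lemma smooth_flat: "smooth (flat p)"
proof (rule smooth_coinduct_DERIV)
  show "flat p \<in> range flat" by simp
  show "\<exists>g'\<in>range flat. \<forall>x. DERIV g x :> g' x" if "g \<in> range flat" for g
    using that DERIV_flat by blast
qed

lemma test_fun_iff: "test_fun \<theta> \<longleftrightarrow> smooth \<theta> \<and> (\<exists>c d. 0 < c \<and> d < 1 \<and> (\<forall>x. x \<notin> {c..d} \<longrightarrow> \<theta> x = 0))"
  by (simp add: test_fun_def smooth_def)

lemma continuous_on_smooth: "smooth f \<Longrightarrow> continuous_on S f"
  using smooth_DERIV by (meson DERIV_isCont continuous_at_imp_continuous_on)

lemma square_integrable_smooth: "smooth f \<Longrightarrow> square_integrable f"
  by (intro square_integrable_continuous continuous_on_smooth)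

text \<open>Smooth functions with values in $[0,1]$ and compact support in the open interval that tend to $1$
pointwise: the factor $n$ drives the argument of $e^{-1/x}$ to infinity, while the shift $1/(n+3)$
keeps the support away from both ends.\<close>

definition cutoff :: "nat \<Rightarrow> real \<Rightarrow> real" where
  "cutoff n x = flat [:1:] (real n * (x - 1 / real (n + 3))) * flat [:1:] (real n * (1 - 1 / real (n + 3) - x))"

lemma flat_1: "0 \<le> flat [:1:] x" "flat [:1:] x \<le> 1"
  by (auto simp: flat_def)

lemma flat_1_tendsto:
  assumes "filterlim f at_top F" shows "((\<lambda>n. flat [:1:] (f n)) \<longlongrightarrow> 1) F"
proof -
  have "((\<lambda>n. exp (- inverse (f n))) \<longlongrightarrow> exp (- 0)) F"
    by (intro tendsto_intros filterlim_compose[OF tendsto_inverse_0_at_top[OF filterlim_ident] assms])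
  then have "((\<lambda>n. exp (- inverse (f n))) \<longlongrightarrow> 1) F" by simp
  moreover have "\<forall>\<^sub>F n in F. exp (- inverse (f n)) = flat [:1:] (f n)"
    using filterlim_at_top_dense[THEN iffD1, OF assms, rule_format, of 0]
    by eventually_elim (simp add: flat_def inverse_eq_divide)
  ultimately show ?thesis by (rule Lim_transform_eventually)
qed

lemma cutoff_tendsto:
  assumes "0 < x" "x < 1" shows "(\<lambda>n. cutoff n x) \<longlonglongrightarrow> 1"
proof -
  have lim: "filterlim (\<lambda>n. real n * (y - 1 / real (n + 3))) at_top sequentially" if "0 < y" for y
  proof (rule filterlim_at_top_mono)
    show "filterlim (\<lambda>n. real n * y - 1) at_top sequentially"
      using that by real_asymp
    show "\<forall>\<^sub>F n in sequentially. real n * y - 1 \<le> real n * (y - 1 / real (n + 3))"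
      by (auto simp: field_simps)
  qed
  have "(\<lambda>n. flat [:1:] (real n * (x - 1 / real (n + 3))) * flat [:1:] (real n * ((1 - x) - 1 / real (n + 3))))
      \<longlonglongrightarrow> 1 * 1"
    using assms by (intro tendsto_intros flat_1_tendsto lim) auto
  then show ?thesis by (simp add: cutoff_def algebra_simps)
qed

lemma test_fun_cutoff:
  assumes "smooth f" shows "test_fun (\<lambda>x. f x * cutoff n x)"
  unfolding test_fun_iff
proof (intro conjI exI allI impI)
  have "smooth (\<lambda>x. flat [:1:] (real n * x + (- (real n / real (n + 3)))) *
      flat [:1:] ((- real n) * x + real n * (1 - 1 / real (n + 3))))"
    by (intro smooth_mult smooth_affine smooth_flat)
  then have "smooth (cutoff n)"
    by (simp add: cutoff_def[abs_def] algebra_simps)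
  then show "smooth (\<lambda>x. f x * cutoff n x)" by (intro smooth_mult assms)
  show "0 < 1 / real (n + 3)" by simp
  show "1 - 1 / real (n + 3) < 1" by simp
  show "f x * cutoff n x = 0" if "x \<notin> {1 / real (n + 3)..1 - 1 / real (n + 3)}" for x
  proof -
    have "\<not> (x - 1 / real (n + 3) > 0 \<and> 1 - 1 / real (n + 3) - x > 0)" using that by auto
    then show ?thesis by (auto simp: cutoff_def flat_def zero_less_mult_iff)
  qed
qed

lemma closure_subspace:
  fixes S :: "'a::real_normed_vector set"
  assumes "subspace S" shows "subspace (closure S)"
  unfolding subspace_def
proof (intro conjI ballI allI)
  show "0 \<in> closure S" using subspace_0[OF assms] closure_subset by blast
  show "x + y \<in> closure S" if "x \<in> closure S" "y \<in> closure S" for x y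
  proof -
    obtain X Y where "\<And>n. X n \<in> S" "X \<longlonglongrightarrow> x" "\<And>n. Y n \<in> S" "Y \<longlonglongrightarrow> y"
      using \<open>x \<in> closure S\<close> \<open>y \<in> closure S\<close> unfolding closure_sequential by blast
    then show ?thesis
      unfolding closure_sequential
      by (intro exI[of _ "\<lambda>n. X n + Y n"]) (auto intro: tendsto_add subspace_add[OF assms])
  qed
  show "c *\<^sub>R x \<in> closure S" if "x \<in> closure S" for c x
  proof -
    obtain X where "\<And>n. X n \<in> S" "X \<longlonglongrightarrow> x"
      using \<open>x \<in> closure S\<close> unfolding closure_sequential by blast
    then show ?thesis
      unfolding closure_sequential
      by (intro exI[of _ "\<lambda>n. c *\<^sub>R X n"]) (auto intro: tendsto_intros subspace_scale[OF assms])
  qed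
qed

text \<open>A monomial is the limit in $L^2$ of its products with the cutoff functions, and the monomials span a
dense subspace.\<close>

lemma test_fun_dense: "closure (span (abs_l2 ` {\<theta>. test_fun \<theta>})) = UNIV"
proof -
  let ?T = "abs_l2 ` {\<theta>. test_fun \<theta>}"
  have "abs_l2 (\<lambda>x. x ^ m) \<in> closure (span ?T)" for m
  proof (rule closed_sequentially[OF closed_closure])
    have pw: "smooth (\<lambda>x. x ^ m)" using smooth_poly[of "monom 1 m"] unfolding poly_monom by simp
    then have tf: "test_fun (\<lambda>x. x ^ m * cutoff n x)" for n by (rule test_fun_cutoff)
    show "abs_l2 (\<lambda>x. x ^ m * cutoff n x) \<in> closure (span ?T)" for n
      using tf by (intro subsetD[OF closure_subset] span_base imageI CollectI)
    show "(\<lambda>n. abs_l2 (\<lambda>x. x ^ m * cutoff n x)) \<longlonglongrightarrow> abs_l2 (\<lambda>x. x ^ m)"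
    proof (rule abs_l2_dominated_tendsto[where w = "\<lambda>x. 1"])
      show "square_integrable (\<lambda>x. x ^ m * cutoff n x)" for n
        using tf test_fun_iff square_integrable_smooth by blast
      show "square_integrable (\<lambda>x. x ^ m)" by (rule square_integrable_smooth[OF pw])
      show "square_integrable (\<lambda>x. 1)" by (intro square_integrable_continuous continuous_intros)
      have "(\<lambda>n. x ^ m * cutoff n x) \<longlonglongrightarrow> x ^ m" if "0 < x" "x < 1" for x
        using tendsto_mult_left[OF cutoff_tendsto[OF that], of "x ^ m"] by simp
      then show "AE x in lebesgue01. (\<lambda>n. x ^ m * cutoff n x) \<longlonglongrightarrow> x ^ m"
        by (intro AE_I2) simp
      have "\<bar>x ^ m * cutoff n x\<bar> \<le> 1" if "0 < x" "x < 1" for x n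
        using that flat_1 by (auto simp: abs_mult cutoff_def power_le_one intro!: mult_le_one)
      then show "AE x in lebesgue01. \<bar>x ^ m * cutoff n x\<bar> \<le> 1" for n
        by (intro AE_I2) simp
    qed
  qed
  then have "range (\<lambda>m. abs_l2 (\<lambda>x. x ^ m)) \<subseteq> closure (span ?T)" by auto
  then have "span (range (\<lambda>m. abs_l2 (\<lambda>x. x ^ m))) \<subseteq> closure (span ?T)"
    by (intro span_minimal closure_subspace) auto
  then have "closure (span (range (\<lambda>m. abs_l2 (\<lambda>x. x ^ m)))) \<subseteq> closure (span ?T)"
    by (intro closure_minimal) auto
  moreover have "closure (span (range (\<lambda>m. abs_l2 (\<lambda>x. x ^ m)))) = UNIV"
    by (rule powers_dense_l2) (auto intro!: continuous_intros)
  ultimately show ?thesis by auto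
qed

lemma eq_if_inner_test_fun_eq:
  assumes "\<And>\<theta>. test_fun \<theta> \<Longrightarrow> inner f (abs_l2 \<theta>) = inner g (abs_l2 \<theta>)"
  shows "f = g"
proof -
  have "inner (f - g) (f - g) = 0"
    by (rule bounded_linear_eq_on_dense_span[where f = "inner (f - g)" and S = "abs_l2 ` {\<theta>. test_fun \<theta>}" and g = "\<lambda>_. 0"])
       (use assms test_fun_dense in \<open>auto simp: inner_diff_left intro: bounded_linear_inner_right bounded_linear_zero\<close>)
  then show ?thesis by simp
qed

lemma test_fun_deriv: 
  assumes "test_fun \<theta>" shows "smooth \<theta>" "smooth (deriv \<theta>)" "\<theta> 0 = 0" "\<theta> 1 = 0"
  using assms unfolding test_fun_iff by (auto intro: smooth_deriv)

lemma has_weak_deriv_inner: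
  "has_weak_deriv f g \<longleftrightarrow> (\<forall>\<theta>. test_fun \<theta> \<longrightarrow> inner f (abs_l2 (deriv \<theta>)) = - inner g (abs_l2 \<theta>))"
proof -
  have *: "inner f (abs_l2 u) = (LINT x|lebesgue01. rep_l2 f x * u x)" if "smooth u" for f u
    using inner_abs_l2[OF square_integrable_rep_l2 square_integrable_smooth[OF that], of f]
    by (simp add: abs_rep_l2)
  show ?thesis
    unfolding has_weak_deriv_def by (auto simp: * test_fun_deriv)
qed

lemma test_fun_lincomb:
  assumes "test_fun f" "test_fun g" shows "test_fun (\<lambda>x. f x - c * g x)"
proof -
  obtain c1 d1 where 1: "0 < c1" "d1 < 1" "\<And>x. x \<notin> {c1..d1} \<Longrightarrow> f x = 0"
    using assms(1) unfolding test_fun_iff by blast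
  obtain c2 d2 where 2: "0 < c2" "d2 < 1" "\<And>x. x \<notin> {c2..d2} \<Longrightarrow> g x = 0"
    using assms(2) unfolding test_fun_iff by blast
  show ?thesis
    unfolding test_fun_iff
  proof (intro conjI exI allI impI)
    show "smooth (\<lambda>x. f x - c * g x)"
      using assms by (intro smooth_diff smooth_cmult) (auto simp: test_fun_iff)
    show "0 < min c1 c2" "max d1 d2 < 1" using 1 2 by auto
    show "f x - c * g x = 0" if "x \<notin> {min c1 c2..max d1 d2}" for x
    proof -
      have "f x = 0" by (rule 1(3)) (use that in auto)
      moreover have "g x = 0" by (rule 2(3)) (use that in auto)
      ultimately show ?thesis by simp
    qed
  qed
qed

text \<open>The primitive of a test function has compact support in the interval exactly when the function has
mean zero.\<close>

lemma test_fun_primitive: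
  assumes w: "test_fun w" and mean: "inner one_l2 (abs_l2 w) = 0"
  obtains \<theta> where "test_fun \<theta>" "deriv \<theta> = w"
proof -
  obtain c d where cd: "0 < c" "d < 1" and supp: "\<And>x. x \<notin> {c..d} \<Longrightarrow> w x = 0"
    using w unfolding test_fun_iff by blast
  have cw: "continuous_on S w" for S using w by (simp add: test_fun_iff continuous_on_smooth)
  have "integral {0..1} w = 0"
    using mean inner_abs_l2_continuous[of "\<lambda>x. 1" w] cw by (simp add: one_l2_def)
  define \<theta> where "\<theta> x = integral {0..x} w" for x
  have \<theta>_low: "\<theta> x = 0" if "x < c" for x
  proof -
    have "integral {0..x} w = integral {0..x} (\<lambda>_. 0)"
      by (rule integral_cong) (use that supp in auto)
    then show ?thesis by (simp add: \<theta>_def)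
  qed
  have \<theta>_high: "\<theta> x = 0" if "x > d" for x
  proof (cases "c \<le> d")
    case True
    have I: "(w has_integral integral {c..d} w) {c..d}"
      by (intro integrable_integral integrable_continuous_interval cw)
    have "(w has_integral integral {c..d} w) {0..1}" "(w has_integral integral {c..d} w) {0..x}"
      by (rule has_integral_on_superset[OF I supp]; use cd that in auto)+
    with \<open>integral {0..1} w = 0\<close> show ?thesis by (simp add: \<theta>_def integral_unique)
  next
    case False
    then have "w = (\<lambda>_. 0)" using supp by auto
    then show ?thesis by (simp add: \<theta>_def)
  qed
  have D: "DERIV \<theta> x :> w x" for x
  proof (cases "x > 0")
    case True
    have "(\<theta> has_real_derivative w x) (at x within {0..x+1})"
      unfolding \<theta>_def by (rule integral_has_real_derivative) (use True cw in auto)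
    moreover have "at x within {0..x+1} = at x"
      by (rule at_within_interior) (use True in simp)
    ultimately show ?thesis by simp
  next
    case False
    then have "x < c" using cd by simp
    then have "DERIV (\<lambda>x. 0) x :> w x" using supp[of x] by simp
    then show ?thesis
      by (rule has_field_derivative_transform_within_open[where S = "{..<c}"])
         (use \<open>x < c\<close> \<theta>_low in auto)
  qed
  have "smooth \<theta>" using smooth_if_deriv[OF D] w by (simp add: test_fun_iff)
  moreover have "deriv \<theta> = w" using D by (auto intro: DERIV_imp_deriv)
  moreover have "\<theta> x = 0" if "x \<notin> {c..d}" for x using that \<theta>_low \<theta>_high by force
  ultimately show ?thesis using that cd unfolding test_fun_iff by blast
qed

text \<open>The lemma of du Bois-Reymond. Subtracting a multiple of a fixed test function of nonzero mean turns
every test function into one of mean zero, which is the derivative of a test function.\<close>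

lemma constant_if_orthogonal_to_derivs:
  assumes "\<And>\<theta>. test_fun \<theta> \<Longrightarrow> inner f (abs_l2 (deriv \<theta>)) = 0"
  obtains \<alpha> where "f = \<alpha> *\<^sub>R one_l2"
proof -
  obtain \<omega> where \<omega>: "test_fun \<omega>" "inner one_l2 (abs_l2 \<omega>) \<noteq> 0"
    using eq_if_inner_test_fun_eq[of one_l2 0] inner_one_one by fastforce
  define \<alpha> where "\<alpha> = inner f (abs_l2 \<omega>) / inner one_l2 (abs_l2 \<omega>)"
  have "f = \<alpha> *\<^sub>R one_l2"
  proof (rule eq_if_inner_test_fun_eq)
    fix w assume w: "test_fun w"
    define m where "m = inner one_l2 (abs_l2 w) / inner one_l2 (abs_l2 \<omega>)"
    have sq: "square_integrable w" "square_integrable \<omega>"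
      using w \<omega>(1) by (auto simp: test_fun_iff square_integrable_smooth)
    have ab: "abs_l2 (\<lambda>x. w x - m * \<omega> x) = abs_l2 w - m *\<^sub>R abs_l2 \<omega>"
      by (simp add: abs_l2_diff abs_l2_scale sq square_integrable_scale)
    have "inner one_l2 (abs_l2 (\<lambda>x. w x - m * \<omega> x)) = 0"
      unfolding ab using \<omega>(2) by (simp add: inner_diff_right m_def)
    then obtain \<theta> where "test_fun \<theta>" "deriv \<theta> = (\<lambda>x. w x - m * \<omega> x)"
      using test_fun_primitive test_fun_lincomb[OF w \<omega>(1)] by blast
    with assms[of \<theta>] have "inner f (abs_l2 w) = m * inner f (abs_l2 \<omega>)"
      by (simp add: ab inner_diff_right)
    then show "inner f (abs_l2 w) = inner (\<alpha> *\<^sub>R one_l2) (abs_l2 w)"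
      by (simp add: \<alpha>_def m_def)
  qed
  then show ?thesis by (rule that)
qed

text \<open>The functions with weak derivative $g$ are the primitives of $g$ up to a constant. This makes both
the weak derivative and the boundary values computable.\<close>

theorem has_weak_deriv_iff: "has_weak_deriv f g \<longleftrightarrow> (\<exists>\<alpha>. f = \<alpha> *\<^sub>R one_l2 + volterra g)"
proof -
  have parts: "inner (volterra g) (abs_l2 (deriv \<theta>)) = - inner g (abs_l2 \<theta>)" if "test_fun \<theta>" for \<theta>
    using volterra_parts[of \<theta> "deriv \<theta>" g] test_fun_deriv[OF that]
    by (simp add: continuous_on_smooth has_field_derivative_at_within smooth_DERIV)
  have const: "inner one_l2 (abs_l2 (deriv \<theta>)) = 0" if "test_fun \<theta>" for \<theta>
    using primitive_of_derivative(1)[of \<theta> "deriv \<theta>" 1] test_fun_deriv[OF that]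
    by (simp add: continuous_on_smooth has_field_derivative_at_within smooth_DERIV primitive_1 inner_commute)
  show ?thesis
  proof
    assume "has_weak_deriv f g"
    then have "inner (f - volterra g) (abs_l2 (deriv \<theta>)) = 0" if "test_fun \<theta>" for \<theta>
      using that parts by (simp add: has_weak_deriv_inner inner_diff_left)
    then obtain \<alpha> where "f - volterra g = \<alpha> *\<^sub>R one_l2"
      using constant_if_orthogonal_to_derivs by blast
    then show "\<exists>\<alpha>. f = \<alpha> *\<^sub>R one_l2 + volterra g" by (metis diff_add_cancel)
  next
    assume "\<exists>\<alpha>. f = \<alpha> *\<^sub>R one_l2 + volterra g"
    then show "has_weak_deriv f g"
      unfolding has_weak_deriv_inner by (auto simp: inner_add_left parts const)
  qed
qed

lemma weak_deriv_eq:
  assumes "has_weak_deriv f g" shows "weak_deriv f = g"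
  unfolding weak_deriv_def
proof (rule the_equality)
  show "has_weak_deriv f g" by (rule assms)
  show "g' = g" if "has_weak_deriv f g'" for g'
  proof (rule eq_if_inner_test_fun_eq)
    fix \<theta> assume "test_fun \<theta>"
    then show "inner g' (abs_l2 \<theta>) = inner g (abs_l2 \<theta>)"
      using assms that unfolding has_weak_deriv_inner by (metis neg_equal_iff_equal)
  qed
qed

lemma sobolev1_iff: "f \<in> sobolev1 \<longleftrightarrow> (\<exists>\<alpha>. f = \<alpha> *\<^sub>R one_l2 + volterra (weak_deriv f))"
  unfolding has_weak_deriv_iff[symmetric] sobolev1_def by (auto simp: weak_deriv_eq)

lemma point_value_primitive:
  assumes "x \<in> {0..1}"
  shows "point_value (\<alpha> *\<^sub>R one_l2 + volterra g) x = \<alpha> + primitive g x"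
proof -
  have "\<alpha> *\<^sub>R one_l2 + volterra g = abs_l2 (\<lambda>x. \<alpha> * 1 + primitive g x)"
  proof -
    have "square_integrable (\<lambda>x. 1)" by (intro square_integrable_continuous continuous_intros)
    then show ?thesis
      unfolding one_l2_def volterra_def
      by (simp only: abs_l2_add abs_l2_scale square_integrable_scale square_integrable_primitive)
  qed
  then show ?thesis
    using assms by (simp add: point_value_abs_l2 continuous_on_primitive continuous_on_add)
qed

section \<open>The operator as a closed graph\<close>

text \<open>The primitive of \<open>h\<close> that vanishes at $1$. It is the derivative of any $f$ with $f'' = h$ and
$f'(1) = 0$, and its value at $0$ is $-\int_0^1 h$.\<close>

definition neumann_primitive :: "l2 \<Rightarrow> l2" where
  "neumann_primitive h = volterra h - inner h one_l2 *\<^sub>R one_l2"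

text \<open>The solution of $f'' = h$, $f'(1) = 0$ that vanishes at $0$; every other solution differs from it by a
constant.\<close>

definition neumann_op :: "l2 \<Rightarrow> l2" where
  "neumann_op h = volterra (neumann_primitive h)"

text \<open>For a solution $f$ of $f'' = h$, $f'(1) = 0$ this is the constant by which it differs from
\<open>neumann_op h\<close>. The definition by an inner product makes it continuous and linear in \<open>f\<close> and \<open>h\<close>.\<close>

definition neumann_const :: "l2 \<Rightarrow> l2 \<Rightarrow> real" where
  "neumann_const f h = inner (f - neumann_op h) one_l2"

text \<open>The value $f(1)$ of a solution of $f'' = h$, $f'(1) = 0$, written as a continuous linear functional of
\<open>f\<close> and \<open>h\<close>.\<close>

definition end_value :: "l2 \<Rightarrow> l2 \<Rightarrow> real" where
  "end_value f h = neumann_const f h + inner (neumann_primitive h) one_l2"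

lemma bounded_linear_neumann_primitive: "bounded_linear neumann_primitive"
  unfolding neumann_primitive_def
  by (intro bounded_linear_sub bounded_linear_volterra
      bounded_linear_compose[OF bounded_linear_scaleR_left bounded_linear_inner_left])

lemma bounded_linear_neumann_op: "bounded_linear neumann_op"
  unfolding neumann_op_def
  by (rule bounded_linear_compose[OF bounded_linear_volterra bounded_linear_neumann_primitive])

lemma end_value_0: "end_value 0 0 = 0"
  by (simp add: end_value_def neumann_const_def linear_0 bounded_linear.linear
      bounded_linear_neumann_primitive bounded_linear_neumann_op)

lemma point_value_neumann_primitive:
  "point_value (neumann_primitive h) 0 = - inner h one_l2"
  "point_value (neumann_primitive h) 1 = 0"
  using point_value_primitive[of 0 "- inner h one_l2" h] point_value_primitive[of 1 "- inner h one_l2" h]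
  by (simp_all add: neumann_primitive_def primitive_0 primitive_1)

text \<open>The regularity conditions and the Neumann condition at $1$ for one component amount to a linear
equation between bounded operators applied to $f$ and $f''$.\<close>

lemma neumann_component_iff:
  "f \<in> sobolev2 \<and> weak_deriv (weak_deriv f) = h \<and> point_value (weak_deriv f) 1 = 0
   \<longleftrightarrow> f - neumann_op h = neumann_const f h *\<^sub>R one_l2"
proof
  assume *: "f \<in> sobolev2 \<and> weak_deriv (weak_deriv f) = h \<and> point_value (weak_deriv f) 1 = 0"
  define g where "g = weak_deriv f"
  obtain \<alpha> \<beta> where f: "f = \<alpha> *\<^sub>R one_l2 + volterra g" and g: "g = \<beta> *\<^sub>R one_l2 + volterra h"
    using * unfolding sobolev2_def mem_Collect_eq sobolev1_iff g_def[symmetric] by metis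
  have "\<beta> = - inner h one_l2"
    using * point_value_primitive[of 1 \<beta> h] by (simp add: g_def[symmetric] g[symmetric] primitive_1)
  then have "g = neumann_primitive h" by (simp add: g neumann_primitive_def)
  then have "f - neumann_op h = \<alpha> *\<^sub>R one_l2" by (simp add: f neumann_op_def)
  then show "f - neumann_op h = neumann_const f h *\<^sub>R one_l2" by (simp add: neumann_const_def inner_one_one)
next
  assume "f - neumann_op h = neumann_const f h *\<^sub>R one_l2"
  then have "f = neumann_const f h *\<^sub>R one_l2 + volterra (neumann_primitive h)"
    unfolding neumann_op_def by (metis diff_add_cancel)
  then have f: "has_weak_deriv f (neumann_primitive h)" unfolding has_weak_deriv_iff by blast
  have "neumann_primitive h = (- inner h one_l2) *\<^sub>R one_l2 + volterra h"
    by (simp add: neumann_primitive_def)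
  then have g: "has_weak_deriv (neumann_primitive h) h" unfolding has_weak_deriv_iff by blast
  show "f \<in> sobolev2 \<and> weak_deriv (weak_deriv f) = h \<and> point_value (weak_deriv f) 1 = 0"
    using f g by (auto simp: sobolev2_def sobolev1_def weak_deriv_eq[OF f] weak_deriv_eq[OF g]
        point_value_neumann_primitive)
qed

lemma neumann_component_values:
  assumes "f - neumann_op h = neumann_const f h *\<^sub>R one_l2"
  shows "point_value (weak_deriv f) 0 = - inner h one_l2" "point_value f 1 = end_value f h"
proof -
  have f: "f = neumann_const f h *\<^sub>R one_l2 + volterra (neumann_primitive h)"
    using assms unfolding neumann_op_def by (metis diff_add_cancel)
  then have "has_weak_deriv f (neumann_primitive h)" unfolding has_weak_deriv_iff by blast
  then show "point_value (weak_deriv f) 0 = - inner h one_l2"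
    by (simp add: weak_deriv_eq point_value_neumann_primitive)
  show "point_value f 1 = end_value f h"
    by (subst f) (simp add: point_value_primitive primitive_1 end_value_def)
qed

lemma neumann_component_classical:
  assumes u: "\<And>x. x \<in> {0..1} \<Longrightarrow> (u has_real_derivative v x) (at x within {0..1})"
    and v: "\<And>x. x \<in> {0..1} \<Longrightarrow> (v has_real_derivative w x) (at x within {0..1})"
    and w: "continuous_on {0..1} w" and "v 1 = 0"
  shows "abs_l2 u - neumann_op (abs_l2 w) = neumann_const (abs_l2 u) (abs_l2 w) *\<^sub>R one_l2"
    and "inner (abs_l2 w) one_l2 = - v 0"
    and "end_value (abs_l2 u) (abs_l2 w) = u 1"
proof -
  have cu: "continuous_on {0..1} u" and cv: "continuous_on {0..1} v"
    using u v by (meson DERIV_continuous_on)+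
  show mean: "inner (abs_l2 w) one_l2 = - v 0"
    using primitive_of_derivative(1)[OF cv v w, of 1] \<open>v 1 = 0\<close> by (simp add: primitive_1)
  have np: "neumann_primitive (abs_l2 w) = abs_l2 v"
    unfolding neumann_primitive_def mean using primitive_of_derivative(2)[OF cv v w] by simp
  have op: "neumann_op (abs_l2 w) = abs_l2 u - u 0 *\<^sub>R one_l2"
    unfolding neumann_op_def np using primitive_of_derivative(2)[OF cu u cv] by simp
  then show "abs_l2 u - neumann_op (abs_l2 w) = neumann_const (abs_l2 u) (abs_l2 w) *\<^sub>R one_l2"
    by (simp add: neumann_const_def inner_one_one)
  show "end_value (abs_l2 u) (abs_l2 w) = u 1"
    using primitive_of_derivative(1)[OF cu u cv, of 1]
    by (simp add: end_value_def np neumann_const_def op inner_one_one primitive_1)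
qed

text \<open>Two integrations by parts against the cosine. The boundary terms at $1$ vanish; the one at $0$
contains the derivative $-\int_0^1 h$ at $0$.\<close>

lemma cos_coeff_neumann_op:
  assumes "k > 0"
  shows "(real k * pi)\<^sup>2 * inner (neumann_op h) (cos_l2 k) = sqrt 2 * inner h one_l2 - inner h (cos_l2 k)"
proof -
  define c where "c = real k * pi"
  have c: "c > 0" using assms by (simp add: c_def)
  define v where "v x = - (1 / c\<^sup>2) * (sqrt 2 * cos (c * x))" for x
  define w where "w x = sqrt 2 / c * sin (c * x)" for x
  have cb: "cos_basis k = (\<lambda>x. sqrt 2 * cos (c * x))"
    using assms by (auto simp: cos_basis_def c_def)
  have dv: "(v has_real_derivative w x) (at x within {0..1})" for x
    unfolding v_def w_def using c
    by (auto intro!: derivative_eq_intros simp: field_simps power2_eq_square)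
  have dw: "(w has_real_derivative cos_basis k x) (at x within {0..1})" for x
    unfolding w_def cb using c by (auto intro!: derivative_eq_intros simp: field_simps)
  have cont: "continuous_on {0..1} v" "continuous_on {0..1} w"
    unfolding v_def w_def using c by (auto intro!: continuous_intros)
  have "sin c = 0" unfolding c_def by (simp add: sin_npi)
  then have w1: "w 1 = 0" by (simp add: w_def)
  have abs_v: "abs_l2 v = (- (1 / c\<^sup>2)) *\<^sub>R cos_l2 k"
    unfolding cos_l2_def v_def[abs_def] cb
    by (rule abs_l2_scale) (use square_integrable_cos_basis[of k] cb in simp)
  have one: "inner one_l2 (abs_l2 w) = v 1 - v 0"
    using primitive_of_derivative(1)[OF cont(1) dv cont(2), of 1] by (simp add: primitive_1 inner_commute)
  have "inner (volterra h) (abs_l2 w) = inner h one_l2 * v 1 + (1 / c\<^sup>2) * inner h (cos_l2 k)"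
    using volterra_parts[OF cont dv, of h] by (simp add: abs_v)
  then have "inner (neumann_primitive h) (abs_l2 w) = inner h one_l2 * v 0 + (1 / c\<^sup>2) * inner h (cos_l2 k)"
    by (simp add: neumann_primitive_def inner_diff_left one algebra_simps)
  moreover have "inner (neumann_op h) (cos_l2 k) = - inner (neumann_primitive h) (abs_l2 w)"
    unfolding neumann_op_def cos_l2_def
    using volterra_parts[OF cont(2) continuous_on_cos_basis dw] w1 by simp
  ultimately show ?thesis
    unfolding c_def[symmetric] using c by (simp add: v_def field_simps)
qed

type_synonym 'n l2vec = "l2 ^ 'n"

text \<open>Components are numbered from $0$ and continued by zero beyond the last one. Then the condition at $0$ on
the last component is the coupling condition with a zero component that follows it, and shifts of the
index need no case distinction.\<close>

definition crd :: "'n::{finite, linorder} l2vec \<Rightarrow> nat \<Rightarrow> l2" where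
  "crd f p = (if p < CARD('n) then f $ (inv idx (Suc p)) else 0)"

definition vec_of :: "(nat \<Rightarrow> l2) \<Rightarrow> 'n::{finite, linorder} l2vec" where
  "vec_of g = (\<chi> j. g (idx j - 1))"

lemma idx_pos: "0 < idx j" and idx_le: "idx (j :: 'n::{finite, linorder}) \<le> CARD('n)"
  by (auto simp: idx_def card_gt_0_iff intro: card_mono)

lemma idx_inv: "p < CARD('n) \<Longrightarrow> idx (inv idx (Suc p) :: 'n::{finite, linorder}) = Suc p"
  using bij_betw_idx[where ?'n = 'n] unfolding bij_betw_def
  by (intro f_inv_into_f) auto

lemma inv_idx: "inv idx (idx j) = (j :: 'n::{finite, linorder})"
  by (rule inv_f_f) (rule strict_mono_imp_inj_on[OF strict_mono_idx])

lemma crd_idx: "crd f (idx j - 1) = f $ (j :: 'n::{finite, linorder})"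
proof -
  have "idx j - 1 < CARD('n)" "Suc (idx j - 1) = idx j"
    using idx_pos[of j] idx_le[of j] by linarith+
  then show ?thesis unfolding crd_def by (simp only: inv_idx if_True)
qed

lemma crd_beyond: "CARD('n) \<le> p \<Longrightarrow> crd (f :: 'n::{finite, linorder} l2vec) p = 0"
  by (simp add: crd_def)

lemma crd_vec_of: "crd (vec_of g :: 'n::{finite, linorder} l2vec) p = (if p < CARD('n) then g p else 0)"
  by (simp add: crd_def vec_of_def idx_inv)

lemma vec_of_crd: "vec_of (crd f) = f"
  unfolding vec_of_def crd_idx by (simp add: vec_eq_iff)

lemma crd_eqI:
  fixes f g :: "'n::{finite, linorder} l2vec"
  assumes "\<And>p. p < CARD('n) \<Longrightarrow> crd f p = crd g p" shows "f = g"
proof -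
  have "crd f = crd g" using assms crd_beyond by (metis ext not_less)
  then show ?thesis by (metis vec_of_crd)
qed

lemma all_idx_iff: "(\<forall>j::'n::{finite, linorder}. P (idx j - 1) j) \<longleftrightarrow> (\<forall>p<CARD('n). P p (inv idx (Suc p)))"
proof (intro iffI allI impI)
  fix p assume "\<forall>j::'n. P (idx j - 1) j" "p < CARD('n)"
  then show "P p (inv idx (Suc p))" using idx_inv[of p, where ?'n = 'n] by (metis diff_Suc_1)
next
  fix j :: 'n assume *: "\<forall>p<CARD('n). P p (inv idx (Suc p))"
  have "idx j - 1 < CARD('n)" using idx_pos[of j] idx_le[of j] by linarith
  with * have "P (idx j - 1) (inv idx (Suc (idx j - 1)))" by blast
  then show "P (idx j - 1) j" using idx_pos[of j] by (simp add: inv_idx)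
qed

lemma bounded_linear_crd: "bounded_linear (\<lambda>f :: 'n::{finite, linorder} l2vec. crd f p)"
  by (cases "p < CARD('n)") (auto simp: crd_def intro: bounded_linear_vec_nth bounded_linear_zero)

lemma bounded_linear_vec_of:
  assumes "\<And>p. bounded_linear (B p)"
  shows "bounded_linear (\<lambda>x. vec_of (\<lambda>p. B p x) :: 'n::{finite, linorder} l2vec)"
proof -
  have "\<forall>p. \<exists>K. \<forall>x. norm (B p x) \<le> norm x * K"
    using assms bounded_linear.bounded by blast
  then obtain K where K: "\<And>p x. norm (B p x) \<le> norm x * K p" by metis
  show ?thesis
  proof (rule bounded_linear_intro)
    show "vec_of (\<lambda>p. B p (x + y)) = (vec_of (\<lambda>p. B p x) + vec_of (\<lambda>p. B p y) :: 'n l2vec)" for x y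
      using assms by (simp add: vec_of_def vec_eq_iff linear_add bounded_linear.linear)
    show "vec_of (\<lambda>p. B p (r *\<^sub>R x)) = (r *\<^sub>R vec_of (\<lambda>p. B p x) :: 'n l2vec)" for r x
      using assms by (simp add: vec_of_def vec_eq_iff linear_scale bounded_linear.linear)
    show "norm (vec_of (\<lambda>p. B p x) :: 'n l2vec) \<le> norm x * (\<Sum>j\<in>(UNIV::'n set). K (idx j - 1))" for x
    proof -
      have "norm (vec_of (\<lambda>p. B p x) :: 'n l2vec) \<le> (\<Sum>j\<in>(UNIV::'n set). norm (B (idx j - 1) x))"
        unfolding norm_vec_def vec_of_def by (simp add: L2_set_le_sum)
      also have "\<dots> \<le> (\<Sum>j\<in>(UNIV::'n set). norm x * K (idx j - 1))"
        by (rule sum_mono) (rule K)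
      finally show ?thesis by (simp add: sum_distrib_left)
    qed
  qed
qed

lemma vec_of_tendsto:
  assumes "\<And>p. p < CARD('n) \<Longrightarrow> ((\<lambda>t. g t p) \<longlongrightarrow> g0 p) F"
  shows "((\<lambda>t. vec_of (g t) :: 'n::{finite, linorder} l2vec) \<longlongrightarrow> vec_of g0) F"
proof (rule vec_tendstoI)
  fix j :: 'n
  have "idx j - 1 < CARD('n)" using idx_pos[of j] idx_le[of j] by linarith
  then show "((\<lambda>t. (vec_of (g t) :: 'n l2vec) $ j) \<longlongrightarrow> (vec_of g0 :: 'n l2vec) $ j) F"
    using assms by (simp add: vec_of_def)
qed

text \<open>If \<open>z\<close> is a pair in the graph of the operator, then $y^j = (f^j)'' + a f^j$, so that this is the second
derivative of the component of $f$.\<close>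

definition second_deriv :: "real \<Rightarrow> 'n::{finite, linorder} l2vec \<times> 'n l2vec \<Rightarrow> nat \<Rightarrow> l2" where
  "second_deriv a z p = crd (snd z) p - a *\<^sub>R crd (fst z) p"

text \<open>The graph of the operator, described by continuous linear equations only; the second equation is the
coupling $(f^j)'(0) = f^{j+1}(1)$.\<close>

definition graph_A :: "real \<Rightarrow> ('n::{finite, linorder} l2vec \<times> 'n l2vec) set" where
  "graph_A a = {z. \<forall>p<CARD('n).
     crd (fst z) p - neumann_op (second_deriv a z p) = neumann_const (crd (fst z) p) (second_deriv a z p) *\<^sub>R one_l2 \<and>
     - inner (second_deriv a z p) one_l2 = end_value (crd (fst z) (Suc p)) (second_deriv a z (Suc p))}"

lemma second_deriv_beyond: "CARD('n) \<le> p \<Longrightarrow> second_deriv a (z :: 'n::{finite, linorder} l2vec \<times> _) p = 0"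
  by (simp add: second_deriv_def crd_beyond)

lemma graph_A_iff:
  fixes f y :: "'n::{finite, linorder} l2vec"
  shows "(f, y) \<in> graph_A a \<longleftrightarrow> f \<in> dom_A \<and> op_A a f = y"
proof -
  define h where "h = second_deriv a (f, y)"
  let ?N = "CARD('n)"
  let ?C = "\<lambda>p. crd f p - neumann_op (h p) = neumann_const (crd f p) (h p) *\<^sub>R one_l2"
  let ?S = "\<lambda>p. crd f p \<in> sobolev2 \<and> weak_deriv (weak_deriv (crd f p)) = h p \<and> point_value (weak_deriv (crd f p)) 1 = 0"
  let ?B = "\<lambda>p. point_value (weak_deriv (crd f p)) 0 = (if Suc p < ?N then point_value (crd f (Suc p)) 1 else 0)"
  have "(f, y) \<in> graph_A a \<longleftrightarrow> (\<forall>p<?N. ?C p) \<and>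
      (\<forall>p<?N. - inner (h p) one_l2 = end_value (crd f (Suc p)) (h (Suc p)))"
    unfolding graph_A_def h_def by auto
  also have "\<dots> \<longleftrightarrow> (\<forall>p<?N. ?C p) \<and> (\<forall>p<?N. ?B p)"
  proof (rule conj_cong[OF refl], intro all_cong)
    fix p assume C: "\<forall>p<?N. ?C p" and p: "p < ?N"
    show "- inner (h p) one_l2 = end_value (crd f (Suc p)) (h (Suc p)) \<longleftrightarrow> ?B p"
    proof (cases "Suc p < ?N")
      case True
      then show ?thesis
        using neumann_component_values(1)[of "crd f p" "h p"]
          neumann_component_values(2)[of "crd f (Suc p)" "h (Suc p)"] C p by simp
    next
      case False
      then have "crd f (Suc p) = 0" "h (Suc p) = 0"
        by (simp_all add: h_def crd_beyond second_deriv_beyond)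
      then show ?thesis
        using False neumann_component_values(1)[of "crd f p" "h p"] C p by (simp add: end_value_0)
    qed
  qed
  also have "\<dots> \<longleftrightarrow> (\<forall>p<?N. ?S p) \<and> (\<forall>p<?N. ?B p)"
    by (simp only: neumann_component_iff)
  also have "\<dots> \<longleftrightarrow> f \<in> dom_A \<and> op_A a f = y"
  proof -
    have opA: "op_A a f = y \<longleftrightarrow> (\<forall>p<?N. weak_deriv (weak_deriv (crd f p)) = h p)"
    proof -
      have "op_A a f = y \<longleftrightarrow> (\<forall>j::'n. weak_deriv (weak_deriv (crd f (idx j - 1))) = h (idx j - 1))"
        unfolding vec_eq_iff op_A_def h_def second_deriv_def fst_conv snd_conv crd_idx vec_lambda_beta
        by (auto simp: algebra_simps)
      also have "\<dots> \<longleftrightarrow> (\<forall>p<?N. weak_deriv (weak_deriv (crd f p)) = h p)"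
        by (rule all_idx_iff)
      finally show ?thesis .
    qed
    have dom: "f \<in> dom_A \<longleftrightarrow> (\<forall>p<?N. crd f p \<in> sobolev2 \<and> point_value (weak_deriv (crd f p)) 1 = 0 \<and> ?B p)"
    proof -
      have "f \<in> dom_A \<longleftrightarrow> (\<forall>j::'n. f $ j \<in> sobolev2 \<and> point_value (weak_deriv (f $ j)) 1 = 0 \<and> ?B (idx j - 1))"
      proof
        assume f: "f \<in> dom_A"
        show "\<forall>j. f $ j \<in> sobolev2 \<and> point_value (weak_deriv (f $ j)) 1 = 0 \<and> ?B (idx j - 1)"
        proof
          fix j
          show "f $ j \<in> sobolev2 \<and> point_value (weak_deriv (f $ j)) 1 = 0 \<and> ?B (idx j - 1)"
          proof (cases "idx j = ?N")
            case True
            then show ?thesis using f unfolding dom_A_def crd_idx by auto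
          next
            case False
            define j' :: 'n where "j' = inv idx (Suc (idx j))"
            have lt: "idx j < ?N" using False idx_le[of j] by linarith
            then have j': "idx j' = idx j + 1" unfolding j'_def by (simp add: idx_inv)
            have "crd f (Suc (idx j - 1)) = f $ j'"
              using crd_idx[of f j'] j' idx_pos[of j] by simp
            then show ?thesis using f j' lt idx_pos[of j] unfolding dom_A_def crd_idx by auto
          qed
        qed
      next
        assume *: "\<forall>j. f $ j \<in> sobolev2 \<and> point_value (weak_deriv (f $ j)) 1 = 0 \<and> ?B (idx j - 1)"
        have "point_value (weak_deriv (f $ j)) 0 = point_value (f $ j') 1" if j': "idx j' = idx j + 1" for j j'
        proof -
          have "crd f (Suc (idx j - 1)) = f $ j'"
            using crd_idx[of f j'] j' idx_pos[of j] by simp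
          moreover have "Suc (idx j - 1) < ?N" using idx_le[of j'] j' idx_pos[of j] by linarith
          ultimately show ?thesis using *[rule_format, of j] unfolding crd_idx by simp
        qed
        moreover have "point_value (weak_deriv (f $ j)) 0 = 0" if "idx j = ?N" for j
          using *[rule_format, of j] that idx_pos[of j] unfolding crd_idx by simp
        ultimately show "f \<in> dom_A" using * unfolding dom_A_def by blast
      qed
      also have "\<dots> \<longleftrightarrow> (\<forall>j::'n. crd f (idx j - 1) \<in> sobolev2 \<and> point_value (weak_deriv (crd f (idx j - 1))) 1 = 0 \<and> ?B (idx j - 1))"
        unfolding crd_idx ..
      also have "\<dots> \<longleftrightarrow> (\<forall>p<?N. crd f p \<in> sobolev2 \<and> point_value (weak_deriv (crd f p)) 1 = 0 \<and> ?B p)"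
        by (rule all_idx_iff)
      finally show ?thesis .
    qed
    show ?thesis unfolding opA dom by blast
  qed
  finally show ?thesis .
qed

lemma bounded_linear_second_deriv: "bounded_linear (\<lambda>z. second_deriv a z p)"
  unfolding second_deriv_def
  by (intro bounded_linear_sub bounded_linear_compose[OF bounded_linear_crd bounded_linear_snd]
      bounded_linear_compose[OF bounded_linear_scaleR_right]
      bounded_linear_compose[OF bounded_linear_crd bounded_linear_fst])

text \<open>The graph is an intersection of kernels of bounded linear maps.\<close>

lemma graph_A_closed_subspace:
  "closed (graph_A a :: ('n::{finite, linorder} l2vec \<times> 'n l2vec) set)"
  "subspace (graph_A a :: ('n l2vec \<times> 'n l2vec) set)"
proof -
  define D1 where "D1 p z = crd (fst z) p - neumann_op (second_deriv a z p) - neumann_const (crd (fst z) p) (second_deriv a z p) *\<^sub>R one_l2"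
    for p and z :: "'n l2vec \<times> 'n l2vec"
  define D2 where "D2 p z = inner (second_deriv a z p) one_l2 + end_value (crd (fst z) (Suc p)) (second_deriv a z (Suc p))"
    for p and z :: "'n l2vec \<times> 'n l2vec"
  have cf: "bounded_linear (\<lambda>z::'n l2vec \<times> 'n l2vec. crd (fst z) p)" for p
    by (rule bounded_linear_compose[OF bounded_linear_crd bounded_linear_fst])
  have np: "bounded_linear (\<lambda>z::'n l2vec \<times> 'n l2vec. neumann_primitive (second_deriv a z p))" for p
    by (rule bounded_linear_compose[OF bounded_linear_neumann_primitive bounded_linear_second_deriv])
  have nop: "bounded_linear (\<lambda>z::'n l2vec \<times> 'n l2vec. neumann_op (second_deriv a z p))" for p
    by (rule bounded_linear_compose[OF bounded_linear_neumann_op bounded_linear_second_deriv])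
  have off: "bounded_linear (\<lambda>z::'n l2vec \<times> 'n l2vec. neumann_const (crd (fst z) p) (second_deriv a z p))" for p
    unfolding neumann_const_def
    by (intro bounded_linear_compose[OF bounded_linear_inner_left] bounded_linear_sub cf nop)
  have D1: "bounded_linear (D1 p)" for p
    unfolding D1_def
    by (intro bounded_linear_sub cf nop bounded_linear_compose[OF bounded_linear_scaleR_left] off)
  have D2: "bounded_linear (D2 p)" for p
    unfolding D2_def end_value_def
    by (intro bounded_linear_add bounded_linear_compose[OF bounded_linear_inner_left] bounded_linear_second_deriv off np)
  have G: "graph_A a = (\<Inter>p\<in>{..<CARD('n)}. {z. D1 p z = 0} \<inter> {z. D2 p z = 0})"
    unfolding graph_A_def D1_def D2_def by (auto simp: neg_eq_iff_add_eq_0)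
  show "closed (graph_A a :: ('n l2vec \<times> 'n l2vec) set)"
    unfolding G
    by (intro closed_INT ballI closed_Int closed_Collect_eq continuous_on_const
        bounded_linear.continuous_on[OF D1] bounded_linear.continuous_on[OF D2] continuous_on_id)
  show "subspace (graph_A a :: ('n l2vec \<times> 'n l2vec) set)"
    unfolding G
    by (intro subspace_Inter ballI) 
       (auto intro!: subspace_inter linear_subspace_kernel bounded_linear.linear D1 D2)
qed

text \<open>If a pair $(f, (a+1) f)$ lies in the graph, then every component satisfies $f'' = f$. Going downwards
from the last component, the component that follows is already known to vanish, so that both
boundary conditions are homogeneous Neumann conditions. Then $-k^2\pi^2$ times a cosine coefficient
equals that coefficient, and all coefficients are zero.\<close>

lemma graph_A_injective:
  fixes f :: "'n::{finite, linorder} l2vec"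
  assumes "(f, (a + 1) *\<^sub>R f) \<in> graph_A a"
  shows "f = 0"
proof -
  have h: "second_deriv a (f, (a + 1) *\<^sub>R f) p = crd f p" for p
    by (simp add: second_deriv_def crd_def algebra_simps)
  have "crd f (CARD('n) - m) = 0" for m
  proof (induction m)
    case 0
    then show ?case by (simp add: crd_beyond)
  next
    case (Suc m)
    show ?case
    proof (cases "m < CARD('n)")
      case False
      then show ?thesis using Suc by simp
    next
      case True
      define p where "p = CARD('n) - Suc m"
      have p: "p < CARD('n)" "Suc p = CARD('n) - m" using True by (auto simp: p_def)
      let ?g = "crd f p"
      have eq: "?g - neumann_op ?g = neumann_const ?g ?g *\<^sub>R one_l2"
        and mean: "inner ?g one_l2 = 0"
        using assms p Suc unfolding graph_A_def by (auto simp: h end_value_0)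
      have "?g = 0"
      proof (rule cosb.coeff_eqI)
        fix k
        show "inner ?g (cos_l2 k) = inner 0 (cos_l2 k)"
        proof (cases "k = 0")
          case True
          then show ?thesis using mean by (simp add: cos_l2_0)
        next
          case False
          have "inner (?g - neumann_op ?g) (cos_l2 k) = 0"
            unfolding eq using False cos_l2_orthonormal[of 0 k] by (simp add: cos_l2_0)
          then have "inner (neumann_op ?g) (cos_l2 k) = inner ?g (cos_l2 k)"
            by (simp add: inner_diff_left)
          then have "((real k * pi)\<^sup>2 + 1) * inner ?g (cos_l2 k) = 0"
            using cos_coeff_neumann_op[of k ?g] False mean by (simp add: algebra_simps)
          moreover have "(real k * pi)\<^sup>2 + 1 \<noteq> 0" using zero_le_power2[of "real k * pi"] by linarith
          ultimately show ?thesis by simp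
        qed
      qed
      then show ?thesis by (simp add: p_def)
    qed
  qed
  then have "crd f p = 0" if "p < CARD('n)" for p
    using that diff_diff_cancel[of p "CARD('n)"] by (metis less_imp_le)
  then show ?thesis by (intro crd_eqI) (simp add: crd_def)
qed

section \<open>Block Toeplitz operators\<close>

text \<open>Multiplication of two power series truncated at order $N$: the square of index pairs may be replaced
by the triangle below the antidiagonal if the remaining terms vanish.\<close>

lemma sum_square_eq_triangle:
  fixes g :: "nat \<Rightarrow> nat \<Rightarrow> 'a::comm_monoid_add"
  assumes "\<And>m l. N \<le> m + l \<Longrightarrow> g m l = 0"
  shows "(\<Sum>m<N. \<Sum>l<N. g m l) = (\<Sum>s<N. \<Sum>i\<le>s. g i (s - i))"
proof -
  have "(\<Sum>m<N. \<Sum>l<N. g m l) = (\<Sum>(m, l)\<in>{..<N} \<times> {..<N}. g m l)"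
    by (simp add: sum.cartesian_product)
  also have "\<dots> = (\<Sum>(m, l)\<in>{(m, l). m + l < N}. g m l)"
  proof (rule sum.mono_neutral_right)
    have "m + l < N" if "g m l \<noteq> 0" for m l using assms that not_le by blast
    then show "\<forall>i\<in>{..<N} \<times> {..<N} - {(m, l). m + l < N}. (case i of (m, l) \<Rightarrow> g m l) = 0" by auto
  qed auto
  also have "\<dots> = (\<Sum>s<N. \<Sum>i\<le>s. g i (s - i))"
    by (rule sum.triangle_reindex)
  finally show ?thesis .
qed

text \<open>The upper triangular block operator with the entry \<open>B m\<close> on the $m$-th diagonal, i.e. the truncated
power series $\sum_m B_m z^m$ in the shift $z$ that moves component $p+1$ to component $p$.\<close>

definition toeplitz :: "(nat \<Rightarrow> l2 \<Rightarrow> l2) \<Rightarrow> 'n::{finite, linorder} l2vec \<Rightarrow> 'n l2vec" where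
  "toeplitz B f = vec_of (\<lambda>p. \<Sum>m<CARD('n). B m (crd f (p + m)))"

lemma crd_toeplitz:
  fixes f :: "'n::{finite, linorder} l2vec"
  assumes "\<And>m. bounded_linear (B m)"
  shows "crd (toeplitz B f) p = (\<Sum>m<CARD('n). B m (crd f (p + m)))"
proof (cases "p < CARD('n)")
  case True
  then show ?thesis by (simp add: toeplitz_def crd_vec_of)
next
  case False
  then show ?thesis
    using assms by (simp add: crd_beyond linear_0 bounded_linear.linear)
qed

lemma bounded_linear_toeplitz:
  assumes "\<And>m. bounded_linear (B m)"
  shows "bounded_linear (toeplitz B :: 'n::{finite, linorder} l2vec \<Rightarrow> _)"
  unfolding toeplitz_def
  by (intro bounded_linear_vec_of bounded_linear_sum bounded_linear_compose[OF assms] bounded_linear_crd)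

lemma toeplitz_compose:
  fixes f :: "'n::{finite, linorder} l2vec"
  assumes B: "\<And>m. bounded_linear (B m)" and C: "\<And>m. bounded_linear (C m)"
  shows "toeplitz B (toeplitz C f) = toeplitz (\<lambda>s x. \<Sum>i\<le>s. B i (C (s - i) x)) f"
proof (rule crd_eqI)
  fix p assume "p < CARD('n)"
  let ?N = "CARD('n)"
  have BC: "bounded_linear (\<lambda>x. \<Sum>i\<le>s. B i (C (s - i) x))" for s
    by (intro bounded_linear_sum bounded_linear_compose[OF B C])
  have "crd (toeplitz B (toeplitz C f)) p = (\<Sum>m<?N. \<Sum>l<?N. B m (C l (crd f (p + (m + l)))))"
    using B by (simp add: crd_toeplitz[of B, OF B] crd_toeplitz[of C, OF C] linear_sum bounded_linear.linear add.assoc)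
  also have "\<dots> = (\<Sum>s<?N. \<Sum>i\<le>s. B i (C (s - i) (crd f (p + (i + (s - i))))))"
    by (rule sum_square_eq_triangle)
       (use B C in \<open>simp add: crd_beyond linear_0 bounded_linear.linear\<close>)
  also have "\<dots> = crd (toeplitz (\<lambda>s x. \<Sum>i\<le>s. B i (C (s - i) x)) f) p"
    by (simp add: crd_toeplitz[of "\<lambda>s x. \<Sum>i\<le>s. B i (C (s - i) x)", OF BC])
  finally show "crd (toeplitz B (toeplitz C f)) p = crd (toeplitz (\<lambda>s x. \<Sum>i\<le>s. B i (C (s - i) x)) f) p" .
qed

lemma toeplitz_id: "toeplitz (\<lambda>m x. if m = 0 then x else 0) f = (f :: 'n::{finite, linorder} l2vec)"
proof (rule crd_eqI)
  fix p assume "p < CARD('n)"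
  have bl: "bounded_linear (\<lambda>x::l2. if m = 0 then x else 0)" for m :: nat
    by (cases "m = 0") (auto simp: bounded_linear_ident bounded_linear_zero)
  have "crd (toeplitz (\<lambda>m x. if m = 0 then x else 0) f) p
      = (\<Sum>m<CARD('n). if m = 0 then crd f (p + m) else 0)"
    by (subst crd_toeplitz) (rule bl refl)+
  then show "crd (toeplitz (\<lambda>m x. if m = 0 then x else 0) f) p = crd f p"
    by simp
qed

text \<open>The coefficients of the inverse of a power series with constant coefficient $1$. The coefficients
are operators that need not commute; this recursion gives the right inverse.\<close>

fun toeplitz_inverse :: "(nat \<Rightarrow> l2 \<Rightarrow> l2) \<Rightarrow> nat \<Rightarrow> l2 \<Rightarrow> l2" where
  "toeplitz_inverse B m x =
     (if m = 0 then x else - (\<Sum>i\<in>{1..m}. B i (toeplitz_inverse B (m - i) x)))"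

declare toeplitz_inverse.simps [simp del]

lemma bounded_linear_toeplitz_inverse:
  assumes B: "\<And>m. bounded_linear (B m)"
  shows "bounded_linear (toeplitz_inverse B m)"
proof (induction m rule: less_induct)
  case (less m)
  show ?case
  proof (cases "m = 0")
    case True
    then have "toeplitz_inverse B m = (\<lambda>x. x)" by (auto simp: toeplitz_inverse.simps)
    then show ?thesis by (simp add: bounded_linear_ident)
  next
    case False
    then have "toeplitz_inverse B m = (\<lambda>x. - (\<Sum>i\<in>{1..m}. B i (toeplitz_inverse B (m - i) x)))"
      by (intro ext) (subst toeplitz_inverse.simps, simp)
    then show ?thesis
      using False less by (auto intro!: bounded_linear_minus bounded_linear_sum bounded_linear_compose[OF B])
  qed
qed

lemma toeplitz_right_inverse:
  fixes f :: "'n::{finite, linorder} l2vec"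
  assumes B: "\<And>m. bounded_linear (B m)" and B0: "\<And>x. B 0 x = x"
  shows "toeplitz B (toeplitz (toeplitz_inverse B) f) = f"
proof -
  have "(\<Sum>i\<le>s. B i (toeplitz_inverse B (s - i) x)) = (if s = 0 then x else 0)" for s x
  proof (cases "s = 0")
    case True
    then show ?thesis by (simp add: B0 toeplitz_inverse.simps)
  next
    case False
    have "{..s} = insert 0 {1..s}" by auto
    then have "(\<Sum>i\<le>s. B i (toeplitz_inverse B (s - i) x))
        = toeplitz_inverse B s x + (\<Sum>i\<in>{1..s}. B i (toeplitz_inverse B (s - i) x))"
      by (simp add: B0)
    also have "toeplitz_inverse B s x = - (\<Sum>i\<in>{1..s}. B i (toeplitz_inverse B (s - i) x))"
      using False by (subst toeplitz_inverse.simps) simp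
    finally show ?thesis using False by simp
  qed
  then show ?thesis
    using toeplitz_id[of f] by (simp add: toeplitz_compose[of B "toeplitz_inverse B", OF B bounded_linear_toeplitz_inverse[OF B]])
qed

text \<open>The right inverse has constant coefficient $1$ too, hence a right inverse of its own, which must be the
original operator.\<close>

lemma toeplitz_left_inverse:
  fixes f :: "'n::{finite, linorder} l2vec"
  assumes B: "\<And>m. bounded_linear (B m)" and B0: "\<And>x. B 0 x = x"
  shows "toeplitz (toeplitz_inverse B) (toeplitz B f) = f"
proof -
  let ?C = "toeplitz_inverse B" and ?D = "toeplitz_inverse (toeplitz_inverse B)"
  have C: "bounded_linear (?C m)" for m by (rule bounded_linear_toeplitz_inverse[OF B])
  have C0: "?C 0 x = x" for x by (simp add: toeplitz_inverse.simps)
  have "toeplitz B f = toeplitz B (toeplitz ?C (toeplitz ?D f))"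
    by (simp add: toeplitz_right_inverse[of ?C, OF C C0])
  also have "\<dots> = toeplitz ?D f" by (rule toeplitz_right_inverse[of B, OF B B0])
  finally show ?thesis by (simp add: toeplitz_right_inverse[of ?C, OF C C0])
qed

definition axis_vec :: "nat \<Rightarrow> l2 \<Rightarrow> 'n::{finite, linorder} l2vec" where
  "axis_vec i v = vec_of (\<lambda>p. if p = i then v else 0)"

lemma crd_axis_vec: "crd (axis_vec i v :: 'n::{finite, linorder} l2vec) p = (if p = i \<and> i < CARD('n) then v else 0)"
  by (simp add: axis_vec_def crd_vec_of)

lemma bounded_linear_axis_vec: "bounded_linear (axis_vec i :: l2 \<Rightarrow> 'n::{finite, linorder} l2vec)"
  unfolding axis_vec_def
proof (rule bounded_linear_vec_of)
  show "bounded_linear (\<lambda>v. if p = i then v else 0 :: l2)" for p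
    by (cases "p = i") (auto simp: bounded_linear_ident bounded_linear_zero)
qed

lemma sum_axis_vec: "(\<Sum>i<CARD('n). axis_vec i (crd f i)) = (f :: 'n::{finite, linorder} l2vec)"
proof (rule crd_eqI)
  fix p assume p: "p < CARD('n)"
  have "crd (\<Sum>i<CARD('n). axis_vec i (crd f i) :: 'n l2vec) p = (\<Sum>i<CARD('n). if p = i then crd f i else 0)"
    by (simp add: linear_sum[OF bounded_linear.linear[OF bounded_linear_crd]] crd_axis_vec cong: if_cong)
  then show "crd (\<Sum>i<CARD('n). axis_vec i (crd f i) :: 'n l2vec) p = crd f p"
    using p by simp
qed

lemma inner_crd: "inner f g = (\<Sum>p<CARD('n). inner (crd f p) (crd g p))" for f g :: "'n::{finite, linorder} l2vec"
proof -
  have "inner f g = (\<Sum>j\<in>(UNIV :: 'n set). inner (crd f (idx j - 1)) (crd g (idx j - 1)))"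
    unfolding crd_idx by (simp add: inner_vec_def)
  also have "\<dots> = (\<Sum>q\<in>{1..CARD('n)}. inner (crd f (q - 1)) (crd g (q - 1)))"
    by (rule sum.reindex_bij_betw[OF bij_betw_idx])
  also have "\<dots> = (\<Sum>p<CARD('n). inner (crd f p) (crd g p))"
    by (rule sum.reindex_bij_witness[where i = Suc and j = "\<lambda>q. q - 1"]) auto
  finally show ?thesis .
qed

section \<open>Orthonormal bases and Riesz bases of the product space\<close>

lemma axis_cos_orthonormal:
  assumes "i < CARD('n)" "i' < CARD('n)"
  shows "inner (axis_vec i (cos_l2 k) :: 'n::{finite, linorder} l2vec) (axis_vec i' (cos_l2 k')) = (if i = i' \<and> k = k' then 1 else 0)"
proof -
  have "inner (axis_vec i (cos_l2 k) :: 'n l2vec) (axis_vec i' (cos_l2 k'))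
      = (\<Sum>p<CARD('n). if p = i then (if i = i' then inner (cos_l2 k) (cos_l2 k') else 0) else 0)"
    unfolding inner_crd by (rule sum.cong) (auto simp: crd_axis_vec assms)
  then show ?thesis using assms by (simp add: cos_l2_orthonormal)
qed

text \<open>For a fixed position the closure of the span contains all vectors with arbitrary entry there, since
the cosines are complete; every vector is a finite sum of such vectors.\<close>

lemma axis_cos_dense:
  "closure (span ((\<lambda>(i, k). axis_vec i (cos_l2 k) :: 'n::{finite, linorder} l2vec) ` ({..<CARD('n)} \<times> UNIV))) = UNIV"
    (is "closure (span ?S) = UNIV")
proof -
  have "axis_vec i v \<in> closure (span ?S)" if "i < CARD('n)" for i v
  proof -
    have "closed {v. axis_vec i v \<in> closure (span ?S)}"
      by (intro closed_vimage[unfolded vimage_def] closed_closure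
          bounded_linear.continuous_on[OF bounded_linear_axis_vec] continuous_on_id)
    moreover have "cos_l2 k \<in> {v. axis_vec i v \<in> closure (span ?S)}" for k
      using that by (auto intro!: subsetD[OF closure_subset] span_base)
    then have "span (range cos_l2) \<subseteq> {v. axis_vec i v \<in> closure (span ?S)}"
      using linear_subspace_vimage[OF bounded_linear.linear[OF bounded_linear_axis_vec] closure_subspace[OF subspace_span], of i ?S]
      by (intro span_minimal) (auto simp: vimage_def)
    ultimately have "closure (span (range cos_l2)) \<subseteq> {v. axis_vec i v \<in> closure (span ?S)}"
      by (intro closure_minimal)
    then show ?thesis unfolding cos_l2_dense by auto
  qed
  then have "(\<Sum>i<CARD('n). axis_vec i (crd f i)) \<in> closure (span ?S)" for f :: "'n l2vec"
    by (intro subspace_sum closure_subspace subspace_span) auto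
  then show ?thesis by (simp add: sum_axis_vec set_eq_iff)
qed

text \<open>Parseval turns the two estimates into bounds for \<open>U\<close> and for its inverse \<open>V\<close>, and \<open>U\<close> maps a dense
subspace to a dense subspace because it is continuous and surjective.\<close>

lemma riesz_basis_image:
  fixes b :: "'i \<Rightarrow> 'h::{real_inner, complete_space}"
  assumes orth: "\<And>i j. i \<in> I \<Longrightarrow> j \<in> I \<Longrightarrow> inner (b i) (b j) = (if i = j then 1 else 0)"
    and dense: "closure (span (b ` I)) = UNIV"
    and U: "bounded_linear U" and V: "bounded_linear V"
    and UV: "\<And>x. U (V x) = x" and VU: "\<And>x. V (U x) = x"
  shows "riesz_basis I (\<lambda>i. U (b i))"
  unfolding riesz_basis_def
proof (intro conjI)
  let ?S = "closure (span ((\<lambda>i. U (b i)) ` I))"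
  have "closed {x. U x \<in> ?S}"
    by (intro closed_vimage[unfolded vimage_def] closed_closure bounded_linear.continuous_on[OF U] continuous_on_id)
  moreover have "span (b ` I) \<subseteq> {x. U x \<in> ?S}"
    using linear_subspace_vimage[OF bounded_linear.linear[OF U] subspace_span, of "(\<lambda>i. U (b i)) ` I"]
      closure_subset[of "span ((\<lambda>i. U (b i)) ` I)"]
    by (intro order_trans[OF span_minimal[of _ "{x. U x \<in> span ((\<lambda>i. U (b i)) ` I)}"]])
       (auto simp: vimage_def intro: span_base)
  ultimately have "UNIV \<subseteq> {x. U x \<in> ?S}"
    unfolding dense[symmetric] by (intro closure_minimal)
  then have "U (V y) \<in> ?S" for y by blast
  then show "?S = UNIV" by (auto simp: UV)
next
  obtain K where K: "K > 0" "\<And>x. norm (U x) \<le> norm x * K"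
    using bounded_linear.pos_bounded[OF U] by blast
  obtain L where L: "L > 0" "\<And>x. norm (V x) \<le> norm x * L"
    using bounded_linear.pos_bounded[OF V] by blast
  have "1 / L\<^sup>2 * (\<Sum>i\<in>F. (c i)\<^sup>2) \<le> (norm (\<Sum>i\<in>F. c i *\<^sub>R U (b i)))\<^sup>2 \<and>
      (norm (\<Sum>i\<in>F. c i *\<^sub>R U (b i)))\<^sup>2 \<le> K\<^sup>2 * (\<Sum>i\<in>F. (c i)\<^sup>2)"
    if F: "finite F" "F \<subseteq> I" for F c
  proof -
    define x where "x = (\<Sum>i\<in>F. c i *\<^sub>R b i)"
    have "inner x x = (\<Sum>i\<in>F. \<Sum>j\<in>F. c i * (c j * inner (b i) (b j)))"
      unfolding x_def inner_sum_left inner_sum_right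
      by (subst sum.swap) (simp add: sum_distrib_left mult_ac inner_commute)
    also have "\<dots> = (\<Sum>i\<in>F. \<Sum>j\<in>F. if i = j then c i * c j else 0)"
      using F by (intro sum.cong refl) (auto simp: orth subset_iff)
    also have "\<dots> = (\<Sum>i\<in>F. (c i)\<^sup>2)" using F by (simp add: power2_eq_square)
    finally have x: "(norm x)\<^sup>2 = (\<Sum>i\<in>F. (c i)\<^sup>2)" by (simp add: power2_norm_eq_inner)
    have Ux: "(\<Sum>i\<in>F. c i *\<^sub>R U (b i)) = U x"
      unfolding x_def using bounded_linear.linear[OF U] by (simp add: linear_sum linear_scale)
    have "(norm (U x))\<^sup>2 \<le> (norm x * K)\<^sup>2" by (intro power_mono K) simp
    moreover have "(norm x)\<^sup>2 \<le> (norm (U x) * L)\<^sup>2"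
      using L(2)[of "U x"] by (intro power_mono) (simp_all add: VU)
    ultimately show ?thesis
      unfolding Ux x[symmetric] using L(1) by (simp add: power_mult_distrib field_simps)
  qed
  moreover have "1 / L\<^sup>2 > 0" "K\<^sup>2 > 0" using K(1) L(1) by simp_all
  ultimately show "\<exists>m>0. \<exists>M>0. \<forall>F c. finite F \<and> F \<subseteq> I \<longrightarrow>
      m * (\<Sum>i\<in>F. (c i)\<^sup>2) \<le> (norm (\<Sum>i\<in>F. c i *\<^sub>R U (b i)))\<^sup>2 \<and>
      (norm (\<Sum>i\<in>F. c i *\<^sub>R U (b i)))\<^sup>2 \<le> M * (\<Sum>i\<in>F. (c i)\<^sup>2)" by blast
qed

section \<open>Power series in the shift as symbols of operators\<close>

text \<open>The action of a power series in the shift on a finite sequence, at one frequency \<open>k\<close>. Terms of order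
$N$ and beyond do not act on sequences that vanish from \<open>N\<close> on, so that the full ring of formal power
series may be used in place of its quotient by $z^N$.\<close>

definition symbol_action :: "nat \<Rightarrow> real fps \<Rightarrow> (nat \<Rightarrow> real) \<Rightarrow> nat \<Rightarrow> real" where
  "symbol_action N F s p = (\<Sum>m<N. fps_nth F m * s (p + m))"

lemma symbol_action_mult:
  assumes "\<And>p. N \<le> p \<Longrightarrow> s p = 0"
  shows "symbol_action N F (symbol_action N G s) p = symbol_action N (F * G) s p"
proof -
  have "symbol_action N F (symbol_action N G s) p = (\<Sum>m<N. \<Sum>l<N. fps_nth F m * (fps_nth G l * s (p + (m + l))))"
    by (simp add: symbol_action_def sum_distrib_left add.assoc)
  also have "\<dots> = (\<Sum>t<N. \<Sum>i\<le>t. fps_nth F i * (fps_nth G (t - i) * s (p + (i + (t - i)))))"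
    by (rule sum_square_eq_triangle) (simp add: assms)
  also have "\<dots> = symbol_action N (F * G) s p"
    by (simp add: symbol_action_def fps_mult_nth sum_distrib_right atLeast0AtMost mult.assoc)
  finally show ?thesis .
qed

lemma symbol_action_const: "0 < N \<Longrightarrow> symbol_action N (fps_const c) s p = c * s p"
proof -
  have "symbol_action N (fps_const c) s p = (\<Sum>m<N. if m = 0 then c * s p else 0)"
    unfolding symbol_action_def by (rule sum.cong) auto
  then show "0 < N \<Longrightarrow> ?thesis" by simp
qed

lemma symbol_action_diff: "symbol_action N (F - G) s p = symbol_action N F s p - symbol_action N G s p"
  by (simp add: symbol_action_def left_diff_distrib sum_subtractf)

definition bounded_symbol :: "(nat \<Rightarrow> real fps) \<Rightarrow> bool" where
  "bounded_symbol F \<longleftrightarrow> (\<forall>m. \<exists>M. \<forall>k. \<bar>fps_nth (F k) m\<bar> \<le> M)"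

text \<open>The operator that acts at frequency \<open>k\<close> by the power series \<open>F k\<close>. Each coefficient of the series gives
a diagonal operator in the cosine basis, which is bounded if the coefficient is bounded in \<open>k\<close>.\<close>

definition symbol_op :: "(nat \<Rightarrow> real fps) \<Rightarrow> 'n::{finite, linorder} l2vec \<Rightarrow> 'n l2vec" where
  "symbol_op F = toeplitz (\<lambda>m. cosb.multiplier (\<lambda>k. fps_nth (F k) m))"

definition cos_coeff :: "'n::{finite, linorder} l2vec \<Rightarrow> nat \<Rightarrow> nat \<Rightarrow> real" where
  "cos_coeff x k p = inner (crd x p) (cos_l2 k)"

lemma cos_coeff_beyond: "CARD('n) \<le> p \<Longrightarrow> cos_coeff (x :: 'n::{finite, linorder} l2vec) k p = 0"
  by (simp add: cos_coeff_def crd_beyond)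

lemma bounded_linear_cos_coeff: "bounded_linear (\<lambda>x. cos_coeff x k p)"
  unfolding cos_coeff_def by (rule bounded_linear_compose[OF bounded_linear_inner_left bounded_linear_crd])

lemma vec_cos_coeff_eqI:
  fixes x y :: "'n::{finite, linorder} l2vec"
  assumes "\<And>k p. p < CARD('n) \<Longrightarrow> cos_coeff x k p = cos_coeff y k p" shows "x = y"
  using assms by (intro crd_eqI cosb.coeff_eqI) (simp add: cos_coeff_def)

lemma bounded_linear_symbol_multiplier:
  assumes "bounded_symbol F"
  shows "bounded_linear (cosb.multiplier (\<lambda>k. fps_nth (F k) m))"
proof -
  obtain M where "\<And>k. \<bar>fps_nth (F k) m\<bar> \<le> M" using assms unfolding bounded_symbol_def by blast
  then show ?thesis by (rule cosb.bounded_linear_multiplier)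
qed

lemma bounded_linear_symbol_op: "bounded_symbol F \<Longrightarrow> bounded_linear (symbol_op F)"
  unfolding symbol_op_def by (intro bounded_linear_toeplitz bounded_linear_symbol_multiplier)

lemma cos_coeff_symbol_op:
  fixes x :: "'n::{finite, linorder} l2vec"
  assumes F: "bounded_symbol F"
  shows "cos_coeff (symbol_op F x) k p = symbol_action (CARD('n)) (F k) (cos_coeff x k) p"
proof -
  have m: "inner (cosb.multiplier (\<lambda>k. fps_nth (F k) m) f) (cos_l2 k) = fps_nth (F k) m * inner f (cos_l2 k)" for m f
  proof -
    obtain M where "\<And>k. \<bar>fps_nth (F k) m\<bar> \<le> M" using F unfolding bounded_symbol_def by blast
    then show ?thesis by (rule cosb.coeff_multiplier)
  qed
  show ?thesis
    unfolding cos_coeff_def symbol_op_def symbol_action_def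
    by (subst crd_toeplitz) (simp_all add: inner_sum_left m bounded_linear_symbol_multiplier[OF F])
qed

lemma bounded_symbol_mult:
  assumes "bounded_symbol F" "bounded_symbol G"
  shows "bounded_symbol (\<lambda>k. F k * G k)"
  unfolding bounded_symbol_def
proof
  fix m
  obtain A B where AB: "\<And>m k. \<bar>fps_nth (F k) m\<bar> \<le> A m" "\<And>m k. \<bar>fps_nth (G k) m\<bar> \<le> B m"
    using assms unfolding bounded_symbol_def by metis
  have "\<bar>fps_nth (F k * G k) m\<bar> \<le> (\<Sum>i=0..m. A i * B (m - i))" for k
    unfolding fps_mult_nth
  proof (rule order_trans[OF sum_abs sum_mono])
    fix i
    show "\<bar>fps_nth (F k) i * fps_nth (G k) (m - i)\<bar> \<le> A i * B (m - i)"
      unfolding abs_mult using AB[of k] abs_ge_zero order_trans[OF abs_ge_zero AB(1)]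
      by (intro mult_mono) auto
  qed
  then show "\<exists>M. \<forall>k. \<bar>fps_nth (F k * G k) m\<bar> \<le> M" by blast
qed

text \<open>The passage from symbols to operators is multiplicative. So identities between operators reduce to
identities between formal power series, one frequency at a time.\<close>

lemma symbol_op_mult:
  assumes F: "bounded_symbol F" and G: "bounded_symbol G"
  shows "symbol_op F (symbol_op G x) = symbol_op (\<lambda>k. F k * G k) (x :: 'n::{finite, linorder} l2vec)"
proof (rule vec_cos_coeff_eqI)
  fix k p
  have "cos_coeff (symbol_op G x) k = symbol_action (CARD('n)) (G k) (cos_coeff x k)"
    by (rule ext) (rule cos_coeff_symbol_op[OF G])
  then show "cos_coeff (symbol_op F (symbol_op G x)) k p = cos_coeff (symbol_op (\<lambda>k. F k * G k) x) k p"
    by (simp add: cos_coeff_symbol_op F bounded_symbol_mult[OF F G] symbol_action_mult cos_coeff_beyond)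
qed

lemma symbol_op_one: "symbol_op (\<lambda>k. 1) x = (x :: 'n::{finite, linorder} l2vec)"
proof (rule vec_cos_coeff_eqI)
  have "bounded_symbol (\<lambda>k. 1)" unfolding bounded_symbol_def by auto
  then show "cos_coeff (symbol_op (\<lambda>k. 1) x) k p = cos_coeff x k p" for k p
    using symbol_action_const[of "CARD('n)" 1 "cos_coeff x k" p] by (simp add: cos_coeff_symbol_op)
qed

lemma symbol_op_tendsto:
  fixes x :: "'n::{finite, linorder} l2vec"
  assumes "\<And>m. \<exists>M. (\<forall>\<^sub>F t in E. \<forall>k. \<bar>fps_nth (F t k) m\<bar> \<le> M) \<and> (\<forall>k. \<bar>fps_nth (F0 k) m\<bar> \<le> M)"
    and "\<And>k m. ((\<lambda>t. fps_nth (F t k) m) \<longlongrightarrow> fps_nth (F0 k) m) E"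
  shows "((\<lambda>t. symbol_op (F t) x) \<longlongrightarrow> symbol_op F0 x) E"
  unfolding symbol_op_def toeplitz_def
proof (intro vec_of_tendsto tendsto_sum)
  fix p m
  obtain M where "\<forall>\<^sub>F t in E. \<forall>k. \<bar>fps_nth (F t k) m\<bar> \<le> M" "\<forall>k. \<bar>fps_nth (F0 k) m\<bar> \<le> M" using assms(1) by blast
  then show "((\<lambda>t. cosb.multiplier (\<lambda>k. fps_nth (F t k) m) (crd x (p + m))) \<longlongrightarrow> cosb.multiplier (\<lambda>k. fps_nth (F0 k) m) (crd x (p + m))) E"
    by (intro cosb.multiplier_tendsto assms(2)) auto
qed

section \<open>The differential equation for $\sigma_k^n$\<close>

lemma sigma_fun_0: "sigma_fun k 0 = (\<lambda>x. 0)"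
  by (simp add: sigma_fun.simps)

lemma sigma_fun_1: "sigma_fun k (Suc 0) = cos_basis k"
  by (auto simp: sigma_fun.simps cos_basis_def)

lemma sigma_fun_rec_0:
  assumes "n > 1"
  shows "sigma_fun 0 n x = sigma_fun 0 (n - 1) 1 * x
    + (\<Sum>i\<in>{1..<n}. nu_coeff 0 i * integral {0..x} (\<lambda>s. (x - s) * sigma_fun 0 (n - i) s))"
  using assms by (subst sigma_fun.simps) simp

lemma sigma_fun_rec_pos:
  assumes "n > 1" "k > 0"
  shows "sigma_fun k n x = sigma_fun k (n - 1) 1 / (k * pi) * sin (k * pi * x)
    + 1 / (k * pi) * (\<Sum>i\<in>{1..<n}. nu_coeff k i * integral {0..x} (\<lambda>s. sin (k * pi * (x - s)) * sigma_fun k (n - i) s))"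
  using assms by (subst sigma_fun.simps) simp

lemma nu_coeff_rec_0:
  "n > 1 \<Longrightarrow> nu_coeff 0 (n - 1) = - sigma_fun 0 (n - 1) 1
    - (\<Sum>i\<in>{1..<n - 1}. nu_coeff 0 i * integral {0..1} (sigma_fun 0 (n - i)))"
  by (subst nu_coeff.simps) simp

lemma nu_coeff_rec_pos:
  "n > 1 \<Longrightarrow> k > 0 \<Longrightarrow> nu_coeff k (n - 1) = - sqrt 2 * (sigma_fun k (n - 1) 1
    + (\<Sum>i\<in>{1..<n - 1}. nu_coeff k i * integral {0..1} (\<lambda>s. cos (k * pi * s) * sigma_fun k (n - i) s)))"
  by (subst nu_coeff.simps) simp

lemma nu_coeff_0: "nu_coeff k 0 = 0"
  by (simp add: nu_coeff.simps)

text \<open>The variable of differentiation also occurs in the integrand; expanding the kernel $x - s$ separates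
it from the variable of integration. The same device serves for the trigonometric kernels below.\<close>

lemma DERIV_linear_kernel:
  fixes g :: "real \<Rightarrow> real"
  assumes g: "continuous_on {0..1} g" and x: "x \<in> {0..1}"
  shows "((\<lambda>x. integral {0..x} (\<lambda>s. (x - s) * g s)) has_real_derivative integral {0..x} g) (at x within {0..1})"
proof -
  have gc: "continuous_on {0..y} g" if "y \<in> {0..1}" for y
    using that by (intro continuous_on_subset[OF g]) auto
  have eq: "integral {0..y} (\<lambda>s. (y - s) * g s) = y * integral {0..y} g - integral {0..y} (\<lambda>s. s * g s)"
    if "y \<in> {0..1}" for y
    unfolding left_diff_distrib
    by (subst Henstock_Kurzweil_Integration.integral_diff)
       (auto intro!: integrable_continuous_interval continuous_intros gc that)
  have "((\<lambda>x. x * integral {0..x} g - integral {0..x} (\<lambda>s. s * g s)) has_real_derivative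
      1 * integral {0..x} g + g x * x - x * g x) (at x within {0..1})"
    by (intro DERIV_diff DERIV_mult DERIV_ident integral_has_real_derivative continuous_intros g x)
  then have "((\<lambda>x. x * integral {0..x} g - integral {0..x} (\<lambda>s. s * g s)) has_real_derivative
      integral {0..x} g) (at x within {0..1})" by simp
  then show ?thesis
    by (rule has_field_derivative_transform_within[OF _ zero_less_one x]) (simp add: eq)
qed

lemma DERIV_trig_kernel:
  fixes g :: "real \<Rightarrow> real"
  assumes g: "continuous_on {0..1} g" and x: "x \<in> {0..1}"
  shows "((\<lambda>x. integral {0..x} (\<lambda>s. sin (c * (x - s)) * g s)) has_real_derivative
      c * integral {0..x} (\<lambda>s. cos (c * (x - s)) * g s)) (at x within {0..1})" (is ?sin)
    and "((\<lambda>x. integral {0..x} (\<lambda>s. cos (c * (x - s)) * g s)) has_real_derivative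
      g x - c * integral {0..x} (\<lambda>s. sin (c * (x - s)) * g s)) (at x within {0..1})" (is ?cos)
proof -
  have gc: "continuous_on {0..y} g" if "y \<in> {0..1}" for y
    using that by (intro continuous_on_subset[OF g]) auto
  define A where "A x = integral {0..x} (\<lambda>s. cos (c * s) * g s)" for x
  define B where "B x = integral {0..x} (\<lambda>s. sin (c * s) * g s)" for x
  have sin_eq: "integral {0..y} (\<lambda>s. sin (c * (y - s)) * g s) = sin (c * y) * A y - cos (c * y) * B y"
    if y: "y \<in> {0..1}" for y
  proof -
    have "integral {0..y} (\<lambda>s. sin (c * (y - s)) * g s)
        = integral {0..y} (\<lambda>s. sin (c * y) * (cos (c * s) * g s) - cos (c * y) * (sin (c * s) * g s))"
      by (rule integral_cong) (simp add: right_diff_distrib sin_diff left_diff_distrib)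
    then show ?thesis
      unfolding A_def B_def
      by (subst (asm) Henstock_Kurzweil_Integration.integral_diff)
         (auto intro!: integrable_continuous_interval continuous_intros gc y)
  qed
  have cos_eq: "integral {0..y} (\<lambda>s. cos (c * (y - s)) * g s) = cos (c * y) * A y + sin (c * y) * B y"
    if y: "y \<in> {0..1}" for y
  proof -
    have "integral {0..y} (\<lambda>s. cos (c * (y - s)) * g s)
        = integral {0..y} (\<lambda>s. cos (c * y) * (cos (c * s) * g s) + sin (c * y) * (sin (c * s) * g s))"
      by (rule integral_cong) (simp add: right_diff_distrib cos_diff distrib_right)
    then show ?thesis
      unfolding A_def B_def
      by (subst (asm) Henstock_Kurzweil_Integration.integral_add)
         (auto intro!: integrable_continuous_interval continuous_intros gc y)
  qed
  have dA: "(A has_real_derivative cos (c * x) * g x) (at x within {0..1})"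
    unfolding A_def by (intro integral_has_real_derivative continuous_intros g x)
  have dB: "(B has_real_derivative sin (c * x) * g x) (at x within {0..1})"
    unfolding B_def by (intro integral_has_real_derivative continuous_intros g x)
  have "((\<lambda>x. sin (c * x) * A x - cos (c * x) * B x) has_real_derivative
      c * (cos (c * x) * A x + sin (c * x) * B x)) (at x within {0..1})"
    by (rule derivative_eq_intros dA dB refl)+ (simp add: algebra_simps)
  then show ?sin
    unfolding cos_eq[OF x] 
    by (rule has_field_derivative_transform_within[OF _ zero_less_one x]) (simp add: sin_eq)
  have pyth: "cos (c * x) * (cos (c * x) * g x) + sin (c * x) * (sin (c * x) * g x) = g x"
    unfolding mult.assoc[symmetric] distrib_right[symmetric] sin_cos_squared_add3 by simp
  have "((\<lambda>x. cos (c * x) * A x + sin (c * x) * B x) has_real_derivative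
      (cos (c * x) * (cos (c * x) * g x) + sin (c * x) * (sin (c * x) * g x)) - c * (sin (c * x) * A x - cos (c * x) * B x)) (at x within {0..1})"
    by (rule derivative_eq_intros dA dB refl)+ (simp add: algebra_simps)
  then show ?cos
    unfolding pyth sin_eq[OF x] 
    by (rule has_field_derivative_transform_within[OF _ zero_less_one x]) (simp add: cos_eq)
qed

text \<open>The right-hand side of the differential equation for $\sigma_k^n$.\<close>

definition sigma_second :: "nat \<Rightarrow> nat \<Rightarrow> real \<Rightarrow> real" where
  "sigma_second k n x = - (real k * pi)\<^sup>2 * sigma_fun k n x + (\<Sum>i\<in>{1..<n}. nu_coeff k i * sigma_fun k (n - i) x)"

lemma continuous_on_sigma_second: "continuous_on {0..1} (sigma_second k n)"
  unfolding sigma_second_def by (intro continuous_intros continuous_on_sigma_fun)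

lemma integral_cos_cos_basis:
  assumes "k > 0" shows "integral {0..1} (\<lambda>s. cos (real k * pi * s) * cos_basis k s) = 1 / sqrt 2"
proof -
  have "(\<lambda>s. cos (real k * pi * s) * cos_basis k s) = (\<lambda>s. (1 / sqrt 2) * (cos_basis k s * cos_basis k s))"
    using assms by (auto simp: cos_basis_def)
  then have "integral {0..1} (\<lambda>s. cos (real k * pi * s) * cos_basis k s)
      = (1 / sqrt 2) * integral {0..1} (\<lambda>s. cos_basis k s * cos_basis k s)" by simp
  also have "integral {0..1} (\<lambda>s. cos_basis k s * cos_basis k s) = 1"
    using cos_l2_orthonormal[of k k]
    unfolding cos_l2_def inner_abs_l2_continuous[OF continuous_on_cos_basis continuous_on_cos_basis] by simp
  finally show ?thesis by simp
qed

lemma sum_split_last: "(n::nat) > 1 \<Longrightarrow> (\<Sum>i\<in>{1..<n}. f i) = (\<Sum>i\<in>{1..<n - 1}. f i) + (f (n - 1) :: real)"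
proof -
  assume "n > 1"
  then have "{1..<n} = insert (n - 1) {1..<n - 1}" by auto
  then show ?thesis by simp
qed

text \<open>The functions $\sigma_k^n$ solve an inhomogeneous equation by variation of constants, and the constants
$\nu_k^{n-1}$ are chosen such that the derivative \<open>v\<close> vanishes at $1$. In this condition
$\nu_k^{n-1}$ appears with the factor $\int_0^1 \cos(k\pi s)\,\sigma_k^1(s)\,ds \ne 0$, so that it can be
solved for.\<close>

lemma sigma_ode:
  assumes "n > 0"
  obtains v where
    "\<And>x. x \<in> {0..1} \<Longrightarrow> (sigma_fun k n has_real_derivative v x) (at x within {0..1})"
    "\<And>x. x \<in> {0..1} \<Longrightarrow> (v has_real_derivative sigma_second k n x) (at x within {0..1})"
    "v 1 = 0" "v 0 = sigma_fun k (n - 1) 1"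
proof -
  let ?c = "real k * pi"
  note cs = continuous_on_sigma_fun
  consider "n = 1" | "n > 1" "k = 0" | "n > 1" "k > 0" using assms by linarith
  then show ?thesis
  proof cases
    case 1
    show ?thesis
    proof (rule that[of "\<lambda>x. - (sqrt 2 * ?c * sin (?c * x))"])
      show "(sigma_fun k n has_real_derivative - (sqrt 2 * ?c * sin (?c * x))) (at x within {0..1})" for x
        unfolding 1 One_nat_def sigma_fun_1 cos_basis_def
        by (cases "k = 0") (auto intro!: derivative_eq_intros)
      show "((\<lambda>x. - (sqrt 2 * ?c * sin (?c * x))) has_real_derivative sigma_second k n x) (at x within {0..1})" for x
        unfolding 1 sigma_second_def One_nat_def sigma_fun_1 cos_basis_def
        by (cases "k = 0") (auto intro!: derivative_eq_intros simp: power2_eq_square)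
      show "- (sqrt 2 * ?c * sin (?c * 1)) = 0" by (simp add: sin_npi)
      show "- (sqrt 2 * ?c * sin (?c * 0)) = sigma_fun k (n - 1) 1" using 1 by (simp add: sigma_fun_0)
    qed
  next
    case 2
    define v where "v x = sigma_fun 0 (n - 1) 1 + (\<Sum>i\<in>{1..<n}. nu_coeff 0 i * integral {0..x} (sigma_fun 0 (n - i)))" for x
    show ?thesis
    proof (rule that[of v])
      show "(sigma_fun k n has_real_derivative v x) (at x within {0..1})" if x: "x \<in> {0..1}" for x
        unfolding 2(2) sigma_fun_rec_0[OF 2(1), abs_def] v_def
        by (rule derivative_eq_intros DERIV_sum DERIV_cmult DERIV_linear_kernel cs x refl)+ simp
      show "(v has_real_derivative sigma_second k n x) (at x within {0..1})" if x: "x \<in> {0..1}" for x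
        unfolding v_def sigma_second_def 2(2)
        by (rule derivative_eq_intros DERIV_sum DERIV_cmult integral_has_real_derivative cs x refl)+ simp
      have "integral {0..1} (sigma_fun 0 (n - (n - 1))) = 1"
      proof -
        have "n - (n - 1) = Suc 0" using 2 by simp
        then show ?thesis by (simp add: sigma_fun_1 cos_basis_def[abs_def])
      qed
      then show "v 1 = 0"
        using nu_coeff_rec_0[OF 2(1)] unfolding v_def sum_split_last[OF 2(1)] by simp
      show "v 0 = sigma_fun k (n - 1) 1" by (simp add: v_def 2)
    qed
  next
    case 3
    define v where "v x = sigma_fun k (n - 1) 1 * cos (?c * x)
        + (\<Sum>i\<in>{1..<n}. nu_coeff k i * integral {0..x} (\<lambda>s. cos (?c * (x - s)) * sigma_fun k (n - i) s))" for x
    have c: "?c > 0" using 3 by simp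
    show ?thesis
    proof (rule that[of v])
      show "(sigma_fun k n has_real_derivative v x) (at x within {0..1})" if x: "x \<in> {0..1}" for x
      proof -
        have "((\<lambda>x. sigma_fun k (n - 1) 1 / ?c * sin (?c * x) + 1 / ?c * (\<Sum>i\<in>{1..<n}. nu_coeff k i *
            integral {0..x} (\<lambda>s. sin (?c * (x - s)) * sigma_fun k (n - i) s))) has_real_derivative
          sigma_fun k (n - 1) 1 / ?c * (cos (?c * x) * ?c) + 1 / ?c * (\<Sum>i\<in>{1..<n}. nu_coeff k i *
            (?c * integral {0..x} (\<lambda>s. cos (?c * (x - s)) * sigma_fun k (n - i) s)))) (at x within {0..1})"
          by (intro DERIV_add DERIV_cmult DERIV_sum DERIV_trig_kernel cs x)
             (auto intro!: derivative_eq_intros)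
        also have "sigma_fun k (n - 1) 1 / ?c * (cos (?c * x) * ?c) + 1 / ?c * (\<Sum>i\<in>{1..<n}. nu_coeff k i *
            (?c * integral {0..x} (\<lambda>s. cos (?c * (x - s)) * sigma_fun k (n - i) s))) = v x"
          unfolding v_def sum_distrib_left using 3(2) by (simp add: field_simps)
        finally show ?thesis
          unfolding sigma_fun_rec_pos[OF 3, abs_def] .
      qed
      show "(v has_real_derivative sigma_second k n x) (at x within {0..1})" if x: "x \<in> {0..1}" for x
      proof -
        have "(v has_real_derivative sigma_fun k (n - 1) 1 * (- sin (?c * x) * ?c)
            + (\<Sum>i\<in>{1..<n}. nu_coeff k i * (sigma_fun k (n - i) x - ?c * integral {0..x} (\<lambda>s. sin (?c * (x - s)) * sigma_fun k (n - i) s)))) (at x within {0..1})"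
          unfolding v_def
          by (intro DERIV_add DERIV_cmult DERIV_sum DERIV_trig_kernel cs x)
             (auto intro!: derivative_eq_intros)
        also have "sigma_fun k (n - 1) 1 * (- sin (?c * x) * ?c)
            + (\<Sum>i\<in>{1..<n}. nu_coeff k i * (sigma_fun k (n - i) x - ?c * integral {0..x} (\<lambda>s. sin (?c * (x - s)) * sigma_fun k (n - i) s)))
            = sigma_second k n x"
        proof -
          have "?c\<^sup>2 * sigma_fun k n x = ?c * (sigma_fun k (n - 1) 1 * sin (?c * x))
              + ?c * (\<Sum>i\<in>{1..<n}. nu_coeff k i * integral {0..x} (\<lambda>s. sin (?c * (x - s)) * sigma_fun k (n - i) s))"
            unfolding sigma_fun_rec_pos[OF 3] using c by (simp add: field_simps power2_eq_square)
          then show ?thesis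
            unfolding sigma_second_def
            by (simp add: right_diff_distrib sum_subtractf sum_distrib_left algebra_simps)
        qed
        finally show ?thesis .
      qed
      show "v 1 = 0"
      proof -
        define I where "I i = integral {0..1} (\<lambda>s. cos (?c * s) * sigma_fun k (n - i) s)" for i
        have sc: "sin ?c = 0" by (rule sin_npi)
        have "cos (?c * (1 - s)) = cos ?c * cos (?c * s)" for s
          by (simp add: right_diff_distrib cos_diff sc)
        then have I: "integral {0..1} (\<lambda>s. cos (?c * (1 - s)) * sigma_fun k (n - i) s) = cos ?c * I i" for i
          unfolding I_def by (simp add: mult.assoc)
        have "n - (n - 1) = Suc 0" using 3 by simp
        \<comment> \<open>The last summand, in which $\sigma_k^1$ occurs, is the one that the choice of
          $\nu_k^{n-1}$ cancels against the others.\<close>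
        then have last: "I (n - 1) = 1 / sqrt 2"
          unfolding I_def using integral_cos_cos_basis[OF 3(2)] by (simp add: sigma_fun_1)
        have nu: "nu_coeff k (n - 1) = - sqrt 2 * (sigma_fun k (n - 1) 1 + (\<Sum>i\<in>{1..<n - 1}. nu_coeff k i * I i))"
          using nu_coeff_rec_pos[OF 3] unfolding I_def by simp
        have "v 1 = cos ?c * (sigma_fun k (n - 1) 1 + (\<Sum>i\<in>{1..<n}. nu_coeff k i * I i))"
          unfolding v_def I by (simp add: distrib_left sum_distrib_left mult_ac)
        also have "sigma_fun k (n - 1) 1 + (\<Sum>i\<in>{1..<n}. nu_coeff k i * I i) = 0"
          unfolding sum_split_last[OF 3(1)] last nu by (simp add: field_simps)
        finally show ?thesis by simp
      qed
      show "v 0 = sigma_fun k (n - 1) 1" by (simp add: v_def)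
    qed
  qed
qed

section \<open>Decay of $\sigma_k^n$ and the Riesz basis\<close>

lemma abs_integral_le:
  fixes f g :: "real \<Rightarrow> real"
  assumes f: "continuous_on {0..1} f" "\<And>s. \<bar>f s\<bar> \<le> 1" and g: "continuous_on {0..1} g" "\<And>s. s \<in> {0..1} \<Longrightarrow> \<bar>g s\<bar> \<le> C"
    and x: "x \<in> {0..1}"
  shows "\<bar>integral {0..x} (\<lambda>s. f s * g s)\<bar> \<le> C"
proof -
  have "norm (integral {0..x} (\<lambda>s. f s * g s)) \<le> C * (x - 0)"
  proof (rule integral_bound)
    show "continuous_on {0..x} (\<lambda>s. f s * g s)"
      by (rule continuous_on_subset[of "{0..1}"]) (use x in \<open>auto intro!: continuous_intros f(1) g(1)\<close>)
    show "norm (f s * g s) \<le> C" if "s \<in> {0..x}" for s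
    proof -
      have "\<bar>f s\<bar> * \<bar>g s\<bar> \<le> 1 * C" using that x by (intro mult_mono f g) auto
      then show ?thesis by (simp add: abs_mult)
    qed
  qed (use x in auto)
  also have "0 \<le> C" using g(2)[OF x] by linarith
  then have "C * (x - 0) \<le> C" using x by (simp add: mult_left_le)
  finally show ?thesis by simp
qed

text \<open>For $n \ge 2$ the recursion contains the factor $1/(k\pi)$. All other quantities in it are bounded
uniformly in \<open>k\<close>, which gives decay of order $1/k$.\<close>

lemma sigma_fun_step_bound:
  assumes n: "n > 1" and k: "k > 0" and x: "x \<in> {0..1}"
    and \<sigma>: "\<And>j s. j < n \<Longrightarrow> s \<in> {0..1} \<Longrightarrow> \<bar>sigma_fun k j s\<bar> \<le> C"
    and \<nu>: "\<And>j. j < n \<Longrightarrow> \<bar>nu_coeff k j\<bar> \<le> C"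
  shows "\<bar>sigma_fun k n x\<bar> \<le> (C + real n * C * C) / real k"
proof -
  let ?c = "real k * pi"
  have "0 \<le> C" using \<nu>[of 0] n by linarith
  have c: "?c \<ge> real k" "real k > 0" using k pi_gt3 by simp_all
  let ?S = "\<Sum>i\<in>{1..<n}. nu_coeff k i * integral {0..x} (\<lambda>s. sin (?c * (x - s)) * sigma_fun k (n - i) s)"
  have S: "\<bar>?S\<bar> \<le> real n * C * C"
  proof -
    have "\<bar>?S\<bar> \<le> (\<Sum>i\<in>{1..<n}. C * C)"
    proof (rule order_trans[OF sum_abs sum_mono])
      fix i assume i: "i \<in> {1..<n}"
      have "\<bar>integral {0..x} (\<lambda>s. sin (?c * (x - s)) * sigma_fun k (n - i) s)\<bar> \<le> C"
        by (rule abs_integral_le) (use i x in \<open>auto intro!: continuous_intros continuous_on_sigma_fun \<sigma>\<close>)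
      then show "\<bar>nu_coeff k i * integral {0..x} (\<lambda>s. sin (?c * (x - s)) * sigma_fun k (n - i) s)\<bar> \<le> C * C"
        unfolding abs_mult using \<open>0 \<le> C\<close> i by (intro mult_mono \<nu>) auto
    qed
    also have "\<dots> = real (n - 1) * (C * C)" by simp
    also have "\<dots> \<le> real n * (C * C)"
      using \<open>0 \<le> C\<close> by (intro mult_right_mono) auto
    also have "\<dots> = real n * C * C" by simp
    finally show ?thesis .
  qed
  have "\<bar>sigma_fun k (n - 1) 1 * sin (?c * x)\<bar> \<le> C * 1"
    unfolding abs_mult using \<open>0 \<le> C\<close> n by (intro mult_mono \<sigma>) auto
  then have "\<bar>sigma_fun k (n - 1) 1 * sin (?c * x) + ?S\<bar> \<le> C + real n * C * C"
    using S by linarith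
  moreover have "sigma_fun k n x = (sigma_fun k (n - 1) 1 * sin (?c * x) + ?S) / ?c"
    unfolding sigma_fun_rec_pos[OF n k] by (simp add: add_divide_distrib)
  ultimately have "\<bar>sigma_fun k n x\<bar> \<le> (C + real n * C * C) / ?c"
    using c by (simp add: abs_divide divide_right_mono)
  also have "\<dots> \<le> (C + real n * C * C) / real k"
    using c \<open>0 \<le> C\<close> by (intro divide_left_mono) auto
  finally show ?thesis .
qed

text \<open>Joint induction: $\sigma_k^n$ is estimated by the quantities with smaller index, and $\nu_k^n$ by these
and $\sigma_k^n$. The case $k = 0$ is left out since its recursion is different; a single frequency is
irrelevant for boundedness.\<close>

lemma sigma_nu_bounded:
  "\<exists>C. \<forall>k>0. \<forall>j\<le>n. \<bar>nu_coeff k j\<bar> \<le> C \<and> (\<forall>x\<in>{0..1}. \<bar>sigma_fun k j x\<bar> \<le> C)"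
proof (induction n)
  case 0
  show ?case by (intro exI[of _ 0]) (simp add: sigma_fun_0 nu_coeff_0)
next
  case (Suc n)
  then obtain C where C: "\<And>k j. k > 0 \<Longrightarrow> j \<le> n \<Longrightarrow> \<bar>nu_coeff k j\<bar> \<le> C"
    "\<And>k j x. k > 0 \<Longrightarrow> j \<le> n \<Longrightarrow> x \<in> {0..1} \<Longrightarrow> \<bar>sigma_fun k j x\<bar> \<le> C" by blast
  have "0 \<le> C" using C(1)[of 1 0] by linarith
  define C1 where "C1 = 2 + (C + real (Suc n) * C * C)"
  have "C \<le> C1" "0 \<le> C1" "2 \<le> C1" unfolding C1_def using \<open>0 \<le> C\<close> by (simp_all add: add_nonneg_nonneg)
  have \<sigma>n: "\<bar>sigma_fun k (Suc n) x\<bar> \<le> C1" if k: "k > 0" and x: "x \<in> {0..1}" for k x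
  proof (cases "n = 0")
    case True
    have "\<bar>sqrt 2 * cos (real k * pi * x)\<bar> \<le> 2 * 1"
      unfolding abs_mult by (intro mult_mono) (auto simp: real_le_lsqrt)
    then show ?thesis
      using True k \<open>2 \<le> C1\<close> by (simp add: sigma_fun_1 cos_basis_def)
  next
    case False
    have "\<bar>sigma_fun k (Suc n) x\<bar> \<le> (C + real (Suc n) * C * C) / real k"
      by (rule sigma_fun_step_bound) (use False k x C in auto)
    also have "\<dots> \<le> (C + real (Suc n) * C * C) / 1"
      using \<open>0 \<le> C\<close> k by (intro divide_left_mono) auto
    finally show ?thesis by (simp add: C1_def)
  qed
  have \<sigma>: "\<bar>sigma_fun k j x\<bar> \<le> C1" if "k > 0" "x \<in> {0..1}" "j \<le> Suc n" for k j x
    using \<sigma>n[OF that(1,2)] C(2)[OF that(1) _ that(2), of j] \<open>C \<le> C1\<close> that(3) by (cases "j = Suc n") force+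
  define C2 where "C2 = 2 * (C1 + real (Suc n) * C * C1)"
  have "C \<le> C1 + real (Suc n) * C * C1" using \<open>C \<le> C1\<close> \<open>0 \<le> C\<close> \<open>0 \<le> C1\<close> by (simp add: add_increasing2)
  then have "C1 \<le> C2" "C \<le> C2" unfolding C2_def using \<open>0 \<le> C\<close> \<open>0 \<le> C1\<close> \<open>C \<le> C1\<close> by (simp_all add: add_nonneg_nonneg)
  have \<nu>n: "\<bar>nu_coeff k (Suc n)\<bar> \<le> C2" if k: "k > 0" for k
  proof -
    let ?S = "\<Sum>i\<in>{1..<Suc n}. nu_coeff k i * integral {0..1} (\<lambda>s. cos (k * pi * s) * sigma_fun k (Suc (Suc n) - i) s)"
    have "\<bar>?S\<bar> \<le> (\<Sum>i\<in>{1..<Suc n}. C * C1)"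
    proof (rule order_trans[OF sum_abs sum_mono])
      fix i assume i: "i \<in> {1..<Suc n}"
      have "\<bar>integral {0..1} (\<lambda>s. cos (k * pi * s) * sigma_fun k (Suc (Suc n) - i) s)\<bar> \<le> C1"
        by (rule abs_integral_le) (use i k in \<open>auto intro!: continuous_intros continuous_on_sigma_fun \<sigma>\<close>)
      then show "\<bar>nu_coeff k i * integral {0..1} (\<lambda>s. cos (k * pi * s) * sigma_fun k (Suc (Suc n) - i) s)\<bar> \<le> C * C1"
        unfolding abs_mult using \<open>0 \<le> C\<close> i k by (intro mult_mono C) auto
    qed
    also have "\<dots> \<le> real (Suc n) * C * C1"
      using \<open>0 \<le> C\<close> \<open>0 \<le> C1\<close> by (simp add: mult_right_mono algebra_simps)
    finally have S: "\<bar>?S\<bar> \<le> real (Suc n) * C * C1" .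
    have "nu_coeff k (Suc n) = - sqrt 2 * (sigma_fun k (Suc n) 1 + ?S)"
      using nu_coeff_rec_pos[of "Suc (Suc n)" k] k by simp
    then have "\<bar>nu_coeff k (Suc n)\<bar> = sqrt 2 * \<bar>sigma_fun k (Suc n) 1 + ?S\<bar>"
      by (simp add: abs_mult)
    also have "\<dots> \<le> 2 * (C1 + real (Suc n) * C * C1)"
    proof (intro mult_mono)
      show "\<bar>sigma_fun k (Suc n) 1 + ?S\<bar> \<le> C1 + real (Suc n) * C * C1"
        using S \<sigma>n[OF k, of 1] by simp
    qed (auto simp: real_le_lsqrt)
    finally show ?thesis by (simp add: C2_def)
  qed
  show ?case
  proof (intro exI[of _ C2] allI impI conjI ballI)
    fix k j :: nat assume k: "0 < k" and j: "j \<le> Suc n"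
    show "\<bar>nu_coeff k j\<bar> \<le> C2"
      using \<nu>n[OF k] C(1)[OF k, of j] \<open>C \<le> C2\<close> j by (cases "j = Suc n") force+
    show "\<bar>sigma_fun k j x\<bar> \<le> C2" if "x \<in> {0..1}" for x
      using \<sigma>[OF k that j] \<open>C1 \<le> C2\<close> by linarith
  qed
qed

lemma nu_coeff_bounded: "\<exists>M. \<forall>k. \<bar>nu_coeff k n\<bar> \<le> M"
proof -
  obtain C where C: "\<And>k. k > 0 \<Longrightarrow> \<bar>nu_coeff k n\<bar> \<le> C" using sigma_nu_bounded[of n] by blast
  have "\<bar>nu_coeff k n\<bar> \<le> max C \<bar>nu_coeff 0 n\<bar>" for k
    using C[of k] by (cases "k = 0") auto
  then show ?thesis by blast
qed

lemma sigma_fun_square_summable: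
  assumes "n > 1"
  shows "summable (\<lambda>k. (norm (abs_l2 (sigma_fun k n)))\<^sup>2)"
proof -
  obtain C where C: "\<And>k j. k > 0 \<Longrightarrow> j \<le> n \<Longrightarrow> \<bar>nu_coeff k j\<bar> \<le> C"
    "\<And>k j x. k > 0 \<Longrightarrow> j \<le> n \<Longrightarrow> x \<in> {0..1} \<Longrightarrow> \<bar>sigma_fun k j x\<bar> \<le> C"
    using sigma_nu_bounded[of n] by blast
  have "0 \<le> C" using C(1)[of 1 0] by linarith
  define D where "D = C + real n * C * C"
  have "D \<ge> 0" unfolding D_def using \<open>0 \<le> C\<close> by simp
  have le: "(norm (abs_l2 (sigma_fun k n)))\<^sup>2 \<le> D\<^sup>2 * inverse (real k ^ 2)" if "k \<ge> 1" for k
  proof -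
    have "norm (abs_l2 (sigma_fun k n)) \<le> D / real k"
    proof (rule norm_abs_l2_le[OF square_integrable_sigma_fun])
      fix x :: real assume "0 < x" "x < 1"
      then show "\<bar>sigma_fun k n x\<bar> \<le> D / real k"
        unfolding D_def by (intro sigma_fun_step_bound C) (use assms that in auto)
    qed (use \<open>D \<ge> 0\<close> in simp)
    then have "(norm (abs_l2 (sigma_fun k n)))\<^sup>2 \<le> (D / real k)\<^sup>2" by (rule power_mono) simp
    then show ?thesis by (simp add: divide_inverse power_mult_distrib power_inverse)
  qed
  have "summable (\<lambda>k. D\<^sup>2 * inverse (real k ^ 2))"
    by (intro summable_mult inverse_power_summable) simp
  then show ?thesis
    by (rule summable_comparison_test'[where N = 1]) (use le in simp)
qed

text \<open>The block on the $m$-th diagonal maps \<open>cos_l2 k\<close> to $\sigma_k^{m+1}$. For $m = 0$ this is the identity,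
which has to be treated apart because the cosines are not square summable.\<close>

definition transform_coeff :: "nat \<Rightarrow> l2 \<Rightarrow> l2" where
  "transform_coeff m = (if m = 0 then (\<lambda>x. x) else cosb.synthesis (\<lambda>k. abs_l2 (sigma_fun k (Suc m))))"

definition transform :: "'n::{finite, linorder} l2vec \<Rightarrow> 'n l2vec" where
  "transform = toeplitz transform_coeff"

definition transform_inv :: "'n::{finite, linorder} l2vec \<Rightarrow> 'n l2vec" where
  "transform_inv = toeplitz (toeplitz_inverse transform_coeff)"

lemma bounded_linear_transform_coeff: "bounded_linear (transform_coeff m)"
  by (cases "m = 0") (auto simp: transform_coeff_def bounded_linear_ident
      intro!: cosb.bounded_linear_synthesis sigma_fun_square_summable)

lemma transform_coeff_0: "transform_coeff 0 x = x"
  by (simp add: transform_coeff_def)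

lemma transform_coeff_cos: "transform_coeff m (cos_l2 k) = abs_l2 (sigma_fun k (Suc m))"
  by (cases "m = 0") (simp_all add: transform_coeff_def cosb.synthesis_basis sigma_fun_1 flip: cos_l2_def)

lemma bounded_linear_transform: "bounded_linear transform" "bounded_linear transform_inv"
  unfolding transform_def transform_inv_def
  by (intro bounded_linear_toeplitz bounded_linear_toeplitz_inverse bounded_linear_transform_coeff)+

lemma transform_inverse: "transform (transform_inv x) = x" "transform_inv (transform x) = x"
  unfolding transform_def transform_inv_def
  using toeplitz_right_inverse[of transform_coeff x] toeplitz_left_inverse[of transform_coeff x]
  by (simp_all add: bounded_linear_transform_coeff transform_coeff_0)

lemma crd_transform_axis:
  assumes "i < CARD('n)"
  shows "crd (transform (axis_vec i (cos_l2 k)) :: 'n::{finite, linorder} l2vec) p = (if p \<le> i then abs_l2 (sigma_fun k (Suc i - p)) else 0)"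
proof -
  have "crd (transform (axis_vec i (cos_l2 k)) :: 'n l2vec) p
      = (\<Sum>m<CARD('n). if m = i - p \<and> p \<le> i then abs_l2 (sigma_fun k (Suc m)) else 0)"
    unfolding transform_def crd_toeplitz[of transform_coeff, OF bounded_linear_transform_coeff]
    by (rule sum.cong) (auto simp: crd_axis_vec assms transform_coeff_cos
        linear_0[OF bounded_linear.linear[OF bounded_linear_transform_coeff]])
  also have "\<dots> = (if p \<le> i then abs_l2 (sigma_fun k (Suc (i - p))) else 0)"
    using assms less_imp_diff_less[OF assms, of p] by (cases "p \<le> i") simp_all
  finally show ?thesis by (simp add: Suc_diff_le)
qed

lemma phi_eq_transform:
  assumes "i < CARD('n)"
  shows "(phi (Suc i) k :: 'n::{finite, linorder} l2vec) = transform (axis_vec i (cos_l2 k))"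
proof (rule crd_eqI)
  fix p assume p: "p < CARD('n)"
  have "crd (phi (Suc i) k :: 'n l2vec) p = (if p \<le> i then abs_l2 (sigma_fun k (Suc i - p)) else 0)"
    using p by (simp add: crd_def phi_def idx_inv)
  then show "crd (phi (Suc i) k :: 'n l2vec) p = crd (transform (axis_vec i (cos_l2 k)) :: 'n l2vec) p"
    by (simp add: crd_transform_axis[OF assms])
qed

lemma riesz_basis_cong:
  fixes b b' :: "'i \<Rightarrow> 'h::{real_inner, complete_space}"
  assumes eq: "\<And>i. i \<in> I \<Longrightarrow> b i = b' i" and b: "riesz_basis I b"
  shows "riesz_basis I b'"
proof -
  have im: "b' ` I = b ` I" by (rule image_cong) (simp_all add: eq)
  have sum: "(\<Sum>i\<in>F. c i *\<^sub>R b' i) = (\<Sum>i\<in>F. c i *\<^sub>R b i)" if "F \<subseteq> I" for F and c :: "'i \<Rightarrow> real"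
    by (rule sum.cong) (use eq that in auto)
  obtain m M where "m > 0" "M > 0" and mM: "\<And>F c. finite F \<and> F \<subseteq> I \<Longrightarrow>
        m * (\<Sum>i\<in>F. (c i)\<^sup>2) \<le> (norm (\<Sum>i\<in>F. c i *\<^sub>R b i))\<^sup>2 \<and>
        (norm (\<Sum>i\<in>F. c i *\<^sub>R b i))\<^sup>2 \<le> M * (\<Sum>i\<in>F. (c i)\<^sup>2)"
    using b unfolding riesz_basis_def by blast
  have "m * (\<Sum>i\<in>F. (c i)\<^sup>2) \<le> (norm (\<Sum>i\<in>F. c i *\<^sub>R b' i))\<^sup>2 \<and>
      (norm (\<Sum>i\<in>F. c i *\<^sub>R b' i))\<^sup>2 \<le> M * (\<Sum>i\<in>F. (c i)\<^sup>2)" if "finite F \<and> F \<subseteq> I" for F c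
    using mM[OF that, of c] sum[of F c] that by simp
  moreover have "closure (span (b' ` I)) = UNIV" using b unfolding riesz_basis_def im by blast
  ultimately show ?thesis using \<open>m > 0\<close> \<open>M > 0\<close> unfolding riesz_basis_def by blast
qed

theorem riesz_basis_phi:
  "riesz_basis ({1..CARD('n)} \<times> UNIV) (\<lambda>(i, k). phi i k :: 'n::{finite, linorder} l2vec)"
proof -
  let ?I = "{1..CARD('n)} \<times> (UNIV :: nat set)"
  let ?b = "\<lambda>(i, k). axis_vec (i - 1) (cos_l2 k) :: 'n l2vec"
  have "riesz_basis ?I (\<lambda>x. transform (?b x))"
  proof (rule riesz_basis_image[OF _ _ bounded_linear_transform transform_inverse])
    show "inner (?b x) (?b y) = (if x = y then 1 else 0)" if "x \<in> ?I" "y \<in> ?I" for x y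
      using that by (auto simp: axis_cos_orthonormal split: if_splits)
    have "{..<CARD('n)} \<times> (UNIV :: nat set) = (\<lambda>(i, k). (i - 1, k)) ` ?I"
      by (force simp: image_iff)
    then have "?b ` ?I = (\<lambda>(i, k). axis_vec i (cos_l2 k) :: 'n l2vec) ` ({..<CARD('n)} \<times> UNIV)"
      by (simp add: image_image case_prod_beta)
    then show "closure (span (?b ` ?I)) = UNIV" using axis_cos_dense by simp
  qed
  moreover have "transform (?b x) = (\<lambda>(i, k). phi i k) x" if "x \<in> ?I" for x
    using that phi_eq_transform[of "fst x - 1" "snd x", where ?'n = 'n] by (auto simp: case_prod_beta)
  ultimately show ?thesis by (rule riesz_basis_cong[rotated])
qed

section \<open>The operator on the basis vectors\<close>

definition nu_symbol :: "nat \<Rightarrow> real fps" where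
  "nu_symbol k = Abs_fps (nu_coeff k)"

text \<open>The operator in the coefficients at frequency \<open>k\<close>: a Jordan-like block with eigenvalue $a - k^2\pi^2$
and nilpotent part \<open>nu_symbol k\<close>.\<close>

definition generator_symbol :: "real \<Rightarrow> nat \<Rightarrow> real fps" where
  "generator_symbol a k = fps_const (a - (real k * pi)\<^sup>2) + nu_symbol k"

lemma generator_symbol_nth:
  "fps_nth (generator_symbol a k) 0 = a - (real k * pi)\<^sup>2"
  "m > 0 \<Longrightarrow> fps_nth (generator_symbol a k) m = nu_coeff k m"
  by (simp_all add: generator_symbol_def nu_symbol_def nu_coeff_0)

lemma abs_l2_sigma_second:
  assumes "n > 0"
  shows "abs_l2 (sigma_second k n) + a *\<^sub>R abs_l2 (sigma_fun k n)
    = (\<Sum>m<n. fps_nth (generator_symbol a k) m *\<^sub>R abs_l2 (sigma_fun k (n - m)))"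
proof -
  note sq = square_integrable_sigma_fun
  define c where "c = - (real k * pi)\<^sup>2"
  have A: "abs_l2 (sigma_second k n) = c *\<^sub>R abs_l2 (sigma_fun k n)
      + (\<Sum>i\<in>{1..<n}. nu_coeff k i *\<^sub>R abs_l2 (sigma_fun k (n - i)))"
    unfolding sigma_second_def[abs_def] c_def[symmetric]
    by (subst abs_l2_add) (auto simp: abs_l2_scale abs_l2_sum sq square_integrable_scale square_integrable_sum)
  have B: "(\<Sum>m<n. fps_nth (generator_symbol a k) m *\<^sub>R abs_l2 (sigma_fun k (n - m)))
      = (a - (real k * pi)\<^sup>2) *\<^sub>R abs_l2 (sigma_fun k n) + (\<Sum>i\<in>{1..<n}. nu_coeff k i *\<^sub>R abs_l2 (sigma_fun k (n - i)))"
  proof -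
    have "{..<n} = insert 0 {1..<n}" using assms by auto
    then show ?thesis by (simp add: generator_symbol_nth)
  qed
  show ?thesis unfolding A B c_def by (simp add: algebra_simps)
qed

text \<open>The relation $\mathcal{A}\phi_{i,k} = (a - k^2\pi^2)\phi_{i,k} + \sum_m \nu_k^m\phi_{i-m,k}$, together
with the statement that $\phi_{i,k}$ belongs to the domain. Both follow from the differential equation
and the boundary values of $\sigma_k^n$.\<close>

lemma transform_axis_graph:
  fixes a :: real
  assumes i: "i < CARD('n)"
  shows "(transform (axis_vec i (cos_l2 k)) :: 'n::{finite, linorder} l2vec,
      transform (\<Sum>m\<le>i. fps_nth (generator_symbol a k) m *\<^sub>R axis_vec (i - m) (cos_l2 k))) \<in> graph_A a"
proof -
  let ?f = "transform (axis_vec i (cos_l2 k)) :: 'n l2vec"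
  let ?y = "transform (\<Sum>m\<le>i. fps_nth (generator_symbol a k) m *\<^sub>R axis_vec (i - m) (cos_l2 k)) :: 'n l2vec"
  let ?L = "fps_nth (generator_symbol a k)"
  have f: "crd ?f p = (if p \<le> i then abs_l2 (sigma_fun k (Suc i - p)) else 0)" for p
    by (rule crd_transform_axis[OF i])
  have y: "crd ?y p = (if p \<le> i then (\<Sum>m<Suc i - p. ?L m *\<^sub>R abs_l2 (sigma_fun k (Suc i - p - m))) else 0)" for p
  proof -
    have "crd ?y p = (\<Sum>m\<le>i. ?L m *\<^sub>R crd (transform (axis_vec (i - m) (cos_l2 k)) :: 'n l2vec) p)"
    proof -
      have lin: "linear (\<lambda>x :: 'n l2vec. crd (transform x) p)"
        by (rule bounded_linear.linear[OF bounded_linear_compose[OF bounded_linear_crd bounded_linear_transform(1)]])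
      show ?thesis by (simp add: linear_sum[OF lin] linear_scale[OF lin])
    qed
    also have "\<dots> = (\<Sum>m\<le>i. if p \<le> i - m then ?L m *\<^sub>R abs_l2 (sigma_fun k (Suc (i - m) - p)) else 0)"
      by (rule sum.cong) (use i in \<open>auto simp: crd_transform_axis\<close>)
    also have "\<dots> = (\<Sum>m\<in>{m\<in>{..i}. p \<le> i - m}. ?L m *\<^sub>R abs_l2 (sigma_fun k (Suc (i - m) - p)))"
      by (rule sum.inter_filter[symmetric]) simp
    also have "\<dots> = (if p \<le> i then (\<Sum>m<Suc i - p. ?L m *\<^sub>R abs_l2 (sigma_fun k (Suc i - p - m))) else 0)"
    proof (cases "p \<le> i")
      case True
      then have "{m\<in>{..i}. p \<le> i - m} = {..<Suc i - p}" by auto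
      moreover have "Suc (i - m) - p = Suc i - p - m" if "m < Suc i - p" for m using that by linarith
      ultimately show ?thesis using True by simp
    next
      case False
      then have "{m\<in>{..i}. p \<le> i - m} = {}" by auto
      then show ?thesis using False by (simp only: sum.empty if_False)
    qed
    finally show ?thesis .
  qed
  have h: "second_deriv a (?f, ?y) p = (if p \<le> i then abs_l2 (sigma_second k (Suc i - p)) else 0)" for p
  proof (cases "p \<le> i")
    case True
    then show ?thesis
      using abs_l2_sigma_second[of "Suc i - p" k a] by (simp add: second_deriv_def f y algebra_simps)
  next
    case False
    then show ?thesis by (simp add: second_deriv_def f y)
  qed
  have "crd ?f p - neumann_op (second_deriv a (?f, ?y) p) = neumann_const (crd ?f p) (second_deriv a (?f, ?y) p) *\<^sub>R one_l2 \<and>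
     - inner (second_deriv a (?f, ?y) p) one_l2 = end_value (crd ?f (Suc p)) (second_deriv a (?f, ?y) (Suc p))" for p
  proof (cases "p \<le> i")
    case True
    obtain v where v: "\<And>x. x \<in> {0..1} \<Longrightarrow> (sigma_fun k (Suc i - p) has_real_derivative v x) (at x within {0..1})"
      "\<And>x. x \<in> {0..1} \<Longrightarrow> (v has_real_derivative sigma_second k (Suc i - p) x) (at x within {0..1})"
      "v 1 = 0" "v 0 = sigma_fun k (Suc i - p - 1) 1"
      using sigma_ode[of "Suc i - p" k] True by (metis Suc_diff_le zero_less_Suc)
    note c = neumann_component_classical[OF v(1,2) continuous_on_sigma_second v(3)]
    have "end_value (crd ?f (Suc p)) (second_deriv a (?f, ?y) (Suc p)) = sigma_fun k (i - p) 1"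
    proof (cases "Suc p \<le> i")
      case True
      obtain w where w: "\<And>x. x \<in> {0..1} \<Longrightarrow> (sigma_fun k (i - p) has_real_derivative w x) (at x within {0..1})"
        "\<And>x. x \<in> {0..1} \<Longrightarrow> (w has_real_derivative sigma_second k (i - p) x) (at x within {0..1})" "w 1 = 0"
        using sigma_ode[of "i - p" k] True by (metis Suc_le_eq zero_less_diff)
      show ?thesis
        using neumann_component_classical(3)[OF w(1,2) continuous_on_sigma_second w(3)] True by (simp add: f h)
    next
      case False
      then have "i - p = 0" by simp
      then show ?thesis using False by (simp add: f h end_value_0 sigma_fun_0)
    qed
    then show ?thesis using c True v(4) by (simp add: f h)
  next
    case False
    then have "crd ?f p = 0" "second_deriv a (?f, ?y) p = 0" "crd ?f (Suc p) = 0" "second_deriv a (?f, ?y) (Suc p) = 0"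
      by (simp_all add: f h)
    then show ?thesis
      by (simp add: end_value_0 neumann_const_def linear_0 bounded_linear.linear bounded_linear_neumann_op)
  qed
  then show ?thesis by (simp add: graph_A_def)
qed

section \<open>The semigroup in the coefficients\<close>

text \<open>The formal power series $\exp(t(\lambda + \nu(z)))$ with $\lambda = a - k^2\pi^2$. The scalar factor is
separated because composition of formal power series requires an inner series without constant term.\<close>

definition exp_symbol :: "real \<Rightarrow> real \<Rightarrow> nat \<Rightarrow> real fps" where
  "exp_symbol a t k = fps_const (exp (t * (a - (real k * pi)\<^sup>2))) * (fps_exp t oo nu_symbol k)"

lemma nu_symbol_nth: "fps_nth (nu_symbol k) m = nu_coeff k m"
  by (simp add: nu_symbol_def)

lemma nu_symbol_nth_0: "fps_nth (nu_symbol k) 0 = 0"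
  by (simp add: nu_symbol_nth nu_coeff_0)

lemma exp_symbol_nth:
  "fps_nth (exp_symbol a t k) m
    = exp (t * (a - (real k * pi)\<^sup>2)) * (\<Sum>i=0..m. t ^ i / fact i * fps_nth (nu_symbol k ^ i) m)"
  by (simp add: exp_symbol_def fps_compose_nth)

lemma exp_symbol_0: "exp_symbol a 0 k = 1"
  by (simp add: exp_symbol_def)

lemma exp_symbol_add: "exp_symbol a (s + t) k = exp_symbol a s k * exp_symbol a t k"
proof -
  have "fps_exp (s + t) oo nu_symbol k = (fps_exp s oo nu_symbol k) * (fps_exp t oo nu_symbol k)"
    unfolding fps_exp_add_mult by (rule fps_compose_mult_distrib) (rule nu_symbol_nth_0)
  then show ?thesis
    by (simp add: exp_symbol_def distrib_right exp_add mult_ac flip: fps_const_mult)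
qed

text \<open>Every coefficient is an exponential times a polynomial in \<open>t\<close>. Termwise differentiation of the series
$\sum_i t^i\nu^i/i!$ shifts the index by one, which is multiplication by $\nu$.\<close>

lemma DERIV_exp_symbol:
  "((\<lambda>t. fps_nth (exp_symbol a t k) m) has_real_derivative fps_nth (generator_symbol a k * exp_symbol a t k) m) (at t within S)"
proof -
  let ?lam = "a - (real k * pi)\<^sup>2" and ?nu = "nu_symbol k"
  have term_deriv: "((\<lambda>t. t ^ i / fact i * c) has_real_derivative
      (fps_nth (fps_X * fps_exp t) i * c)) (at t within S)" for i c
  proof (cases i)
    case 0
    then show ?thesis by simp
  next
    case (Suc j)
    have "((\<lambda>t. t ^ Suc j / fact (Suc j) * c) has_real_derivative
        (real (Suc j) * t ^ j) / fact (Suc j) * c) (at t within S)"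
      using DERIV_cmult_right[OF DERIV_cdivide[OF DERIV_pow[of "Suc j" t S], of "fact (Suc j)"], of c]
      by (simp del: power_Suc fact_Suc of_nat_Suc)
    also have "(real (Suc j) * t ^ j) / fact (Suc j) * c = fps_nth (fps_X * fps_exp t) i * c"
      by (simp add: Suc fact_Suc del: of_nat_Suc)
    finally show ?thesis by (simp only: Suc)
  qed
  have mult: "?nu * (fps_exp t oo ?nu) = (fps_X * fps_exp t) oo ?nu"
    by (subst fps_compose_mult_distrib[OF nu_symbol_nth_0]) (simp only: fps_X_fps_compose_startby0[OF nu_symbol_nth_0])
  have "((\<lambda>t. exp (t * ?lam) * (\<Sum>i=0..m. t ^ i / fact i * fps_nth (?nu ^ i) m)) has_real_derivative
      (exp (t * ?lam) * ?lam) * (\<Sum>i=0..m. t ^ i / fact i * fps_nth (?nu ^ i) m)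
      + (\<Sum>i=0..m. fps_nth (fps_X * fps_exp t) i * fps_nth (?nu ^ i) m) * exp (t * ?lam)) (at t within S)"
    by (intro DERIV_mult DERIV_sum term_deriv) (auto intro!: derivative_eq_intros)
  also have "(exp (t * ?lam) * ?lam) * (\<Sum>i=0..m. t ^ i / fact i * fps_nth (?nu ^ i) m)
      + (\<Sum>i=0..m. fps_nth (fps_X * fps_exp t) i * fps_nth (?nu ^ i) m) * exp (t * ?lam)
      = ?lam * fps_nth (exp_symbol a t k) m + exp (t * ?lam) * fps_nth (?nu * (fps_exp t oo ?nu)) m"
    unfolding mult exp_symbol_nth fps_compose_nth[of "fps_X * fps_exp t"] by (simp only: mult_ac)
  also have "\<dots> = fps_nth (generator_symbol a k * exp_symbol a t k) m"
  proof -
    have "generator_symbol a k * exp_symbol a t k = fps_const ?lam * exp_symbol a t k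
        + fps_const (exp (t * ?lam)) * (?nu * (fps_exp t oo ?nu))"
      unfolding generator_symbol_def exp_symbol_def by (simp only: algebra_simps)
    then show ?thesis by (simp add: fps_add_nth)
  qed
  finally show ?thesis unfolding exp_symbol_nth .
qed

lemma bounded_symbol_nu: "bounded_symbol nu_symbol"
  using nu_coeff_bounded unfolding bounded_symbol_def nu_symbol_nth by blast

lemma bounded_symbol_power: "bounded_symbol F \<Longrightarrow> bounded_symbol (\<lambda>k. F k ^ i)"
proof (induction i)
  case 0
  then show ?case by (auto simp: bounded_symbol_def)
next
  case (Suc i)
  then show ?case using bounded_symbol_mult by simp
qed

text \<open>The eigenvalues $a - k^2\pi^2$ are bounded above by $a$, so the exponential factor is bounded in \<open>k\<close>; the
polynomial factor is bounded since the coefficients of all powers of $\nu_k$ are.\<close>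

lemma exp_symbol_bounded:
  obtains M where "\<And>t k. 0 \<le> t \<Longrightarrow> t \<le> T \<Longrightarrow> \<bar>fps_nth (exp_symbol a t k) m\<bar> \<le> M"
proof -
  have "\<forall>i. \<exists>B. \<forall>k. \<bar>fps_nth (nu_symbol k ^ i) m\<bar> \<le> B"
    using bounded_symbol_power[OF bounded_symbol_nu] unfolding bounded_symbol_def by blast
  then obtain B where B: "\<And>i k. \<bar>fps_nth (nu_symbol k ^ i) m\<bar> \<le> B i" by metis
  have "\<bar>fps_nth (exp_symbol a t k) m\<bar> \<le> exp (T * \<bar>a\<bar>) * (\<Sum>i=0..m. T ^ i / fact i * B i)"
    if t: "0 \<le> t" "t \<le> T" for t k
  proof -
    have "t * (a - (real k * pi)\<^sup>2) \<le> T * \<bar>a\<bar>"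
    proof -
      have "t * (a - (real k * pi)\<^sup>2) \<le> t * \<bar>a\<bar>"
        by (rule mult_left_mono[OF _ t(1)]) (use zero_le_power2[of "real k * pi"] abs_ge_self[of a] in linarith)
      also have "\<dots> \<le> T * \<bar>a\<bar>" using t by (intro mult_right_mono) auto
      finally show ?thesis .
    qed
    then have 1: "exp (t * (a - (real k * pi)\<^sup>2)) \<le> exp (T * \<bar>a\<bar>)" by simp
    have 2: "\<bar>\<Sum>i=0..m. t ^ i / fact i * fps_nth (nu_symbol k ^ i) m\<bar> \<le> (\<Sum>i=0..m. T ^ i / fact i * B i)"
    proof (rule order_trans[OF sum_abs sum_mono])
      fix i
      have "\<bar>t ^ i / fact i\<bar> \<le> T ^ i / fact i"
        using t by (simp add: abs_divide divide_right_mono power_mono)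
      then show "\<bar>t ^ i / fact i * fps_nth (nu_symbol k ^ i) m\<bar> \<le> T ^ i / fact i * B i"
        unfolding abs_mult using t by (intro mult_mono B) auto
    qed
    show ?thesis
      unfolding exp_symbol_nth abs_mult by (rule mult_mono) (use 1 2 in auto)
  qed
  then show ?thesis by (rule that)
qed

lemma bounded_symbol_exp: "0 \<le> t \<Longrightarrow> bounded_symbol (exp_symbol a t)"
  unfolding bounded_symbol_def
proof
  fix m assume "0 \<le> t"
  obtain M where "\<And>s k. 0 \<le> s \<Longrightarrow> s \<le> t \<Longrightarrow> \<bar>fps_nth (exp_symbol a s k) m\<bar> \<le> M"
    using exp_symbol_bounded by blast
  then show "\<exists>M. \<forall>k. \<bar>fps_nth (exp_symbol a t k) m\<bar> \<le> M" using \<open>0 \<le> t\<close> by blast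
qed

lemma eventually_at_right_01: "eventually (\<lambda>t::real. 0 < t \<and> t \<le> 1) (at_right 0)"
  unfolding eventually_at_right_field by (intro exI[of _ 1]) auto

definition model_semigroup :: "real \<Rightarrow> real \<Rightarrow> 'n::{finite, linorder} l2vec \<Rightarrow> 'n l2vec" where
  "model_semigroup a t = symbol_op (exp_symbol a t)"

lemma C0_semigroup_model: "C0_semigroup (model_semigroup a :: real \<Rightarrow> 'n::{finite, linorder} l2vec \<Rightarrow> _)"
  unfolding C0_semigroup_def
proof (intro conjI allI impI)
  show "bounded_linear (model_semigroup a t :: 'n l2vec \<Rightarrow> _)" if "0 \<le> t" for t
    unfolding model_semigroup_def by (rule bounded_linear_symbol_op[OF bounded_symbol_exp[OF that]])
  show "model_semigroup a 0 x = x" for x :: "'n l2vec"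
    unfolding model_semigroup_def exp_symbol_0[abs_def] by (rule symbol_op_one)
  show "model_semigroup a (s + t) x = model_semigroup a s (model_semigroup a t x)"
    if "0 \<le> s" "0 \<le> t" for s t and x :: "'n l2vec"
    unfolding model_semigroup_def symbol_op_mult[OF bounded_symbol_exp[OF that(1)] bounded_symbol_exp[OF that(2)]]
    by (simp add: exp_symbol_add[abs_def])
  show "((\<lambda>t. model_semigroup a t x) \<longlongrightarrow> x) (at_right 0)" for x :: "'n l2vec"
  proof -
    have "((\<lambda>t. symbol_op (exp_symbol a t) x) \<longlongrightarrow> symbol_op (\<lambda>k. 1) x) (at_right 0)"
    proof (rule symbol_op_tendsto)
      show "\<exists>M. (\<forall>\<^sub>F t in at_right 0. \<forall>k. \<bar>fps_nth (exp_symbol a t k) m\<bar> \<le> M) \<and> (\<forall>k::nat. \<bar>fps_nth 1 m\<bar> \<le> M)" for m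
      proof -
        obtain M where M: "\<And>t k. 0 \<le> t \<Longrightarrow> t \<le> 1 \<Longrightarrow> \<bar>fps_nth (exp_symbol a t k) m\<bar> \<le> M"
          using exp_symbol_bounded[of 1 a m] by blast
        have "\<forall>\<^sub>F t in at_right 0. \<forall>k. \<bar>fps_nth (exp_symbol a t k) m\<bar> \<le> M"
          using eventually_at_right_01 by eventually_elim (use M in simp)
        moreover have "\<bar>fps_nth (1 :: real fps) m\<bar> \<le> M" using M[of 0 0] by (simp add: exp_symbol_0)
        ultimately show ?thesis by blast
      qed
      show "((\<lambda>t. fps_nth (exp_symbol a t k) m) \<longlongrightarrow> fps_nth 1 m) (at_right 0)" for k m
        using DERIV_continuous[OF DERIV_exp_symbol[of a k m 0 "{0<..}"]]
        by (simp add: continuous_within exp_symbol_0)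
    qed
    then show ?thesis by (simp add: model_semigroup_def symbol_op_one)
  qed
qed

text \<open>The generator expected from the symbol, with its maximal domain: \<open>y\<close> has to be a vector of the space
with the coefficients prescribed by \<open>x\<close>. The symbol is unbounded in \<open>k\<close>, so this is a condition on \<open>x\<close>.\<close>

definition model_generator :: "real \<Rightarrow> ('n::{finite, linorder} l2vec \<times> 'n l2vec) set" where
  "model_generator a = {(x, y). \<forall>k p. cos_coeff y k p = symbol_action (CARD('n)) (generator_symbol a k) (cos_coeff x k) p}"

lemma cos_coeff_linear:
  "cos_coeff (x + y) k p = cos_coeff x k p + cos_coeff y k p"
  "cos_coeff (x - y) k p = cos_coeff x k p - cos_coeff y k p"
  "cos_coeff (c *\<^sub>R x) k p = c * cos_coeff x k p"
  for x y :: "'n::{finite, linorder} l2vec"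
proof -
  have lin: "linear (\<lambda>x :: 'n l2vec. cos_coeff x k p)"
    by (rule bounded_linear.linear[OF bounded_linear_cos_coeff])
  show "cos_coeff (x + y) k p = cos_coeff x k p + cos_coeff y k p" by (rule linear_add[OF lin])
  show "cos_coeff (x - y) k p = cos_coeff x k p - cos_coeff y k p" by (rule linear_diff[OF lin])
  show "cos_coeff (c *\<^sub>R x) k p = c * cos_coeff x k p" using linear_scale[OF lin] by simp
qed

text \<open>Each cosine coefficient is a continuous functional, so that the difference quotients converge
coefficientwise, and there the derivative is that of \<open>exp_symbol\<close>.\<close>

lemma generator_model_subset:
  "generator (model_semigroup a) \<subseteq> (model_generator a :: ('n::{finite, linorder} l2vec \<times> 'n l2vec) set)"
proof clarify
  fix x y :: "'n l2vec"
  assume "(x, y) \<in> generator (model_semigroup a)"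
  then have lim: "((\<lambda>t. (model_semigroup a t x - x) /\<^sub>R t) \<longlongrightarrow> y) (at_right 0)"
    by (simp add: generator_def)
  let ?N = "CARD('n)"
  have "cos_coeff y k p = symbol_action ?N (generator_symbol a k) (cos_coeff x k) p" for k p
  proof -
    define f where "f t = symbol_action ?N (exp_symbol a t k) (cos_coeff x k) p" for t
    have "(f has_real_derivative (\<Sum>m<?N. fps_nth (generator_symbol a k * exp_symbol a 0 k) m * cos_coeff x k (p + m))) (at 0 within {0<..})"
      unfolding f_def symbol_action_def by (intro DERIV_sum DERIV_cmult_right DERIV_exp_symbol)
    then have "(f has_real_derivative symbol_action ?N (generator_symbol a k) (cos_coeff x k) p) (at 0 within {0<..})"
      by (simp add: exp_symbol_0 symbol_action_def)
    then have lim_f: "((\<lambda>t. (f t - f 0) / (t - 0)) \<longlongrightarrow> symbol_action ?N (generator_symbol a k) (cos_coeff x k) p) (at_right 0)"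
      by (simp add: has_field_derivative_iff)
    have lim_y: "((\<lambda>t. cos_coeff ((model_semigroup a t x - x) /\<^sub>R t) k p) \<longlongrightarrow> cos_coeff y k p) (at_right 0)"
      by (rule bounded_linear.tendsto[OF bounded_linear_cos_coeff lim])
    have ev: "\<forall>\<^sub>F t in at_right 0. (f t - f 0) / (t - 0) = cos_coeff ((model_semigroup a t x - x) /\<^sub>R t) k p"
      using eventually_at_right_01
    proof eventually_elim
      case (elim t)
      have "f 0 = cos_coeff x k p"
        using symbol_action_const[of ?N 1] by (simp add: f_def exp_symbol_0)
      moreover have "cos_coeff (model_semigroup a t x) k p = f t"
        unfolding model_semigroup_def f_def by (rule cos_coeff_symbol_op[OF bounded_symbol_exp]) (use elim in simp)
      ultimately show ?case by (simp add: cos_coeff_linear divide_inverse mult.commute)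
    qed
    show ?thesis
      by (rule tendsto_unique[OF trivial_limit_at_right_real lim_y Lim_transform_eventually[OF lim_f ev]])
  qed
  then show "(x, y) \<in> model_generator a" by (simp add: model_generator_def)
qed

text \<open>The difference quotient of $\exp(tL)$ at $x$ is $Q_t y$ with $y = Lx$ and
$Q_t = \frac1t\int_0^t\exp(sL)\,ds$. Unlike $L$, the means $Q_t$ are bounded uniformly in the frequency,
and they tend to $1$ at each frequency as $t$ tends to $0$; hence $Q_t y$ tends to $y$.\<close>

lemma model_generator_subset:
  "(model_generator a :: ('n::{finite, linorder} l2vec \<times> 'n l2vec) set) \<subseteq> generator (model_semigroup a)"
proof clarify
  fix x y :: "'n l2vec"
  assume xy: "(x, y) \<in> model_generator a"
  let ?N = "CARD('n)"
  define Q where "Q t k = Abs_fps (\<lambda>m. integral {0..t} (\<lambda>s. fps_nth (exp_symbol a s k) m) / t)" for t k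
  have cont: "continuous_on S (\<lambda>s. fps_nth (exp_symbol a s k) m)" for S k m
    by (rule DERIV_continuous_on) (rule DERIV_exp_symbol)
  have Q_bound: "\<exists>M. (\<forall>t k. 0 < t \<and> t \<le> 1 \<longrightarrow> \<bar>fps_nth (Q t k) m\<bar> \<le> M) \<and> \<bar>fps_nth (1 :: real fps) m\<bar> \<le> M" for m
  proof -
    obtain M where M: "\<And>t k. 0 \<le> t \<Longrightarrow> t \<le> 1 \<Longrightarrow> \<bar>fps_nth (exp_symbol a t k) m\<bar> \<le> M"
      using exp_symbol_bounded[of 1 a m] by blast
    have "\<bar>fps_nth (Q t k) m\<bar> \<le> M" if t: "0 < t" "t \<le> 1" for t k
    proof -
      have "norm (integral {0..t} (\<lambda>s. fps_nth (exp_symbol a s k) m)) \<le> M * (t - 0)"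
        by (rule integral_bound[OF _ cont]) (use t M in auto)
      then show ?thesis using t by (simp add: Q_def abs_divide divide_le_eq)
    qed
    moreover have "\<bar>fps_nth (1 :: real fps) m\<bar> \<le> M" using M[of 0 0] by (simp add: exp_symbol_0)
    ultimately show ?thesis by blast
  qed
  have Q_bounded: "bounded_symbol (Q t)" if "0 < t" "t \<le> 1" for t
    unfolding bounded_symbol_def using Q_bound that by blast
  have Q_mult: "fps_const t * (Q t k * generator_symbol a k) = exp_symbol a t k - 1" if t: "0 < t" for t k
  proof (rule fps_ext)
    fix m
    let ?E = "\<lambda>i s. fps_nth (exp_symbol a s k) i" and ?L = "\<lambda>i. fps_nth (generator_symbol a k) i"
    have "((\<lambda>s. fps_nth (generator_symbol a k * exp_symbol a s k) m) has_integral ?E m t - ?E m 0) {0..t}"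
      using t DERIV_exp_symbol
      by (intro fundamental_theorem_of_calculus) (auto simp: has_real_derivative_iff_has_vector_derivative[symmetric])
    moreover have "((\<lambda>s. \<Sum>i=0..m. ?L i * ?E (m - i) s) has_integral (\<Sum>i=0..m. ?L i * integral {0..t} (?E (m - i)))) {0..t}"
      by (intro has_integral_sum has_integral_mult_right integrable_integral integrable_continuous_interval cont) simp
    ultimately have "?E m t - ?E m 0 = (\<Sum>i=0..m. ?L i * integral {0..t} (?E (m - i)))"
      unfolding fps_mult_nth by (rule has_integral_unique)
    moreover have "fps_nth (fps_const t * (generator_symbol a k * Q t k)) m = (\<Sum>i=0..m. ?L i * integral {0..t} (?E (m - i)))"
      using t by (simp add: fps_mult_left_const_nth fps_mult_nth[of "generator_symbol a k"] Q_def sum_distrib_left)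
    ultimately show "fps_nth (fps_const t * (Q t k * generator_symbol a k)) m = fps_nth (exp_symbol a t k - 1) m"
      by (simp add: exp_symbol_0 mult.commute)
  qed
  have quotient: "symbol_op (Q t) y = (model_semigroup a t x - x) /\<^sub>R t" if t: "0 < t" "t \<le> 1" for t
  proof (rule vec_cos_coeff_eqI)
    fix k p
    have y: "cos_coeff y k = symbol_action ?N (generator_symbol a k) (cos_coeff x k)"
      using xy by (auto simp: model_generator_def)
    have "t * cos_coeff (symbol_op (Q t) y) k p = t * symbol_action ?N (Q t k * generator_symbol a k) (cos_coeff x k) p"
      by (simp add: cos_coeff_symbol_op Q_bounded t y symbol_action_mult cos_coeff_beyond)
    also have "\<dots> = symbol_action ?N (fps_const t) (symbol_action ?N (Q t k * generator_symbol a k) (cos_coeff x k)) p"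
      by (rule symbol_action_const[symmetric]) simp
    also have "\<dots> = symbol_action ?N (exp_symbol a t k - 1) (cos_coeff x k) p"
      by (simp only: symbol_action_mult[OF cos_coeff_beyond] Q_mult[OF t(1)])
    also have "\<dots> = cos_coeff (model_semigroup a t x - x) k p"
      using t symbol_action_const[of ?N 1 "cos_coeff x k" p]
      by (simp add: symbol_action_diff cos_coeff_linear model_semigroup_def cos_coeff_symbol_op bounded_symbol_exp)
    finally show "cos_coeff (symbol_op (Q t) y) k p = cos_coeff ((model_semigroup a t x - x) /\<^sub>R t) k p"
      using t by (simp add: cos_coeff_linear field_simps)
  qed
  have "((\<lambda>t. symbol_op (Q t) y) \<longlongrightarrow> symbol_op (\<lambda>k. 1) y) (at_right 0)"
  proof (rule symbol_op_tendsto)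
    show "\<exists>M. (\<forall>\<^sub>F t in at_right 0. \<forall>k. \<bar>fps_nth (Q t k) m\<bar> \<le> M) \<and> (\<forall>k::nat. \<bar>fps_nth 1 m\<bar> \<le> M)" for m
    proof -
      obtain M where M: "\<And>t k. 0 < t \<and> t \<le> 1 \<Longrightarrow> \<bar>fps_nth (Q t k) m\<bar> \<le> M" "\<bar>fps_nth (1 :: real fps) m\<bar> \<le> M"
        using Q_bound by blast
      have "\<forall>\<^sub>F t in at_right 0. \<forall>k. \<bar>fps_nth (Q t k) m\<bar> \<le> M"
        using eventually_at_right_01 by eventually_elim (use M in blast)
      then show ?thesis using M(2) by blast
    qed
    show "((\<lambda>t. fps_nth (Q t k) m) \<longlongrightarrow> fps_nth 1 m) (at_right 0)" for k m
    proof -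
      have "((\<lambda>t. integral {0..t} (\<lambda>s. fps_nth (exp_symbol a s k) m)) has_real_derivative fps_nth (exp_symbol a 0 k) m) (at 0 within {0..1})"
        by (rule integral_has_real_derivative[OF cont]) simp
      then show ?thesis
        by (simp add: has_field_derivative_iff at_within_Icc_at_right exp_symbol_0 Q_def)
    qed
  qed
  moreover have "\<forall>\<^sub>F t in at_right 0. symbol_op (Q t) y = (model_semigroup a t x - x) /\<^sub>R t"
    using eventually_at_right_01 by eventually_elim (simp add: quotient)
  ultimately have "((\<lambda>t. (model_semigroup a t x - x) /\<^sub>R t) \<longlongrightarrow> symbol_op (\<lambda>k. 1) y) (at_right 0)"
    by (rule Lim_transform_eventually)
  then show "(x, y) \<in> generator (model_semigroup a)"
    by (simp add: generator_def symbol_op_one)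
qed

lemma generator_model: "generator (model_semigroup a) = (model_generator a :: ('n::{finite, linorder} l2vec \<times> _) set)"
  using generator_model_subset model_generator_subset by blast

section \<open>Identification of the generator\<close>

lemma C0_semigroup_similar:
  fixes T :: "real \<Rightarrow> 'h::banach \<Rightarrow> 'h"
  assumes T: "C0_semigroup T" and U: "bounded_linear U" and V: "bounded_linear V"
    and UV: "\<And>x. U (V x) = x" and VU: "\<And>x. V (U x) = x"
  shows "C0_semigroup (\<lambda>t x. U (T t (V x)))"
    and "generator (\<lambda>t x. U (T t (V x))) = (\<lambda>(x, y). (U x, U y)) ` generator T"
proof -
  show "C0_semigroup (\<lambda>t x. U (T t (V x)))"
    unfolding C0_semigroup_def
  proof (intro conjI allI impI)
    show "bounded_linear (\<lambda>x. U (T t (V x)))" if "0 \<le> t" for t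
      using T that unfolding C0_semigroup_def
      by (intro bounded_linear_compose[OF U] bounded_linear_compose[OF _ V, of "T t"]) auto
    show "((\<lambda>t. U (T t (V x))) \<longlongrightarrow> x) (at_right 0)" for x
      using bounded_linear.tendsto[OF U, of "\<lambda>t. T t (V x)" "V x"] T by (simp add: C0_semigroup_def UV)
  qed (use T in \<open>auto simp: C0_semigroup_def UV VU\<close>)
  have quotient: "(U (T t (V x)) - x) /\<^sub>R t = U ((T t (V x) - V x) /\<^sub>R t)"
    "(T t (V x) - V x) /\<^sub>R t = V ((U (T t (V x)) - x) /\<^sub>R t)" for t x
    using bounded_linear.linear[OF U] bounded_linear.linear[OF V]
    by (simp_all add: linear_scale linear_diff UV VU)
  have "(x, y) \<in> generator (\<lambda>t x. U (T t (V x))) \<longleftrightarrow> (V x, V y) \<in> generator T" for x y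
  proof
    assume "(x, y) \<in> generator (\<lambda>t x. U (T t (V x)))"
    then have "((\<lambda>t. V ((U (T t (V x)) - x) /\<^sub>R t)) \<longlongrightarrow> V y) (at_right 0)"
      unfolding generator_def by (auto intro: bounded_linear.tendsto[OF V])
    then show "(V x, V y) \<in> generator T" by (simp add: generator_def quotient(2)[symmetric])
  next
    assume "(V x, V y) \<in> generator T"
    then have "((\<lambda>t. U ((T t (V x) - V x) /\<^sub>R t)) \<longlongrightarrow> U (V y)) (at_right 0)"
      unfolding generator_def by (auto intro: bounded_linear.tendsto[OF U])
    then show "(x, y) \<in> generator (\<lambda>t x. U (T t (V x)))"
      by (simp add: generator_def quotient(1)[symmetric] UV)
  qed
  then show "generator (\<lambda>t x. U (T t (V x))) = (\<lambda>(x, y). (U x, U y)) ` generator T"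
    by (force simp: image_iff UV VU)
qed

text \<open>Truncation to finitely many frequencies gives finite combinations of basis vectors, for which the claim
is \<open>transform_axis_graph\<close>. The truncations of both components converge, and the graph is closed.\<close>

lemma transform_model_generator:
  fixes x y :: "'n::{finite, linorder} l2vec"
  assumes xy: "(x, y) \<in> model_generator a"
  shows "(transform x, transform y) \<in> graph_A a"
proof -
  let ?N = "CARD('n)"
  define part where "part n x = (\<Sum>k<n. \<Sum>i<?N. cos_coeff x k i *\<^sub>R (axis_vec i (cos_l2 k) :: 'n l2vec))"
    for n and x :: "'n l2vec"
  have lim: "(\<lambda>n. part n x) \<longlonglongrightarrow> x" for x
  proof -
    have "(\<lambda>n. \<Sum>k<n. cos_coeff x k i *\<^sub>R cos_l2 k) \<longlonglongrightarrow> crd x i" for i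
      using cosb.fourier_sums[of "crd x i"] by (simp add: sums_def cos_coeff_def)
    then have "(\<lambda>n. \<Sum>i<?N. axis_vec i (\<Sum>k<n. cos_coeff x k i *\<^sub>R cos_l2 k)) \<longlonglongrightarrow> (\<Sum>i<?N. axis_vec i (crd x i) :: 'n l2vec)"
      by (intro tendsto_sum bounded_linear.tendsto[OF bounded_linear_axis_vec])
    moreover have "(\<Sum>i<?N. axis_vec i (\<Sum>k<n. cos_coeff x k i *\<^sub>R cos_l2 k)) = part n x" for n
      unfolding part_def
      by (subst sum.swap) (simp add: linear_sum[OF bounded_linear.linear[OF bounded_linear_axis_vec]]
          linear_scale[OF bounded_linear.linear[OF bounded_linear_axis_vec]])
    ultimately show ?thesis by (simp add: sum_axis_vec)
  qed
  have lin: "linear (transform :: 'n l2vec \<Rightarrow> _)"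
    by (rule bounded_linear.linear[OF bounded_linear_transform(1)])
  have mem: "(transform (part n x), transform (part n y)) \<in> graph_A a" for n
  proof -
    let ?v = "\<lambda>k i. axis_vec i (cos_l2 k) :: 'n l2vec"
    let ?L = "\<lambda>k m. fps_nth (generator_symbol a k) m"
    have blk: "(\<Sum>p<?N. cos_coeff y k p *\<^sub>R ?v k p) = (\<Sum>i<?N. cos_coeff x k i *\<^sub>R (\<Sum>m\<le>i. ?L k m *\<^sub>R ?v k (i - m)))" for k
    proof -
      have "(\<Sum>p<?N. cos_coeff y k p *\<^sub>R ?v k p) = (\<Sum>p<?N. \<Sum>m<?N. (?L k m * cos_coeff x k (p + m)) *\<^sub>R ?v k p)"
        using xy by (simp add: model_generator_def symbol_action_def scaleR_sum_left)
      also have "\<dots> = (\<Sum>i<?N. \<Sum>p\<le>i. (?L k (i - p) * cos_coeff x k (p + (i - p))) *\<^sub>R ?v k p)"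
        by (rule sum_square_eq_triangle) (simp add: cos_coeff_beyond)
      also have "\<dots> = (\<Sum>i<?N. \<Sum>m\<le>i. (?L k m * cos_coeff x k i) *\<^sub>R ?v k (i - m))"
      proof (rule sum.cong[OF refl])
        fix i
        show "(\<Sum>p\<le>i. (?L k (i - p) * cos_coeff x k (p + (i - p))) *\<^sub>R ?v k p)
            = (\<Sum>m\<le>i. (?L k m * cos_coeff x k i) *\<^sub>R ?v k (i - m))"
          by (rule sum.reindex_bij_witness[where i = "\<lambda>m. i - m" and j = "\<lambda>m. i - m"]) auto
      qed
      also have "\<dots> = (\<Sum>i<?N. cos_coeff x k i *\<^sub>R (\<Sum>m\<le>i. ?L k m *\<^sub>R ?v k (i - m)))"
        by (simp add: scaleR_sum_right mult.commute)
      finally show ?thesis .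
    qed
    have "(transform (part n x), transform (part n y))
        = (\<Sum>k<n. \<Sum>i<?N. cos_coeff x k i *\<^sub>R (transform (?v k i), transform (\<Sum>m\<le>i. ?L k m *\<^sub>R ?v k (i - m))))"
      unfolding part_def blk by (simp add: linear_sum[OF lin] linear_scale[OF lin] sum_prod scaleR_Pair)
    also have "\<dots> \<in> graph_A a"
      by (intro subspace_sum subspace_scale graph_A_closed_subspace(2) transform_axis_graph) simp
    finally show ?thesis .
  qed
  show ?thesis
  proof (rule closed_sequentially[OF graph_A_closed_subspace(1)])
    show "(transform (part n x), transform (part n y)) \<in> graph_A a" for n by (rule mem)
    show "(\<lambda>n. (transform (part n x), transform (part n y))) \<longlonglongrightarrow> (transform x, transform y)"
      by (intro tendsto_Pair bounded_linear.tendsto[OF bounded_linear_transform(1)] lim)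
  qed
qed

text \<open>The inverse of $a + 1 - L$ at frequency \<open>k\<close>, where $L$ is the symbol of the generator. At the point $a + 1$
the constant coefficient is $1 + k^2\pi^2 \ge 1$, which keeps the inverses bounded in \<open>k\<close>.\<close>

definition resolvent_symbol :: "nat \<Rightarrow> real fps" where
  "resolvent_symbol k = inverse (fps_const (1 + (real k * pi)\<^sup>2) - nu_symbol k)"

lemma resolvent_symbol_mult:
  "(fps_const (1 + (real k * pi)\<^sup>2) - nu_symbol k) * resolvent_symbol k = 1"
proof -
  have "1 + (real k * pi)\<^sup>2 \<noteq> 0" using zero_le_power2[of "real k * pi"] by linarith
  then show ?thesis
    unfolding resolvent_symbol_def by (intro inverse_mult_eq_1') (simp add: nu_symbol_nth_0)
qed

text \<open>The recursion for the coefficients of an inverse power series divides by $1 + k^2\pi^2 \ge 1$ in each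
step, so bounds for smaller indices carry over.\<close>

lemma bounded_symbol_resolvent: "bounded_symbol resolvent_symbol"
  unfolding bounded_symbol_def
proof
  fix m
  obtain B where B: "\<And>i k. \<bar>fps_nth (nu_symbol k) i\<bar> \<le> B i"
    using bounded_symbol_nu unfolding bounded_symbol_def by metis
  show "\<exists>M. \<forall>k. \<bar>fps_nth (resolvent_symbol k) m\<bar> \<le> M"
  proof (induction m rule: less_induct)
    case (less m)
    then obtain R where R: "\<And>j k. j < m \<Longrightarrow> \<bar>fps_nth (resolvent_symbol k) j\<bar> \<le> R j" by metis
    have "\<bar>fps_nth (resolvent_symbol k) m\<bar> \<le> 1 + (\<Sum>i\<in>{1..m}. B i * R (m - i))" for k
    proof -
      let ?r = "fps_nth (resolvent_symbol k)" and ?c = "1 + (real k * pi)\<^sup>2"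
      have c: "1 \<le> ?c" by simp
      have "?c * ?r m - (\<Sum>i=0..m. fps_nth (nu_symbol k) i * ?r (m - i)) = fps_nth (1 :: real fps) m"
        using resolvent_symbol_mult[of k, THEN arg_cong, of "\<lambda>f. fps_nth f m"]
        by (simp add: left_diff_distrib fps_mult_nth[of "nu_symbol k"])
      moreover have "{0..m} = insert 0 {1..m}" by auto
      ultimately have eq: "?c * ?r m = fps_nth (1 :: real fps) m + (\<Sum>i\<in>{1..m}. fps_nth (nu_symbol k) i * ?r (m - i))"
        by (simp add: nu_symbol_nth_0)
      have "\<bar>?r m\<bar> \<le> ?c * \<bar>?r m\<bar>" using mult_right_mono[OF c, of "\<bar>?r m\<bar>"] by simp
      also have "\<dots> = \<bar>?c * ?r m\<bar>" using c by (simp add: abs_mult)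
      also have "\<dots> \<le> \<bar>fps_nth (1 :: real fps) m\<bar> + \<bar>\<Sum>i\<in>{1..m}. fps_nth (nu_symbol k) i * ?r (m - i)\<bar>"
        unfolding eq by (rule abs_triangle_ineq)
      also have "\<dots> \<le> 1 + (\<Sum>i\<in>{1..m}. B i * R (m - i))"
      proof (rule add_mono)
        show "\<bar>\<Sum>i\<in>{1..m}. fps_nth (nu_symbol k) i * ?r (m - i)\<bar> \<le> (\<Sum>i\<in>{1..m}. B i * R (m - i))"
        proof (rule order_trans[OF sum_abs sum_mono])
          fix i assume "i \<in> {1..m}"
          then show "\<bar>fps_nth (nu_symbol k) i * ?r (m - i)\<bar> \<le> B i * R (m - i)"
            unfolding abs_mult using order_trans[OF abs_ge_zero B] by (intro mult_mono B R) auto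
        qed
      qed simp
      finally show ?thesis .
    qed
    then show ?case by blast
  qed
qed

lemma model_generator_resolvent:
  fixes w :: "'n::{finite, linorder} l2vec"
  shows "(symbol_op resolvent_symbol w, (a + 1) *\<^sub>R symbol_op resolvent_symbol w - w) \<in> model_generator a"
  unfolding model_generator_def
proof clarify
  fix k p
  let ?N = "CARD('n)" and ?R = "resolvent_symbol k" and ?x = "symbol_op resolvent_symbol w"
  have x: "cos_coeff ?x k = symbol_action ?N ?R (cos_coeff w k)"
    by (rule ext) (rule cos_coeff_symbol_op[OF bounded_symbol_resolvent])
  have "generator_symbol a k = fps_const (a + 1) - (fps_const (1 + (real k * pi)\<^sup>2) - nu_symbol k)"
    by (rule fps_ext) (simp add: generator_symbol_def)
  then have "generator_symbol a k * ?R = fps_const (a + 1) * ?R - 1"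
    by (simp only: left_diff_distrib[of "fps_const (a + 1)" "fps_const (1 + (real k * pi)\<^sup>2) - nu_symbol k" ?R]
        resolvent_symbol_mult)
  then have "symbol_action ?N (generator_symbol a k) (cos_coeff ?x k) p = symbol_action ?N (fps_const (a + 1) * ?R - 1) (cos_coeff w k) p"
    unfolding x by (simp add: symbol_action_mult cos_coeff_beyond)
  also have "\<dots> = symbol_action ?N (fps_const (a + 1)) (cos_coeff ?x k) p - symbol_action ?N (fps_const 1) (cos_coeff w k) p"
    unfolding symbol_action_diff x by (simp add: symbol_action_mult cos_coeff_beyond)
  also have "\<dots> = cos_coeff ((a + 1) *\<^sub>R ?x - w) k p"
    using symbol_action_const[of ?N 1 "cos_coeff w k" p] by (simp add: symbol_action_const cos_coeff_linear)
  finally show "cos_coeff ((a + 1) *\<^sub>R ?x - w) k p = symbol_action ?N (generator_symbol a k) (cos_coeff ?x k) p" ..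
qed

text \<open>If $(f, y)$ is in the graph, surjectivity provides an element of the generator to which $a + 1$ minus the
operator assigns the same image $(a + 1) f - y$. The difference of the two is in the graph and is
annihilated by $a + 1$ minus the operator, so it is zero by \<open>graph_A_injective\<close>.\<close>

lemma graph_A_eq_transform_model_generator:
  "graph_A a = (\<lambda>(x, y). (transform x, transform y)) ` (model_generator a :: ('n::{finite, linorder} l2vec \<times> 'n l2vec) set)"
proof (rule equalityI)
  show "(\<lambda>(x, y). (transform x, transform y)) ` (model_generator a :: ('n l2vec \<times> 'n l2vec) set) \<subseteq> graph_A a"
    using transform_model_generator by auto
  show "graph_A a \<subseteq> (\<lambda>(x, y). (transform x, transform y)) ` (model_generator a :: ('n l2vec \<times> 'n l2vec) set)"
  proof clarify
    fix f y :: "'n l2vec" assume fy: "(f, y) \<in> graph_A a"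
    have lin: "linear (transform :: 'n l2vec \<Rightarrow> _)"
      by (rule bounded_linear.linear[OF bounded_linear_transform(1)])
    define w where "w = (a + 1) *\<^sub>R f - y"
    define x where "x = symbol_op resolvent_symbol (transform_inv w)"
    define z where "z = (a + 1) *\<^sub>R x - transform_inv w"
    have xz: "(x, z) \<in> model_generator a"
      unfolding x_def z_def by (rule model_generator_resolvent)
    have tz: "transform z = (a + 1) *\<^sub>R transform x - w"
      unfolding z_def by (simp add: linear_diff[OF lin] linear_scale[OF lin] transform_inverse)
    have "(f, y) - (transform x, transform z) \<in> graph_A a"
      by (intro subspace_diff graph_A_closed_subspace(2) fy transform_model_generator xz)
    moreover have "(f, y) - (transform x, transform z) = (f - transform x, (a + 1) *\<^sub>R (f - transform x))"
      unfolding tz w_def by (simp add: algebra_simps)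
    ultimately have "f - transform x = 0" using graph_A_injective by metis
    then have "f = transform x" "y = transform z" unfolding tz w_def by simp_all
    then show "(f, y) \<in> (\<lambda>(x, y). (transform x, transform y)) ` model_generator a"
      using xz by (intro image_eqI[of _ _ "(x, z)"]) auto
  qed
qed

theorem generates_C0_semigroup_op_A:
  "generates_C0_semigroup dom_A (op_A a :: 'n::{finite, linorder} l2vec \<Rightarrow> 'n l2vec)"
  unfolding generates_C0_semigroup_def
proof (intro exI conjI)
  let ?T = "\<lambda>t x. transform (model_semigroup a t (transform_inv x)) :: 'n l2vec"
  note similar = C0_semigroup_similar[OF C0_semigroup_model bounded_linear_transform transform_inverse]
  show "C0_semigroup ?T" by (rule similar(1))
  have "generator ?T = graph_A a"
    unfolding similar(2) generator_model graph_A_eq_transform_model_generator ..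
  also have "\<dots> = {(x, op_A a x) |x. x \<in> dom_A}"
    using graph_A_iff by force
  finally show "generator ?T = {(x, op_A a x) |x. x \<in> dom_A}" .
qed

theorem lemma11:
  fixes a :: real
  shows "riesz_basis ({1..CARD('n)} \<times> UNIV)
           (\<lambda>(i, k). phi i k :: l2 ^ 'n::{finite, linorder}) \<and>
         generates_C0_semigroup dom_A (op_A a :: l2 ^ 'n::{finite, linorder} \<Rightarrow> l2 ^ 'n::{finite, linorder})"
  using riesz_basis_phi generates_C0_semigroup_op_A by blast

end
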